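(* For each $n\in\mathbb{N}$ let $(u_w)_{w\in\Sigma_n}$ be a solution of the self-similar interacting particle system $$\dot u_w=f(t,u_w)+\sum_{|v|=n}W_{wv}D(u_w,u_v)\,\nu(K_v),\quad w\in\Sigma_n,$$ and for $m,\ell\in\mathbb{N}$ and $n=m+\ell$ let $$\bar{\mathfrak m}^x_{m,\ell,t}(A)=\frac1{k^\ell}\sum_{|j|=\ell}\mathbf{1}_A\big(u_{wj}(t)\big),\qquad A\in\mathcal{B}(\mathbb{R}^q),\ x\in K_w,\ |w|=m,$$ be the local empirical measures. Let $\bar\rho$ be the solution of the initial value problem for the Vlasov equation $$\partial_t\bar\rho(t,u,x)+\partial_u\{V(t,u,x)\bar\rho(t,u,x)\}=0,$$ $$V(t,u,x)=f(t,u)+\int_K\int_{\mathbb{R}^q}W(x,y)D(u,v)\bar\rho(t,v,y)\,dv\,d\nu(y),$$ where $\bar\rho(t,\cdot,x)$ is a probability density on $\mathbb{R}^q$ for $x\in K$, and let $$\bar{\mathfrak m}^x_t(A)=\int_A\bar\rho(t,u,x)\,du,\qquad A\in\mathcal{B}(\mathbb{R}^q).$$ Suppose that $\bar{\mathfrak m}^x_{m,\ell,0}$ converges weakly to $\bar{\mathfrak m}^x_0$ for $\nu$-almost every $x\in K$ as $m,\ell\to\infty$. Then for any given $\epsilon,T>0$ and all sufficiently large $m,\ell\in\mathbb{N}$, $$\sup_{t\in[0,T]}\int_K d_{BL}\big(\bar{\mathfrak m}^x_{m,\ell,t},\bar{\mathfrak m}^x_t\big)\,d\nu(x)<\epsilon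 .$$
   Context: A contracting iterated function system (IFS) on $\mathbb{R}^d$ is a finite family of injective maps $f_i:\mathbb{R}^d\to\mathbb{R}^d$, $i\in[k]=\{1,\dots,k\}$, with $|f_i(x)-f_i(y)|\le r_i|x-y|$, $0<r_i<1$, whose fixed points are not all identical. Its attractor is the unique nonempty compact $K$ with $K=\bigcup_i f_i(K)$. $\Sigma_n=[k]^n$ is the set of words of length $n$ ($|w|=n$ means $w\in\Sigma_n$), $wj$ denotes concatenation of words, $f_w=f_{w_1}\circ\cdots\circ f_{w_n}$ and $K_w=f_w(K)$. The measure $\nu$ is the stationary Borel probability measure on $K$ for the uniform probability vector, $\nu(A)=\frac1k\sum_{j}\nu(f_j^{-1}(A))$, and it is assumed that $\nu(K_w)=k^{-n}$ for all $w\in\Sigma_n$, $n\in\mathbb{N}$ (so that distinct $K_w,K_v$ with $|w|=|v|$ overlap in a $\nu$-null set). Data: $W\in L^2(K\times K,\nu\times\nu)$ is real-valued with $\max\{\operatorname{ess\,sup}_x\int_K|W(x,y)|d\nu(y),\ \operatorname{ess\,sup}_y\int_K|W(x,y)|d\nu(x)\}<\infty$, and $W_{wv}=\frac1{\nu(K_w)\nu(K_v)}\int_{K_w\times K_v}W\,d(\nu\times\nu)$. The functions $f:\mathbb{R}\times\mathbb{R}^q\to\mathbb{R}^q$ and $D:\mathbb{R}^q\times\mathbb{R}^q\to\mathbb{R}^q$ are jointly continuous, $|f(t,u)-f(t,u')|\le L_f|u-u'|$, $|D(u,v)-D(u',v')|\le L_D(|u-u'|+|v-v'|)$, and $\sup|D|\le1$.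 (The function $f(t,u)$ is unrelated to the maps $f_i$.) $\partial_u\{\cdot\}$ denotes the divergence in $u\in\mathbb{R}^q$. $d_{BL}$ is the bounded Lipschitz distance between Borel probability measures on $\mathbb{R}^q$: $d_{BL}(\mu_1,\mu_2)=\sup\big|\int h\,d\mu_1-\int h\,d\mu_2\big|$, the supremum being over $h:\mathbb{R}^q\to\mathbb{R}$ with $\sup|h|+\operatorname{Lip}(h)\le1$. *)

theory Defs
  imports "HOL-Probability.Probability"
begin

section \<open>Contracting iterated function systems on a Euclidean space\<close>

definition contracting_ifs :: "nat \<Rightarrow> (nat \<Rightarrow> 'a::euclidean_space \<Rightarrow> 'a) \<Rightarrow> bool" where
  "contracting_ifs k F \<longleftrightarrow>
     (\<forall>i\<in>{1..k}. inj (F i) \<and>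
        (\<exists>r. 0 < r \<and> r < 1 \<and> (\<forall>x y. norm (F i x - F i y) \<le> r * norm (x - y)))) \<and>
     (\<exists>i\<in>{1..k}. \<exists>j\<in>{1..k}. \<exists>x y. F i x = x \<and> F j y = y \<and> x \<noteq> y)"

definition attractor :: "nat \<Rightarrow> (nat \<Rightarrow> 'a::euclidean_space \<Rightarrow> 'a) \<Rightarrow> 'a set \<Rightarrow> bool" where
  "attractor k F K \<longleftrightarrow> compact K \<and> K \<noteq> {} \<and> K = (\<Union>i\<in>{1..k}. F i ` K)"

definition words :: "nat \<Rightarrow> nat \<Rightarrow> nat list set" where
  "words k n = {w. set w \<subseteq> {1..k} \<and> length w = n}"

definition word_map :: "(nat \<Rightarrow> 'a \<Rightarrow> 'a) \<Rightarrow> nat list \<Rightarrow> 'a \<Rightarrow> 'a" where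
  "word_map F w = foldr (\<lambda>i g. F i \<circ> g) w id"

definition cell :: "(nat \<Rightarrow> 'a \<Rightarrow> 'a) \<Rightarrow> 'a set \<Rightarrow> nat list \<Rightarrow> 'a set" where
  "cell F K w = word_map F w ` K"

text \<open>The measure lives on the space \<^term>\<open>K\<close>, so every integral against it is an integral
  over \<^term>\<open>K\<close>; accordingly the preimages are taken inside \<^term>\<open>K\<close>.\<close>

definition stationary_measure ::
  "nat \<Rightarrow> (nat \<Rightarrow> 'a::euclidean_space \<Rightarrow> 'a) \<Rightarrow> 'a set \<Rightarrow> 'a measure \<Rightarrow> bool" where
  "stationary_measure k F K \<nu> \<longleftrightarrow>
     prob_space \<nu> \<and> sets \<nu> = sets (restrict_space borel K) \<and>
     (\<forall>A\<in>sets \<nu>. measure \<nu> A = 1 / real k * (\<Sum>j\<in>{1..k}. measure \<nu> (F j -` A \<inter> K)))"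


section \<open>The interacting particle system\<close>

definition cell_average ::
  "(nat \<Rightarrow> 'a \<Rightarrow> 'a) \<Rightarrow> 'a set \<Rightarrow> 'a measure \<Rightarrow> ('a \<times> 'a \<Rightarrow> real) \<Rightarrow> nat list \<Rightarrow> nat list \<Rightarrow> real" where
  "cell_average F K \<nu> W w v =
     1 / (measure \<nu> (cell F K w) * measure \<nu> (cell F K v)) *
     set_lebesgue_integral (\<nu> \<Otimes>\<^sub>M \<nu>) (cell F K w \<times> cell F K v) W"

text \<open>A word determines its length, so one family \<^term>\<open>u\<close> indexed by all words
  carries the solutions of the systems of all levels \<^term>\<open>n\<close>.\<close>

definition particle_solution ::
  "nat \<Rightarrow> (nat \<Rightarrow> 'a \<Rightarrow> 'a) \<Rightarrow> 'a set \<Rightarrow> 'a measure \<Rightarrow> ('a \<times> 'a \<Rightarrow> real) \<Rightarrow>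
   (real \<Rightarrow> 'b::euclidean_space \<Rightarrow> 'b) \<Rightarrow> ('b \<Rightarrow> 'b \<Rightarrow> 'b) \<Rightarrow> nat \<Rightarrow> (nat list \<Rightarrow> real \<Rightarrow> 'b) \<Rightarrow> bool" where
  "particle_solution k F K \<nu> W f D n u \<longleftrightarrow>
     (\<forall>w\<in>words k n. \<forall>t\<ge>0.
        (u w has_vector_derivative
           f t (u w t) + (\<Sum>v\<in>words k n.
             (cell_average F K \<nu> W w v * measure \<nu> (cell F K v)) *\<^sub>R D (u w t) (u v t)))
        (at t within {0..}))"

text \<open>A point \<^term>\<open>x\<close> may lie in several cells of the same level. Under the hypotheses of the
  main theorem these points form a null set, so the choice is immaterial.\<close>

definition word_of :: "nat \<Rightarrow> (nat \<Rightarrow> 'a \<Rightarrow> 'a) \<Rightarrow> 'a set \<Rightarrow> nat \<Rightarrow> 'a \<Rightarrow> nat list" where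
  "word_of k F K m x = (SOME w. w \<in> words k m \<and> x \<in> cell F K w)"

definition local_empirical ::
  "nat \<Rightarrow> (nat \<Rightarrow> 'a \<Rightarrow> 'a) \<Rightarrow> 'a set \<Rightarrow> (nat list \<Rightarrow> real \<Rightarrow> 'b::euclidean_space) \<Rightarrow>
   nat \<Rightarrow> nat \<Rightarrow> real \<Rightarrow> 'a \<Rightarrow> 'b measure" where
  "local_empirical k F K u m l t x =
     distr (uniform_count_measure (words k l)) borel (\<lambda>j. u (word_of k F K m x @ j) t)"

lemma finite_words [simp]: "finite (words k n)"
  unfolding words_def by (intro finite_lists_length_eq) simp

lemma card_words: "card (words k n) = k ^ n"
  unfolding words_def by (simp add: card_lists_length_eq)

lemma measure_local_empirical:
  assumes "A \<in> sets borel"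
  shows "measure (local_empirical k F K u m l t x) A =
    1 / real (k ^ l) * (\<Sum>j\<in>words k l. indicator A (u (word_of k F K m x @ j) t))"
proof -
  have m: "(\<lambda>j. u (word_of k F K m x @ j) t) \<in> measurable (uniform_count_measure (words k l)) borel"
    by (simp add: uniform_count_measure_def)
  have "measure (local_empirical k F K u m l t x) A =
    measure (uniform_count_measure (words k l))
      {j \<in> words k l. u (word_of k F K m x @ j) t \<in> A}"
    unfolding local_empirical_def
    by (subst measure_distr[OF m assms])
       (auto simp: space_uniform_count_measure intro!: arg_cong[where f = "measure _"])
  also have "\<dots> = card {j \<in> words k l. u (word_of k F K m x @ j) t \<in> A} / card (words k l)"
    by (subst measure_uniform_count_measure) auto
  also have "real (card {j \<in> words k l. u (word_of k F K m x @ j) t \<in> A}) =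
    (\<Sum>j\<in>words k l. indicator A (u (word_of k F K m x @ j) t))"
    by (simp add: indicator_def sum.If_cases Int_def)
  finally show ?thesis by (simp add: card_words)
qed


section \<open>The Vlasov equation\<close>

definition vlasov_field ::
  "'a measure \<Rightarrow> ('a \<times> 'a \<Rightarrow> real) \<Rightarrow> (real \<Rightarrow> 'b::euclidean_space \<Rightarrow> 'b) \<Rightarrow> ('b \<Rightarrow> 'b \<Rightarrow> 'b) \<Rightarrow>
   (real \<Rightarrow> 'b \<Rightarrow> 'a \<Rightarrow> real) \<Rightarrow> real \<Rightarrow> 'b \<Rightarrow> 'a \<Rightarrow> 'b" where
  "vlasov_field \<nu> W f D \<rho> t u x =
     f t u + (LINT y|\<nu>. (LINT v|lborel. (W (x, y) * \<rho> t v y) *\<^sub>R D u v))"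

definition test_function :: "('b::euclidean_space \<Rightarrow> real) \<Rightarrow> ('b \<Rightarrow> 'b) \<Rightarrow> bool" where
  "test_function \<phi> g \<longleftrightarrow>
     (\<forall>u. GDERIV \<phi> u :> g u) \<and> continuous_on UNIV g \<and> bounded {u. \<phi> u \<noteq> 0}"

text \<open>For merely Lipschitz coefficients the divergence of \<open>V \<rho>\<close> is understood in the sense of
  distributions: the equation is tested against compactly supported \<open>C\<^sup>1\<close> functions \<open>\<phi>\<close> of \<open>u\<close>
  (with gradient \<open>g\<close>) and integrated in time from \<open>0\<close> to \<open>t\<close>. The initial value
  enters through \<open>\<rho> 0\<close>. Weak continuity of \<open>t \<mapsto> \<rho> t\<close> follows from the integrated equation.\<close>

definition vlasov_solution ::
  "'a set \<Rightarrow> 'a measure \<Rightarrow> ('a \<times> 'a \<Rightarrow> real) \<Rightarrow> (real \<Rightarrow> 'b::euclidean_space \<Rightarrow> 'b) \<Rightarrow>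
   ('b \<Rightarrow> 'b \<Rightarrow> 'b) \<Rightarrow> (real \<Rightarrow> 'b \<Rightarrow> 'a \<Rightarrow> real) \<Rightarrow> bool" where
  "vlasov_solution K \<nu> W f D \<rho> \<longleftrightarrow>
     (\<lambda>(t, u, x). \<rho> t u x) \<in>
        borel_measurable (restrict_space borel {0..} \<Otimes>\<^sub>M borel \<Otimes>\<^sub>M \<nu>) \<and>
     (\<forall>t\<ge>0. \<forall>x\<in>K. (\<forall>u. 0 \<le> \<rho> t u x) \<and> (\<integral>\<^sup>+u. ennreal (\<rho> t u x) \<partial>lborel) = 1) \<and>
     (AE x in \<nu>. \<forall>t\<ge>0. \<forall>\<phi> g. test_function \<phi> g \<longrightarrow>
        (LINT u|lborel. \<phi> u * \<rho> t u x) - (LINT u|lborel. \<phi> u * \<rho> 0 u x) =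
        (LINT s:{0..t}|lborel.
           (LINT u|lborel. (g u \<bullet> vlasov_field \<nu> W f D \<rho> s u x) * \<rho> s u x)))"

definition vlasov_measure :: "(real \<Rightarrow> 'b::euclidean_space \<Rightarrow> 'a \<Rightarrow> real) \<Rightarrow> real \<Rightarrow> 'a \<Rightarrow> 'b measure" where
  "vlasov_measure \<rho> t x = density lborel (\<lambda>u. ennreal (\<rho> t u x))"


section \<open>Weak convergence and the bounded Lipschitz distance\<close>

text \<open>The library's \<^term>\<open>weak_conv_m\<close> covers only sequences of measures on the real line.\<close>

definition weakly_converges ::
  "('i \<Rightarrow> 'b::euclidean_space measure) \<Rightarrow> 'b measure \<Rightarrow> 'i filter \<Rightarrow> bool" where
  "weakly_converges M L \<F> \<longleftrightarrow>
     (\<forall>h :: 'b \<Rightarrow> real. continuous_on UNIV h \<and> bounded (range h) \<longrightarrow>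
        ((\<lambda>i. LINT u|M i. h u) \<longlongrightarrow> (LINT u|L. h u)) \<F>)"

definition sup_abs :: "('b \<Rightarrow> real) \<Rightarrow> ennreal" where
  "sup_abs h = (SUP u. ennreal \<bar>h u\<bar>)"

definition lip_const :: "('b::metric_space \<Rightarrow> real) \<Rightarrow> ennreal" where
  "lip_const h = (SUP p\<in>{(u, v). u \<noteq> v}. ennreal (\<bar>h (fst p) - h (snd p)\<bar> / dist (fst p) (snd p)))"

definition d_BL :: "'b::euclidean_space measure \<Rightarrow> 'b measure \<Rightarrow> ennreal" where
  "d_BL M1 M2 =
     (SUP h\<in>{h. sup_abs h + lip_const h \<le> 1}. ennreal \<bar>(LINT u|M1. h u) - (LINT u|M2. h u)\<bar>)"

end

theory Submission
  imports Defs
begin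

text \<open>At \<open>\<nu>\<close>-almost every \<open>x\<close> the Vlasov solution \<open>\<mu>\<^sub>s\<close> and the particles are driven by the same field
\<open>V(s,p) = f(s,p) + \<integral> W(x,y) \<integral> D(p,v) d\<mu>\<^sub>s(v) d\<nu>(y)\<close>, which is Lipschitz in \<open>p\<close>: the Vlasov solution
exactly, a particle up to a \<^emph>\<open>gap\<close>, the difference between the forces exerted by finitely many particles
and by the Vlasov solution. The theorem follows from a stability estimate at fixed \<open>x\<close> and an estimate
of the gap averaged over \<open>x\<close>.

\<^bold>\<open>Stability at fixed \<open>x\<close>\<close> (\<open>particles_track_solution\<close>). The bounded Lipschitz distance between a cloud
of particles and a weak solution of the continuity equation of \<open>V\<close> grows at most by the factor
\<open>exp (L T)\<close>, after adding the mean gap integrated over time. This contains the uniqueness of weak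
solutions. The usual dual argument tests the equation against a Lipschitz function composed with the
flow, which is not \<open>C\<^sup>1\<close> when \<open>V\<close> is merely Lipschitz. Here the flow is replaced by compositions of
Euler maps \<open>A p = p + \<integral> V(s,p) ds\<close>, with \<open>s\<close> ranging over a short time step. Mollification at scale \<open>e\<close>
commutes with one Euler step of length \<open>\<tau>\<close> up to \<open>O(\<tau> e)\<close>, and for fixed \<open>e\<close> the weak equation, tested
against the mollified function, agrees with the Euler step up to \<open>O(\<tau>\<^sup>2)\<close> (\<open>mollified_step\<close>).
Summing the steps, refining the grid and then letting \<open>e\<close> tend to \<open>0\<close> exhibits the solution at time \<open>t\<close>
as the limit of the images of the initial measure under Euler maps (\<open>euler_pushforward\<close>). The particles
follow the same maps up to their gap (\<open>euler_tracks_path\<close>), and the maps are uniformly Lipschitz.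

\<^bold>\<open>The averaged gap\<close> (\<open>mean_gap_le\<close>). Replacing \<open>W\<close> by its averages over products of cells of level
\<open>m\<close> costs the \<open>L\<^sup>1\<close> distance from \<open>W\<close> to these averages, which tends to \<open>0\<close> as the cells shrink
(\<open>deviation_tendsto_0\<close>); this absorbs both the sampling at the finer level \<open>m + l\<close> and the passage to the
continuum. What remains is a row of \<open>W\<close> integrated against the distance of the two families of
measures, and the bound on the columns of \<open>W\<close> turns its average over \<open>x\<close> into the average distance
itself. Gronwall's inequality then bounds the average distance on \<open>[0, T]\<close> by its initial value and the
deviation of \<open>W\<close> (\<open>level_estimate\<close>); the former is small by weak convergence and dominated convergence
(\<open>initial_majorant\<close>).

Throughout, the bounded Lipschitz distance is bounded by majorants that are measurable in \<open>x\<close> by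
construction, so that its own measurability is never an issue.\<close>

section \<open>Mollification of Lipschitz functions\<close>

lemma integrable_lborel_bounded_support:
  fixes f :: "'b::euclidean_space \<Rightarrow> 'c::{banach, second_countable_topology}"
  assumes "f \<in> borel_measurable borel" "\<And>z. norm (f z) \<le> B" "\<And>z. R < norm z \<Longrightarrow> f z = 0"
  shows "integrable lborel f"
proof (rule Bochner_Integration.integrable_bound)
  show "integrable lborel (\<lambda>z::'b. B * indicat_real (cball 0 R) z)"
    by (intro integrable_mult_right integrable_real_indicator emeasure_lborel_cball_finite) auto
  show "f \<in> borel_measurable lborel" using assms by simp
  have "norm (f z) \<le> norm (B * indicat_real (cball 0 R) z)" for z
  proof (cases "norm z \<le> R")
    case True
    then show ?thesis using order_trans[OF assms(2)[of z] abs_ge_self]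
      by (simp add: indicator_def abs_mult)
  next
    case False
    then show ?thesis using assms(3)[of z] by simp
  qed
  then show "AE z in lborel. norm (f z) \<le> norm (B * indicat_real (cball 0 R) z)" by simp
qed

lemma GDERIV_quadratic:
  fixes \<phi> :: "'b::euclidean_space \<Rightarrow> real"
  assumes "\<And>h. norm h \<le> 1 \<Longrightarrow> \<bar>\<phi> (u + h) - \<phi> u - g \<bullet> h\<bar> \<le> C * (norm h)\<^sup>2"
  shows "GDERIV \<phi> u :> g"
  unfolding gderiv_def
proof (rule has_derivativeI_sandwich[where e = 1 and H = "\<lambda>y. C * norm (y - u)"])
  show "(0::real) < 1" by simp
  show "bounded_linear (\<lambda>h. h \<bullet> g)" by (rule bounded_linear_inner_left)
  show "((\<lambda>y. C * norm (y - u)) \<longlongrightarrow> 0) (at u)"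
    by (rule tendsto_eq_intros | simp)+
  show "norm (\<phi> y - \<phi> u - (y - u) \<bullet> g) / norm (y - u) \<le> C * norm (y - u)"
    if "y \<noteq> u" "dist y u < 1" for y
    using assms[of "y - u"] that
    by (simp add: dist_norm inner_commute divide_simps power2_eq_square mult.assoc)
qed

text \<open>The bound is local: only small displacements from \<open>u\<close> matter. With \<open>M = 0\<close> it shows that the gradient
vanishes off the support of \<open>\<phi>\<close>.\<close>
lemma gradient_bound:
  fixes \<phi> :: "'b::euclidean_space \<Rightarrow> real"
  assumes taylor: "\<And>h. norm h \<le> 1 \<Longrightarrow> \<bar>\<phi> (u + h) - \<phi> u - g \<bullet> h\<bar> \<le> C * (norm h)\<^sup>2"
    and lip: "\<And>h. norm h \<le> r \<Longrightarrow> \<bar>\<phi> (u + h) - \<phi> u\<bar> \<le> M * norm h"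
    and "0 \<le> C" "0 \<le> M" "0 < r"
  shows "norm g \<le> M"
proof (rule field_le_epsilon)
  fix e :: real assume "0 < e"
  define t where "t = min (min 1 r) (e / (C + 1))"
  have t: "0 < t" "t \<le> 1" "t \<le> r" using \<open>0 < e\<close> \<open>0 \<le> C\<close> \<open>0 < r\<close> by (auto simp: t_def)
  have "t \<le> e / (C + 1)" by (simp add: t_def)
  then have "t * (C + 1) \<le> e" using \<open>0 \<le> C\<close> by (simp add: pos_le_divide_eq)
  then have Ct: "C * t \<le> e" using t by (simp add: algebra_simps)
  show "norm g \<le> M + e"
  proof (cases "g = 0")
    case True
    then show ?thesis using \<open>0 \<le> M\<close> \<open>0 < e\<close> by simp
  next
    case False
    define h where "h = (t / norm g) *\<^sub>R g"
    have nh: "norm h = t" using False t by (simp add: h_def)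
    have "g \<bullet> h = t * norm g" using False
      by (simp add: h_def norm_eq_sqrt_inner[symmetric] power2_norm_eq_inner[symmetric] power2_eq_square)
    then have "t * norm g \<le> M * t + C * t\<^sup>2"
      using taylor[of h] lip[of h] nh t by simp
    then have "t * norm g \<le> t * (M + C * t)" by (simp add: power2_eq_square algebra_simps)
    then have "norm g \<le> M + C * t" using t by simp
    then show ?thesis using Ct by simp
  qed
qed

text \<open>The bump only has to be a compactly supported kernel with a Lipschitz gradient, so a truncated
polynomial will do. Dividing by its mass in \<open>mollify\<close> avoids computing that mass.\<close>
definition bump :: "real \<Rightarrow> 'b::euclidean_space \<Rightarrow> real" where
  "bump e z = (max 0 (e\<^sup>2 - z \<bullet> z))\<^sup>2"

definition bump_grad :: "real \<Rightarrow> 'b::euclidean_space \<Rightarrow> 'b" where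
  "bump_grad e z = - (4 * max 0 (e\<^sup>2 - z \<bullet> z)) *\<^sub>R z"

definition mollify :: "real \<Rightarrow> ('b::euclidean_space \<Rightarrow> real) \<Rightarrow> 'b \<Rightarrow> real" where
  "mollify e \<phi> u = (LINT z|lborel. bump e z * \<phi> (u + z)) / (LINT z|lborel. bump e (z::'b))"

lemma continuous_bump [continuous_intros]: "continuous_on A (bump e)"
  unfolding bump_def by (intro continuous_intros)

lemma continuous_bump_grad [continuous_intros]: "continuous_on A (bump_grad e)"
  unfolding bump_grad_def by (intro continuous_intros)

lemma borel_measurable_bump [measurable]: "bump e \<in> borel_measurable borel"
  by (intro borel_measurable_continuous_onI continuous_intros)

lemma borel_measurable_bump_grad [measurable]: "bump_grad e \<in> borel_measurable borel"
  by (intro borel_measurable_continuous_onI continuous_intros)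

lemma bump_nonneg [simp]: "0 \<le> bump e z" by (simp add: bump_def)

lemma bump_eq_0:
  assumes "0 < e" "e < norm z"
  shows "max 0 (e\<^sup>2 - z \<bullet> z) = 0"
proof -
  have "e\<^sup>2 \<le> (norm z)\<^sup>2" using assms by (intro power_mono) auto
  then show ?thesis by (simp add: power2_norm_eq_inner)
qed

lemma bump_le_1:
  assumes "0 < e" "e \<le> 1" shows "max 0 (e\<^sup>2 - z \<bullet> z) \<le> 1" "bump e z \<le> 1"
proof -
  have "e\<^sup>2 \<le> 1" using assms by (simp add: power_le_one)
  then show *: "max 0 (e\<^sup>2 - z \<bullet> z) \<le> 1"
    by (smt (verit) inner_ge_zero)
  show "bump e z \<le> 1" unfolding bump_def using * by (intro power_le_one) auto
qed

text \<open>The positive part \<open>r \<mapsto> (max 0 r)\<^sup>2\<close> has a quadratic Taylor remainder although it is not \<open>C\<^sup>2\<close>, and the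
increment of \<open>e\<^sup>2 - z \<bullet> z\<close> is at most \<open>5 |h|\<close> near the support of the bump.\<close>
lemma bump_taylor:
  fixes z h :: "'b::euclidean_space"
  assumes e: "0 < e" "e \<le> 1" and h: "norm h \<le> 1"
  shows "\<bar>bump e (z + h) - bump e z - bump_grad e z \<bullet> h\<bar> \<le> 27 * (norm h)\<^sup>2"
proof (cases "norm z \<le> 2")
  case False
  then have "e < norm z" using e by simp
  moreover have "e < norm (z + h)" using False e h norm_triangle_ineq2[of z "- h"] by simp
  ultimately have "max 0 (e\<^sup>2 - z \<bullet> z) = 0" "max 0 (e\<^sup>2 - (z + h) \<bullet> (z + h)) = 0"
    using bump_eq_0[OF e(1)] by blast+
  then show ?thesis unfolding bump_def bump_grad_def by simp
next
  case True
  define r where "r = e\<^sup>2 - z \<bullet> z"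
  define a where "a = - 2 * (z \<bullet> h) - h \<bullet> h"
  have ra: "e\<^sup>2 - (z + h) \<bullet> (z + h) = r + a"
    by (simp add: r_def a_def inner_add_left inner_add_right inner_commute)
  have r1: "0 \<le> max 0 r" "max 0 r \<le> 1" using bump_le_1(1)[OF e, of z] by (simp_all add: r_def)
  have "\<bar>(max 0 (r + a))\<^sup>2 - (max 0 r)\<^sup>2 - 2 * max 0 r * a\<bar> \<le> a\<^sup>2"
  proof (cases "0 \<le> r")
    case r: True
    show ?thesis
    proof (cases "0 \<le> r + a")
      case True
      then show ?thesis using r by (simp add: power2_eq_square algebra_simps)
    next
      case False
      have "r\<^sup>2 + 2 * r * a = r * (r + a) + r * a" by (simp add: power2_eq_square algebra_simps)
      also have "\<dots> \<le> 0" using False r by (smt (verit) mult_nonneg_nonpos)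
      moreover have "0 \<le> (r + a)\<^sup>2" by simp
      ultimately show ?thesis using False r by (simp add: power2_eq_square algebra_simps)
    qed
  next
    case r: False
    have "(max 0 (r + a))\<^sup>2 \<le> a\<^sup>2" using r by (intro abs_le_square_iff[THEN iffD1]) auto
    then show ?thesis using r by simp
  qed
  moreover have "a\<^sup>2 \<le> 25 * (norm h)\<^sup>2"
  proof -
    have "\<bar>a\<bar> \<le> 2 * \<bar>z \<bullet> h\<bar> + h \<bullet> h"
      unfolding a_def by (smt (verit) inner_ge_zero)
    also have "\<dots> \<le> 2 * (2 * norm h) + norm h"
    proof (intro add_mono mult_left_mono)
      have "\<bar>z \<bullet> h\<bar> \<le> norm z * norm h" by (rule Cauchy_Schwarz_ineq2)
      also have "\<dots> \<le> 2 * norm h" using True by (intro mult_right_mono) auto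
      finally show "\<bar>z \<bullet> h\<bar> \<le> 2 * norm h" .
      show "h \<bullet> h \<le> norm h"
        using h by (simp add: power2_norm_eq_inner[symmetric] power2_eq_square mult_left_le)
    qed simp
    finally have "\<bar>a\<bar> \<le> 5 * norm h" by simp
    then have "\<bar>a\<bar>\<^sup>2 \<le> (5 * norm h)\<^sup>2" by (intro power_mono) auto
    then show ?thesis by (simp add: power_mult_distrib)
  qed
  moreover have "\<bar>2 * max 0 r * a - bump_grad e z \<bullet> h\<bar> \<le> 2 * (norm h)\<^sup>2"
  proof -
    have "2 * max 0 r * a - bump_grad e z \<bullet> h = - (2 * max 0 r) * (h \<bullet> h)"
      by (simp add: a_def bump_grad_def r_def algebra_simps)
    then show ?thesis using r1
      by (simp add: abs_mult power2_norm_eq_inner mult_left_le_one_le)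
  qed
  ultimately show ?thesis unfolding bump_def ra r_def[symmetric] by linarith
qed

lemma bump_grad_lipschitz:
  fixes z z' :: "'b::euclidean_space"
  assumes e: "0 < e" "e \<le> 1"
  shows "norm (bump_grad e z - bump_grad e z') \<le> 12 * norm (z - z')"
proof -
  define s :: "'b \<Rightarrow> real" where "s z = max 0 (e\<^sup>2 - z \<bullet> z)" for z
  have s: "0 \<le> s z" "s z \<le> 1" for z using bump_le_1(1)[OF e] by (auto simp: s_def)
  have sl: "\<bar>s z - s z'\<bar> * norm z' \<le> 2 * norm (z - z')" if "norm z \<le> 1" "norm z' \<le> 1" for z z'
  proof -
    have "\<bar>s z - s z'\<bar> \<le> \<bar>z \<bullet> z - z' \<bullet> z'\<bar>" by (auto simp: s_def)
    also have "z \<bullet> z - z' \<bullet> z' = (norm z - norm z') * (norm z + norm z')"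
      by (simp add: power2_norm_eq_inner[symmetric] power2_eq_square algebra_simps)
    also have "\<bar>\<dots>\<bar> \<le> norm (z - z') * 2"
      unfolding abs_mult using that norm_triangle_ineq3[of z z'] by (intro mult_mono) auto
    finally show ?thesis using that(2)
      by (smt (verit) mult_left_le norm_ge_zero)
  qed
  have out: "s z' * norm z' \<le> 2 * norm (z - z')" if "1 < norm z" for z z'
  proof (cases "norm z' \<le> 1")
    case True
    have "s z' \<le> 2 * norm (z - z')"
    proof (cases "0 \<le> e\<^sup>2 - z' \<bullet> z'")
      case pos: True
      have "e\<^sup>2 \<le> 1" using e by (simp add: power_le_one)
      then have "s z' \<le> 1 - (norm z')\<^sup>2" using pos by (simp add: s_def power2_norm_eq_inner)
      also have "\<dots> = (1 - norm z') * (1 + norm z')" by (simp add: power2_eq_square algebra_simps)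
      also have "\<dots> \<le> (1 - norm z') * 2" using True by (intro mult_left_mono) auto
      also have "\<dots> \<le> 2 * norm (z - z')" using that norm_triangle_ineq2[of z z'] by simp
      finally show ?thesis .
    qed (simp add: s_def)
    then show ?thesis using True s[of z'] by (smt (verit) mult_left_le norm_ge_zero)
  next
    case False
    then have "s z' = 0" using bump_eq_0[OF e(1), of z'] e by (simp add: s_def)
    then show ?thesis by simp
  qed
  have "norm (s z *\<^sub>R z - s z' *\<^sub>R z') \<le> 3 * norm (z - z')"
  proof (cases "norm z \<le> 1")
    case z: True
    show ?thesis
    proof (cases "norm z' \<le> 1")
      case True
      have "s z *\<^sub>R z - s z' *\<^sub>R z' = s z *\<^sub>R (z - z') + (s z - s z') *\<^sub>R z'"
        by (simp add: algebra_simps)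
      also have "norm \<dots> \<le> s z * norm (z - z') + \<bar>s z - s z'\<bar> * norm z'"
        using norm_triangle_ineq[of "s z *\<^sub>R (z - z')" "(s z - s z') *\<^sub>R z'"] s[of z] by simp
      also have "\<dots> \<le> 1 * norm (z - z') + 2 * norm (z - z')"
        using sl[OF z True] s[of z] by (intro add_mono mult_right_mono) auto
      finally show ?thesis by simp
    next
      case False
      then have "s z' = 0" using bump_eq_0[OF e(1), of z'] e by (simp add: s_def)
      then show ?thesis using out[of z' z] False s[of z]
        by (smt (verit) diff_zero norm_minus_commute norm_ge_zero norm_scaleR scaleR_zero_left)
    qed
  next
    case False
    then have "s z = 0" using bump_eq_0[OF e(1), of z] e by (simp add: s_def)
    then show ?thesis using out[of z z'] False s[of z'] by simp (smt (verit) norm_ge_zero)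
  qed
  moreover have "bump_grad e z - bump_grad e z' = (-4) *\<^sub>R (s z *\<^sub>R z - s z' *\<^sub>R z')"
    by (simp add: bump_grad_def s_def scaleR_diff_right)
  ultimately show ?thesis by (simp del: scaleR_minus_left)
qed

lemma integrable_bump_mult:
  fixes \<phi> :: "'b::euclidean_space \<Rightarrow> real"
  assumes e: "0 < e" "e \<le> 1" and [measurable]: "\<phi> \<in> borel_measurable borel"
    and b: "\<And>z. \<bar>\<phi> z\<bar> \<le> S"
  shows "integrable lborel (\<lambda>z. bump e z * \<phi> z)"
proof (rule integrable_lborel_bounded_support[where B = S and R = e])
  show "norm (bump e z * \<phi> z) \<le> S" for z
    using mult_mono[OF bump_le_1(2)[OF e, of z] b[of z]] by (simp add: abs_mult)
  show "bump e z * \<phi> z = 0" if "e < norm z" for z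
    using bump_eq_0[OF e(1) that] by (simp add: bump_def)
qed measurable

lemma bump_mass_pos:
  assumes e: "0 < e" "e \<le> 1"
  shows "0 < (LINT z|lborel. bump e (z::'b::euclidean_space))"
proof -
  have int: "integrable lborel (bump e :: 'b \<Rightarrow> real)"
    using integrable_bump_mult[OF e, of "\<lambda>_. 1" 1] by simp
  have "(LINT z|lborel. bump e (z::'b)) \<noteq> 0"
  proof
    assume "(LINT z|lborel. bump e (z::'b)) = 0"
    then have "AE z in lborel. bump e (z::'b) = 0"
      using integral_nonneg_eq_0_iff_AE[OF int] by simp
    then have "emeasure lborel {z::'b. bump e z \<noteq> 0} = 0"
      using AE_iff_measurable[of "{z::'b. bump e z \<noteq> 0}" lborel "\<lambda>z. bump e z = 0"] by simp
    moreover have "ball 0 e \<subseteq> {z::'b. bump e z \<noteq> 0}"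
    proof
      fix z :: 'b assume "z \<in> ball 0 e"
      then have "(norm z)\<^sup>2 < e\<^sup>2" by (intro power_strict_mono) auto
      then show "z \<in> {z. bump e z \<noteq> 0}" by (simp add: bump_def power2_norm_eq_inner)
    qed
    ultimately have "emeasure lborel (ball (0::'b) e) = 0"
      using emeasure_mono[of "ball (0::'b) e" "{z::'b. bump e z \<noteq> 0}" lborel] by simp
    then show False using e content_ball_pos[of e "0::'b"] by (simp add: measure_def)
  qed
  moreover have "0 \<le> (LINT z|lborel. bump e (z::'b))" by simp
  ultimately show ?thesis by linarith
qed

text \<open>Moving \<open>u\<close> from \<open>\<phi>\<close> to the kernel makes \<open>mollify e \<phi>\<close> as smooth as the kernel.\<close>
lemma mollify_translate:
  fixes \<phi> :: "'b::euclidean_space \<Rightarrow> real"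
  assumes [measurable]: "\<phi> \<in> borel_measurable borel"
  shows "mollify e \<phi> u = (LINT z|lborel. bump e (z - u) * \<phi> z) / (LINT z|lborel. bump e (z::'b))"
proof -
  have "(LINT z|lborel. bump e (z - u) * \<phi> z) =
      (LINT z|distr lborel borel ((+) u). bump e (z - u) * \<phi> z)"
    by (simp add: lborel_distr_plus)
  also have "\<dots> = (LINT z|lborel. bump e z * \<phi> (u + z))"
    by (subst integral_distr) auto
  finally show ?thesis by (simp add: mollify_def)
qed

text \<open>A mollified value is an average over \<open>|z| \<le> e\<close>, so it moves no more than the averaged function does there.
Closeness to \<open>\<phi>\<close>, the Lipschitz bound and the commutation with Euler steps are all instances.\<close>
lemma mollify_near:
  fixes \<phi> \<psi> :: "'b::euclidean_space \<Rightarrow> real"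
  assumes e: "0 < e" "e \<le> 1" and [measurable]: "\<phi> \<in> borel_measurable borel"
    and b: "\<And>z. \<bar>\<phi> z\<bar> \<le> S"
    and near: "\<And>z. norm z \<le> e \<Longrightarrow> \<bar>\<phi> (u + z) - c z\<bar> \<le> K"
    and [measurable]: "c \<in> borel_measurable borel" and bc: "\<And>z. \<bar>c z\<bar> \<le> S"
  shows "\<bar>mollify e \<phi> u - (LINT z|lborel. bump e z * c z) / (LINT z|lborel. bump e (z::'b))\<bar> \<le> K"
proof -
  let ?Z = "LINT z|lborel. bump e (z::'b)"
  note Z = bump_mass_pos[OF e, where ?'b = 'b]
  have int: "integrable lborel (bump e :: 'b \<Rightarrow> real)"
    using integrable_bump_mult[OF e, of "\<lambda>_. 1" 1] by simp
  have i1: "integrable lborel (\<lambda>z. bump e z * \<phi> (u + z))"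
    by (rule integrable_bump_mult[OF e]) (auto intro: b)
  have i2: "integrable lborel (\<lambda>z. bump e z * c z)"
    by (rule integrable_bump_mult[OF e]) (auto intro: bc)
  have "mollify e \<phi> u - (LINT z|lborel. bump e z * c z) / ?Z =
      (LINT z|lborel. bump e z * \<phi> (u + z) - bump e z * c z) / ?Z"
    by (simp add: mollify_def diff_divide_distrib Bochner_Integration.integral_diff[OF i1 i2])
  also have "\<bar>\<dots>\<bar> = \<bar>LINT z|lborel. bump e z * \<phi> (u + z) - bump e z * c z\<bar> / ?Z" using Z by simp
  also have "\<bar>LINT z|lborel. bump e z * \<phi> (u + z) - bump e z * c z\<bar>
      \<le> (LINT z|lborel. \<bar>bump e z * \<phi> (u + z) - bump e z * c z\<bar>)" by (rule integral_abs_bound)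
  also have "\<dots> \<le> (LINT z|lborel. bump e (z::'b) * K)"
  proof (rule integral_mono)
    show "integrable lborel (\<lambda>z. \<bar>bump e z * \<phi> (u + z) - bump e z * c z\<bar>)" using i1 i2 by auto
    show "integrable lborel (\<lambda>z::'b. bump e z * K)" using int by simp
    show "\<bar>bump e z * \<phi> (u + z) - bump e z * c z\<bar> \<le> bump e z * K" for z
    proof (cases "norm z \<le> e")
      case True
      show ?thesis using mult_left_mono[OF near[OF True], of "bump e z"]
        by (simp add: abs_mult right_diff_distrib[symmetric])
    next
      case False
      then show ?thesis using bump_eq_0[OF e(1), of z] by (simp add: bump_def)
    qed
  qed
  also have "(LINT z|lborel. bump e (z::'b) * K) = ?Z * K" by simp
  finally show ?thesis using Z by (simp add: divide_right_mono)
qed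

lemma lipschitz_real_measurable:
  fixes \<phi> :: "'b::euclidean_space \<Rightarrow> real"
  assumes "\<And>v w. \<bar>\<phi> v - \<phi> w\<bar> \<le> M * norm (v - w)"
  shows "continuous_on UNIV \<phi>" "\<phi> \<in> borel_measurable borel"
proof -
  have "(max 0 M)-lipschitz_on UNIV \<phi>"
  proof (rule lipschitz_onI)
    show "dist (\<phi> x) (\<phi> y) \<le> max 0 M * dist x y" for x y
      using assms[of x y] mult_right_mono[of M "max 0 M" "norm (x - y)"]
      by (simp add: dist_norm)
  qed simp
  then show "continuous_on UNIV \<phi>" by (rule lipschitz_on_continuous_on)
  then show "\<phi> \<in> borel_measurable borel" by (rule borel_measurable_continuous_onI)
qed

lemma mollify_close:
  fixes \<phi> :: "'b::euclidean_space \<Rightarrow> real"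
  assumes e: "0 < e" "e \<le> 1" and lip: "\<And>v w. \<bar>\<phi> v - \<phi> w\<bar> \<le> M * norm (v - w)"
    and b: "\<And>z. \<bar>\<phi> z\<bar> \<le> S" and M: "0 \<le> M"
  shows "\<bar>mollify e \<phi> u - \<phi> u\<bar> \<le> M * e"
proof -
  have "\<bar>mollify e \<phi> u - (LINT z|lborel. bump e (z::'b) * \<phi> u) / (LINT z|lborel. bump e (z::'b))\<bar> \<le> M * e"
  proof (rule mollify_near[OF e lipschitz_real_measurable(2)[OF lip], where c = "\<lambda>_. \<phi> u"])
    show "\<bar>\<phi> (u + z) - \<phi> u\<bar> \<le> M * e" if "norm z \<le> e" for z
      using lip[of "u + z" u] mult_left_mono[OF that M] by simp
  qed (use b in auto)
  then show ?thesis using bump_mass_pos[OF e, where ?'b = 'b] by simp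
qed

lemma mollify_lipschitz:
  fixes \<phi> :: "'b::euclidean_space \<Rightarrow> real"
  assumes e: "0 < e" "e \<le> 1" and lip: "\<And>v w. \<bar>\<phi> v - \<phi> w\<bar> \<le> M * norm (v - w)"
    and b: "\<And>z. \<bar>\<phi> z\<bar> \<le> S"
  shows "\<bar>mollify e \<phi> v - mollify e \<phi> w\<bar> \<le> M * norm (v - w)"
proof -
  note [measurable] = lipschitz_real_measurable(2)[OF lip]
  have "\<bar>mollify e \<phi> v - (LINT z|lborel. bump e z * \<phi> (w + z)) / (LINT z|lborel. bump e (z::'b))\<bar>
     \<le> M * norm (v - w)"
  proof (rule mollify_near[OF e])
    show "\<bar>\<phi> (v + z) - \<phi> (w + z)\<bar> \<le> M * norm (v - w)" for z
      using lip[of "v + z" "w + z"] by simp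
  qed (use b in auto)
  then show ?thesis by (simp add: mollify_def)
qed

lemma mollify_support:
  fixes \<phi> :: "'b::euclidean_space \<Rightarrow> real"
  assumes e: "0 < e" and supp: "\<And>z. R < norm z \<Longrightarrow> \<phi> z = 0" and u: "R + e < norm u"
  shows "mollify e \<phi> u = 0"
proof -
  have "bump e z * \<phi> (u + z) = 0" for z
  proof (cases "norm z \<le> e")
    case True
    then have "R < norm (u + z)" using u norm_triangle_ineq2[of u "- z"] by simp
    then show ?thesis using supp by simp
  next
    case False
    then show ?thesis using bump_eq_0[OF e, of z] by (simp add: bump_def)
  qed
  then have "(\<lambda>z. bump e z * \<phi> (u + z)) = (\<lambda>_. 0)" by auto
  then show ?thesis unfolding mollify_def by simp
qed

text \<open>The constant depends on \<open>\<phi>\<close> only through its bound and its support. This uniformity allows the same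
constant to be used at every step of a time grid, with a different test function at each step.\<close>
lemma mollify_taylor:
  fixes R S e :: real
  assumes e: "0 < e" "e \<le> 1" and S: "0 \<le> S"
  shows "\<exists>C\<ge>0. \<forall>\<phi> :: 'b::euclidean_space \<Rightarrow> real. \<phi> \<in> borel_measurable borel \<longrightarrow>
     (\<forall>z. \<bar>\<phi> z\<bar> \<le> S) \<longrightarrow> (\<forall>z. R < norm z \<longrightarrow> \<phi> z = 0) \<longrightarrow>
     (\<exists>g. (\<forall>u h. norm h \<le> 1 \<longrightarrow>
             \<bar>mollify e \<phi> (u + h) - mollify e \<phi> u - g u \<bullet> h\<bar> \<le> C * (norm h)\<^sup>2) \<and>
          (\<forall>u v. norm (g u - g v) \<le> C * norm (u - v)))"
proof -
  let ?Z = "LINT z|lborel. bump e (z::'b)"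
  define vol where "vol = measure lborel (cball (0::'b) R)"
  note Z = bump_mass_pos[OF e, where ?'b = 'b]
  have vol: "0 \<le> vol" by (simp add: vol_def)
  have ind: "integrable lborel (indicat_real (cball (0::'b) R))"
    by (intro integrable_real_indicator emeasure_lborel_cball_finite) auto
  have main: "norm (LINT z|lborel. F z) \<le> K * S * vol"
    if "\<And>z. norm (F z) \<le> K * \<bar>\<phi> z\<bar>" "\<And>z. \<bar>\<phi> z\<bar> \<le> S" "\<And>z. R < norm z \<Longrightarrow> \<phi> z = 0"
      "0 \<le> K" "integrable lborel F"
    for F :: "'b \<Rightarrow> 'c::{banach, second_countable_topology}" and K and \<phi> :: "'b \<Rightarrow> real"
  proof -
    have "norm (LINT z|lborel. F z) \<le> (LINT z|lborel. norm (F z))" by (rule integral_norm_bound)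
    also have "\<dots> \<le> (LINT z|lborel. (K * S) * indicat_real (cball (0::'b) R) z)"
    proof (rule integral_mono)
      show "norm (F z) \<le> (K * S) * indicat_real (cball (0::'b) R) z" for z
        using that(1)[of z] mult_left_mono[OF that(2)[of z] that(4)] that(3)[of z]
        by (cases "norm z \<le> R") (auto simp: indicator_def)
    qed (use that ind in auto)
    also have "\<dots> = K * S * vol" by (simp add: vol_def)
    finally show ?thesis .
  qed
  define C where "C = 27 * S * vol / ?Z"
  have C0: "0 \<le> C" using vol S Z by (simp add: C_def)
  show ?thesis
  proof (intro exI[of _ C] conjI allI impI C0)
    fix \<phi> :: "'b \<Rightarrow> real"
    assume [measurable]: "\<phi> \<in> borel_measurable borel"
      and b': "\<forall>z. \<bar>\<phi> z\<bar> \<le> S" and s': "\<forall>z. R < norm z \<longrightarrow> \<phi> z = 0"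
    then have b: "\<And>z. \<bar>\<phi> z\<bar> \<le> S" and s: "\<And>z. R < norm z \<Longrightarrow> \<phi> z = 0" by auto
    define G where "G u = (LINT z|lborel. \<phi> z *\<^sub>R bump_grad e (z - u))" for u
    define g where "g u = - (1 / ?Z) *\<^sub>R G u" for u
    have i1: "integrable lborel (\<lambda>z. bump e (z - u) * \<phi> z)" for u
    proof (rule integrable_lborel_bounded_support[where B = S and R = R])
      show "norm (bump e (z - u) * \<phi> z) \<le> S" for z
        using mult_mono[OF bump_le_1(2)[OF e, of "z - u"] b[of z]] by (simp add: abs_mult)
    qed (use s in auto)
    have i2: "integrable lborel (\<lambda>z. \<phi> z *\<^sub>R bump_grad e (z - u))" for u
    proof (rule integrable_lborel_bounded_support[where B = "S * 4" and R = R])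
      show "norm (\<phi> z *\<^sub>R bump_grad e (z - u)) \<le> S * 4" for z
      proof -
        have "norm (bump_grad e w) \<le> 4" for w :: 'b
        proof (cases "norm w \<le> 1")
          case True
          then show ?thesis using bump_le_1(1)[OF e, of w]
              mult_mono[of "max 0 (e\<^sup>2 - w \<bullet> w)" 1 "norm w" 1]
            by (simp add: bump_grad_def mult.assoc)
        next
          case False
          then show ?thesis using bump_eq_0[OF e(1), of w] e by (simp add: bump_grad_def)
        qed
        then show ?thesis using mult_mono[OF b[of z], of "norm (bump_grad e (z - u))" 4] S by simp
      qed
    qed (use s in auto)
    have taylor: "\<bar>mollify e \<phi> (u + h) - mollify e \<phi> u - g u \<bullet> h\<bar> \<le> C * (norm h)\<^sup>2"
      if h: "norm h \<le> 1" for u h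
    proof -
      define F where "F z = bump e (z - (u + h)) * \<phi> z - bump e (z - u) * \<phi> z
          + (\<phi> z *\<^sub>R bump_grad e (z - u)) \<bullet> h" for z
      have iF: "integrable lborel F" unfolding F_def
        by (intro Bochner_Integration.integrable_add Bochner_Integration.integrable_diff
            integrable_inner_left i1 i2)
      have "(LINT z|lborel. F z) = (LINT z|lborel. bump e (z - (u + h)) * \<phi> z)
          - (LINT z|lborel. bump e (z - u) * \<phi> z) + G u \<bullet> h"
      proof -
        have ii: "integrable lborel (\<lambda>z. (\<phi> z *\<^sub>R bump_grad e (z - u)) \<bullet> h)"
          by (rule integrable_inner_left) (rule i2)
        have "(LINT z|lborel. F z) = (LINT z|lborel. bump e (z - (u + h)) * \<phi> z - bump e (z - u) * \<phi> z)
            + (LINT z|lborel. (\<phi> z *\<^sub>R bump_grad e (z - u)) \<bullet> h)" unfolding F_def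
          by (rule Bochner_Integration.integral_add[OF Bochner_Integration.integrable_diff[OF i1 i1] ii])
        moreover have "(LINT z|lborel. (\<phi> z *\<^sub>R bump_grad e (z - u)) \<bullet> h) = G u \<bullet> h"
          unfolding G_def by (rule integral_inner_left) (rule i2)
        ultimately show ?thesis
          by (simp only: Bochner_Integration.integral_diff[OF i1 i1])
      qed
      moreover have "g u \<bullet> h = - (G u \<bullet> h / ?Z)" by (simp add: g_def)
      ultimately have "mollify e \<phi> (u + h) - mollify e \<phi> u - g u \<bullet> h = (LINT z|lborel. F z) / ?Z"
        by (simp only: mollify_translate[OF \<open>\<phi> \<in> borel_measurable borel\<close>])
          (simp only: add_divide_distrib diff_divide_distrib diff_minus_eq_add)
      moreover have "norm (LINT z|lborel. F z) \<le> (27 * (norm h)\<^sup>2) * S * vol"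
      proof (rule main[OF _ b s _ iF])
        show "norm (F z) \<le> 27 * (norm h)\<^sup>2 * \<bar>\<phi> z\<bar>" for z
        proof -
          have "F z = (bump e ((z - u) + (- h)) - bump e (z - u) - bump_grad e (z - u) \<bullet> (- h)) * \<phi> z"
            by (simp add: F_def algebra_simps)
          then show ?thesis
            using bump_taylor[OF e, of "- h" "z - u"] h by (simp add: abs_mult mult_right_mono)
        qed
      qed auto
      then have "\<bar>LINT z|lborel. F z\<bar> / ?Z \<le> (27 * (norm h)\<^sup>2) * S * vol / ?Z"
        using Z by (intro divide_right_mono) auto
      ultimately show ?thesis using Z by (simp add: C_def mult_ac)
    qed
    have glip: "norm (g u - g v) \<le> C * norm (u - v)" for u v
    proof -
      have "G u - G v = (LINT z|lborel. \<phi> z *\<^sub>R bump_grad e (z - u) - \<phi> z *\<^sub>R bump_grad e (z - v))"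
        unfolding G_def using i2[of u] i2[of v] by simp
      also have "norm \<dots> \<le> (12 * norm (u - v)) * S * vol"
      proof (rule main[OF _ b s])
        show "norm (\<phi> z *\<^sub>R bump_grad e (z - u) - \<phi> z *\<^sub>R bump_grad e (z - v))
            \<le> 12 * norm (u - v) * \<bar>\<phi> z\<bar>" for z
          using bump_grad_lipschitz[OF e, of "z - u" "z - v"]
          by (simp add: scaleR_diff_right[symmetric] mult.commute mult_left_mono norm_minus_commute)
      qed (use i2[of u] i2[of v] in auto)
      also have "\<dots> \<le> (27 * norm (u - v)) * S * vol"
        using vol S by (intro mult_right_mono) auto
      finally have "norm (G u - G v) / ?Z \<le> (27 * norm (u - v)) * S * vol / ?Z"
        using Z by (intro divide_right_mono) auto
      moreover have "norm (g u - g v) = norm (G u - G v) / ?Z"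
      proof -
        have "g u - g v = - (1 / ?Z) *\<^sub>R (G u - G v)" by (simp add: g_def scaleR_diff_right)
        then show ?thesis using Z by (simp del: scaleR_minus_left)
      qed
      ultimately show ?thesis by (simp add: C_def mult_ac)
    qed
    show "\<exists>g. (\<forall>u h. norm h \<le> 1 \<longrightarrow>
             \<bar>mollify e \<phi> (u + h) - mollify e \<phi> u - g u \<bullet> h\<bar> \<le> C * (norm h)\<^sup>2) \<and>
          (\<forall>u v. norm (g u - g v) \<le> C * norm (u - v))"
      using taylor glip by blast
  qed
qed

definition mollified_gradient ::
  "real \<Rightarrow> real \<Rightarrow> real \<Rightarrow> real \<Rightarrow> ('b::euclidean_space \<Rightarrow> real) \<Rightarrow> ('b \<Rightarrow> 'b) \<Rightarrow> bool" where
  "mollified_gradient e R C M \<phi> g \<longleftrightarrow> test_function (mollify e \<phi>) g \<and> (\<forall>u. norm (g u) \<le> M) \<and>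
     (\<forall>u. R + e < norm u \<longrightarrow> g u = 0) \<and>
     (\<forall>u h. norm h \<le> 1 \<longrightarrow>
             \<bar>mollify e \<phi> (u + h) - mollify e \<phi> u - g u \<bullet> h\<bar> \<le> C * (norm h)\<^sup>2) \<and>
     (\<forall>u v. norm (g u - g v) \<le> C * norm (u - v))"

lemma mollify_test_function:
  fixes R S e :: real
  assumes e: "0 < e" "e \<le> 1" and S: "0 \<le> S"
  shows "\<exists>C\<ge>0. \<forall>(\<phi> :: 'b::euclidean_space \<Rightarrow> real) M.
     (\<forall>v w. \<bar>\<phi> v - \<phi> w\<bar> \<le> M * norm (v - w)) \<longrightarrow> 0 \<le> M \<longrightarrow>
     (\<forall>z. \<bar>\<phi> z\<bar> \<le> S) \<longrightarrow> (\<forall>z. R < norm z \<longrightarrow> \<phi> z = 0) \<longrightarrow>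
     (\<exists>g. mollified_gradient e R C M \<phi> g)"
proof -
  obtain C where C0: "0 \<le> C" and C: "\<And>\<phi> :: 'b \<Rightarrow> real. \<phi> \<in> borel_measurable borel \<Longrightarrow>
     (\<forall>z. \<bar>\<phi> z\<bar> \<le> S) \<Longrightarrow> (\<forall>z. R < norm z \<longrightarrow> \<phi> z = 0) \<Longrightarrow>
     (\<exists>g. (\<forall>u h. norm h \<le> 1 \<longrightarrow>
             \<bar>mollify e \<phi> (u + h) - mollify e \<phi> u - g u \<bullet> h\<bar> \<le> C * (norm h)\<^sup>2) \<and>
          (\<forall>u v. norm (g u - g v) \<le> C * norm (u - v)))"
    using mollify_taylor[OF e S, where R = R and ?'b = 'b] by blast
  show ?thesis
  proof (intro exI[of _ C] conjI allI impI C0)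
    fix \<phi> :: "'b \<Rightarrow> real" and M
    assume lip: "\<forall>v w. \<bar>\<phi> v - \<phi> w\<bar> \<le> M * norm (v - w)" and M: "0 \<le> M"
      and b: "\<forall>z. \<bar>\<phi> z\<bar> \<le> S" and supp: "\<forall>z. R < norm z \<longrightarrow> \<phi> z = 0"
    have meas: "\<phi> \<in> borel_measurable borel"
      by (rule lipschitz_real_measurable(2)) (use lip in auto)
    obtain g where g: "\<And>u h. norm h \<le> 1 \<Longrightarrow>
             \<bar>mollify e \<phi> (u + h) - mollify e \<phi> u - g u \<bullet> h\<bar> \<le> C * (norm h)\<^sup>2"
      and glip: "\<And>u v. norm (g u - g v) \<le> C * norm (u - v)"
      using C[OF meas b supp] by auto
    have mlip: "\<bar>mollify e \<phi> v - mollify e \<phi> w\<bar> \<le> M * norm (v - w)" for v w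
      by (rule mollify_lipschitz[OF e, where S = S]) (use lip b in auto)
    have gM: "norm (g u) \<le> M" for u
    proof (rule gradient_bound[where r = 1, OF g _ C0 M])
      show "\<bar>mollify e \<phi> (u + h) - mollify e \<phi> u\<bar> \<le> M * norm h" for h
        using mlip[of "u + h" u] by simp
    qed auto
    have msupp: "mollify e \<phi> u = 0" if "R + e < norm u" for u
      by (rule mollify_support[OF e(1) _ that]) (use supp in auto)
    have g0: "g u = 0" if u: "R + e < norm u" for u
    proof -
      have "norm (g u) \<le> 0"
      proof (rule gradient_bound[where r = "(norm u - (R + e)) / 2", OF g _ C0])
        show "\<bar>mollify e \<phi> (u + h) - mollify e \<phi> u\<bar> \<le> 0 * norm h"
          if "norm h \<le> (norm u - (R + e)) / 2" for h
        proof -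
          have "norm u \<le> norm (u + h) + norm h" using norm_triangle_ineq[of "u + h" "- h"] by simp
          moreover have "2 * norm h \<le> norm u - (R + e)" using that by simp
          ultimately have "R + e < norm (u + h)" using u by argo
          then show ?thesis using msupp u by simp
        qed
      qed (use u in auto)
      then show ?thesis by simp
    qed
    have "C-lipschitz_on UNIV g"
      by (rule lipschitz_onI) (use glip C0 in \<open>auto simp: dist_norm\<close>)
    then have "continuous_on UNIV g" by (rule lipschitz_on_continuous_on)
    moreover have "bounded {u. mollify e \<phi> u \<noteq> 0}"
      unfolding bounded_iff using msupp by (auto intro!: exI[of _ "R + e"] simp: not_less[symmetric])
    moreover have "GDERIV (mollify e \<phi>) u :> g u" for u
      by (rule GDERIV_quadratic) (rule g)
    ultimately have "test_function (mollify e \<phi>) g" by (simp add: test_function_def)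
    then show "\<exists>g. mollified_gradient e R C M \<phi> g"
      unfolding mollified_gradient_def using gM g0 g glip by blast
  qed
qed

section \<open>Euler maps of a Lipschitz field\<close>

lemma set_integral_adjacent:
  fixes F :: "real \<Rightarrow> 'c::{banach, second_countable_topology}"
  assumes "a \<le> b" "b \<le> t" "set_integrable lborel {a..t} F"
  shows "(LINT s:{a..t}|lborel. F s) = (LINT s:{a..b}|lborel. F s) + (LINT s:{b..t}|lborel. F s)"
proof -
  have *: "{a..b} \<union> {b..t} = {a..t}" using assms by auto
  have "(LINT s:{a..b} \<union> {b..t}|lborel. F s) = (LINT s:{a..b}|lborel. F s) + (LINT s:{b..t}|lborel. F s)"
  proof (rule set_integral_Un_AE)
    show "AE x in lborel. \<not> (x \<in> {a..b} \<and> x \<in> {b..t})"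
      using AE_lborel_singleton[of b] by eventually_elim auto
    show "set_integrable lborel {a..b} F" "set_integrable lborel {b..t} F"
      using assms by (auto intro: set_integrable_subset)
  qed auto
  then show ?thesis by (simp add: *)
qed

lemma set_integral_interval_bound:
  fixes F :: "real \<Rightarrow> 'c::{banach, second_countable_topology}"
  assumes "a \<le> b" "\<And>s. s \<in> {a..b} \<Longrightarrow> norm (F s) \<le> K"
  shows "norm (LINT s:{a..b}|lborel. F s) \<le> (b - a) * K"
proof (cases "set_integrable lborel {a..b} F")
  case True
  have "norm (LINT s:{a..b}|lborel. F s) \<le> (LINT s:{a..b}|lborel. norm (F s))"
    by (rule set_integral_norm_bound[OF True])
  also have "\<dots> \<le> (LINT s:{a..b}|lborel. K)"
  proof (rule set_integral_mono)
    show "set_integrable lborel {a..b} (\<lambda>s. norm (F s))" by (rule set_integrable_norm[OF True])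
    show "set_integrable lborel {a..b} (\<lambda>s. K)"
      by (auto simp: set_integrable_def emeasure_lborel_Icc_eq)
  qed (use assms in auto)
  also have "\<dots> = (b - a) * K" using assms(1) by (simp add: set_lebesgue_integral_def)
  finally show ?thesis .
next
  case False
  then have "(LINT s:{a..b}|lborel. F s) = 0"
    unfolding set_lebesgue_integral_def set_integrable_def by (rule not_integrable_integral_eq)
  moreover have "0 \<le> K" using order_trans[OF norm_ge_zero assms(2)[of a]] assms(1) by simp
  ultimately show ?thesis using assms(1) by simp
qed

lemma set_integrable_bounded_interval:
  fixes F :: "real \<Rightarrow> 'c::{banach, second_countable_topology}"
  assumes [measurable]: "F \<in> borel_measurable borel" and "\<And>s. s \<in> {a..b} \<Longrightarrow> norm (F s) \<le> K"
  shows "set_integrable lborel {a..b} F"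
  unfolding set_integrable_def
proof (rule Bochner_Integration.integrable_bound[of lborel "\<lambda>s. K * indicat_real {a..b} s"])
  show "integrable lborel (\<lambda>s. K * indicat_real {a..b} s)"
    by (intro integrable_mult_right integrable_real_indicator) (auto simp: emeasure_lborel_Icc_eq)
  show "AE s in lborel. norm (indicat_real {a..b} s *\<^sub>R F s) \<le> norm (K * indicat_real {a..b} s)"
    using order_trans[OF assms(2) abs_ge_self] by (auto simp: indicator_def)
qed simp

locale lipschitz_field =
  fixes V :: "real \<Rightarrow> 'b::euclidean_space \<Rightarrow> 'b" and L c T :: real
  assumes V_measurable [measurable]: "(\<lambda>(s, u). V s u) \<in> borel_measurable (borel \<Otimes>\<^sub>M borel)"
    and V_lipschitz: "norm (V s u - V s v) \<le> L * norm (u - v)"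
    and V_origin: "s \<in> {0..T} \<Longrightarrow> norm (V s 0) \<le> c"
    and L_nonneg: "0 \<le> L" and c_nonneg: "0 \<le> c"
begin

lemma V_growth: "s \<in> {0..T} \<Longrightarrow> norm (V s u) \<le> c + L * norm u"
  using V_origin[of s] V_lipschitz[of s u 0] norm_triangle_ineq[of "V s u - V s 0" "V s 0"] by simp

lemma V_set_integrable: "0 \<le> a \<Longrightarrow> b \<le> T \<Longrightarrow> set_integrable lborel {a..b} (\<lambda>s. V s u)"
  by (rule set_integrable_bounded_interval[where K = "c + L * norm u"]) (auto intro: V_growth)

text \<open>The field is averaged over the time step instead of being evaluated at its start, because it need not be
continuous in time.\<close>
definition euler_step :: "real \<Rightarrow> real \<Rightarrow> 'b \<Rightarrow> 'b" where
  "euler_step a b u = u + (LINT s:{a..b}|lborel. V s u)"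

lemma euler_step_displacement:
  assumes "0 \<le> a" "a \<le> b" "b \<le> T"
  shows "norm (euler_step a b u - u) \<le> (b - a) * (c + L * norm u)"
  using set_integral_interval_bound[of a b "\<lambda>s. V s u" "c + L * norm u"] V_growth assms
  by (auto simp: euler_step_def)

lemma euler_step_shift:
  assumes "0 \<le> a" "a \<le> b" "b \<le> T"
  shows "norm ((euler_step a b u - u) - (euler_step a b v - v)) \<le> (b - a) * (L * norm (u - v))"
proof -
  have "(euler_step a b u - u) - (euler_step a b v - v) = (LINT s:{a..b}|lborel. V s u - V s v)"
    using assms by (simp add: euler_step_def set_integral_diff(2) V_set_integrable)
  also have "norm \<dots> \<le> (b - a) * (L * norm (u - v))"
    using assms by (intro set_integral_interval_bound V_lipschitz)
  finally show ?thesis .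
qed

lemma euler_step_lipschitz:
  assumes "0 \<le> a" "a \<le> b" "b \<le> T"
  shows "norm (euler_step a b u - euler_step a b v) \<le> exp (L * (b - a)) * norm (u - v)"
proof -
  have "norm (euler_step a b u - euler_step a b v) \<le> norm (u - v) + (b - a) * (L * norm (u - v))"
    using euler_step_shift[OF assms, of u v]
      norm_triangle_ineq[of "u - v" "(euler_step a b u - u) - (euler_step a b v - v)"]
    by (simp add: algebra_simps)
  also have "\<dots> = (1 + L * (b - a)) * norm (u - v)" by (simp add: algebra_simps)
  also have "\<dots> \<le> exp (L * (b - a)) * norm (u - v)"
    by (intro mult_right_mono exp_ge_add_one_self) simp
  finally show ?thesis .
qed

text \<open>\<open>euler d i n\<close> performs \<open>n\<close> steps of length \<open>d\<close> starting at time \<open>i * d\<close>. The recursion peels off the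
\<^emph>\<open>first\<close> step, so that a function composed with the remaining steps plays the role of the dual solution
at time \<open>(i + 1) * d\<close>.\<close>
primrec euler :: "real \<Rightarrow> nat \<Rightarrow> nat \<Rightarrow> 'b \<Rightarrow> 'b" where
  "euler d i 0 u = u"
| "euler d i (Suc n) u = euler d (Suc i) n (euler_step (real i * d) (real (Suc i) * d) u)"

lemma grid_step:
  assumes "0 \<le> d" "real (i + Suc n) * d \<le> T"
  shows "0 \<le> real i * d" "real i * d \<le> real (Suc i) * d" "real (Suc i) * d \<le> T"
    "real (Suc i) * d - real i * d = d" "real (Suc i + n) * d \<le> T"
proof -
  have "real (Suc i) * d \<le> real (i + Suc n) * d" by (rule mult_right_mono) (use assms in auto)
  then show "real (Suc i) * d \<le> T" using assms by linarith
qed (use assms in \<open>auto simp: algebra_simps\<close>)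

lemma euler_lipschitz:
  assumes "0 \<le> d" "real (i + n) * d \<le> T"
  shows "norm (euler d i n u - euler d i n v) \<le> exp (L * (n * d)) * norm (u - v)"
  using assms(2)
proof (induction n arbitrary: i u v)
  case (Suc n)
  note g = grid_step[OF assms(1) Suc.prems]
  let ?A = "euler_step (real i * d) (real (Suc i) * d)"
  have "norm (euler d i (Suc n) u - euler d i (Suc n) v) \<le> exp (L * (n * d)) * norm (?A u - ?A v)"
    using Suc.IH[OF g(5)] by simp
  also have "\<dots> \<le> exp (L * (n * d)) * (exp (L * d) * norm (u - v))"
    using euler_step_lipschitz[OF g(1-3), of u v] unfolding g(4) by (intro mult_left_mono) auto
  also have "\<dots> = exp (L * (real (Suc n) * d)) * norm (u - v)"
    by (simp add: mult_exp_exp algebra_simps)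
  finally show ?case .
qed simp

lemma euler_lipschitz_T:
  assumes "0 \<le> d" "real (i + n) * d \<le> T"
  shows "norm (euler d i n u - euler d i n v) \<le> exp (L * T) * norm (u - v)"
proof -
  have "real n * d \<le> real (i + n) * d" by (rule mult_right_mono) (use assms in auto)
  then have "exp (L * (n * d)) \<le> exp (L * T)" using assms L_nonneg by (auto intro: mult_left_mono)
  then show ?thesis using euler_lipschitz[OF assms, of u v] mult_right_mono[of _ _ "norm (u - v)"]
    by (meson norm_ge_zero order_trans)
qed

lemma continuous_euler: 
  assumes "0 \<le> d" "real (i + n) * d \<le> T"
  shows "continuous_on UNIV (euler d i n)"
proof -
  have "(exp (L * T))-lipschitz_on UNIV (euler d i n)"
    by (rule lipschitz_onI) (use euler_lipschitz_T[OF assms] in \<open>auto simp: dist_norm\<close>)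
  then show ?thesis by (rule lipschitz_on_continuous_on)
qed

text \<open>Euler maps do not bring far away points close, so composing a compactly supported function with them
leaves its support in a ball that does not depend on the grid. This replaces moment bounds on the measures.\<close>
lemma euler_growth_lower:
  assumes "0 \<le> d" "real (i + n) * d \<le> T" "L * d \<le> 1 / 2"
  shows "norm u \<le> exp (2 * L * (n * d)) * (norm (euler d i n u) + n * d * c)"
  using assms(2)
proof (induction n arbitrary: i u)
  case (Suc n)
  note g = grid_step[OF assms(1) Suc.prems]
  let ?A = "euler_step (real i * d) (real (Suc i) * d)"
  let ?E = "norm (euler d i (Suc n) u)"
  have Ld: "0 \<le> L * d" using L_nonneg assms(1) by simp
  have dc: "0 \<le> d * c" using c_nonneg assms(1) by simp
  have "norm u \<le> norm (?A u) + d * (c + L * norm u)"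
    using euler_step_displacement[OF g(1-3), of u] norm_triangle_ineq2[of u "?A u"]
    unfolding g(4) by (simp add: norm_minus_commute)
  then have 1: "(1 - L * d) * norm u \<le> norm (?A u) + d * c" by (simp add: algebra_simps)
  have "1 \<le> (1 + 2 * (L * d)) * (1 - L * d)"
  proof -
    have "(1 + 2 * (L * d)) * (1 - L * d) = 1 + (L * d) * (1 - 2 * (L * d))" by (simp add: algebra_simps)
    moreover have "0 \<le> (L * d) * (1 - 2 * (L * d))" by (rule mult_nonneg_nonneg) (use Ld assms(3) in auto)
    ultimately show ?thesis by linarith
  qed
  also have "\<dots> \<le> exp (2 * (L * d)) * (1 - L * d)"
    using assms(3) by (intro mult_right_mono exp_ge_add_one_self) auto
  finally have "norm u \<le> exp (2 * (L * d)) * (1 - L * d) * norm u"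
    using mult_right_mono[of 1 _ "norm u"] by simp
  also have "\<dots> \<le> exp (2 * (L * d)) * (norm (?A u) + d * c)"
    using mult_left_mono[OF 1, of "exp (2 * (L * d))"] by (simp add: mult.assoc)
  also have "\<dots> \<le> exp (2 * (L * d)) * (exp (2 * L * (n * d)) * (?E + n * d * c)
      + exp (2 * L * (n * d)) * (d * c))"
  proof (intro mult_left_mono add_mono)
    show "norm (?A u) \<le> exp (2 * L * (n * d)) * (?E + n * d * c)" using Suc.IH[OF g(5), of "?A u"] by simp
    have "1 \<le> exp (2 * L * (n * d))" using L_nonneg assms(1) by simp
    then show "d * c \<le> exp (2 * L * (n * d)) * (d * c)" using dc mult_right_mono[of 1 _ "d * c"] by simp
  qed simp
  also have "\<dots> = exp (2 * L * (real (Suc n) * d)) * (?E + real (Suc n) * d * c)"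
  proof -
    have "exp (2 * L * (real (Suc n) * d)) = exp (2 * (L * d)) * exp (2 * L * (n * d))"
      by (simp add: mult_exp_exp algebra_simps)
    then show ?thesis by (simp add: algebra_simps)
  qed
  finally show ?case .
qed simp

text \<open>Each step contributes its local error, propagated by the Lipschitz constant of the remaining steps. The
gap enters with its exact time integral; only the term with \<open>d\<^sup>2\<close> is a discretisation error.\<close>
lemma euler_tracks_path:
  assumes d: "0 \<le> d" and y: "\<And>s. s \<in> {0..T} \<Longrightarrow> (y has_vector_derivative y' s) (at s within {0..T})"
    and y'_cont: "continuous_on {0..T} y'" and B: "\<And>s. s \<in> {0..T} \<Longrightarrow> norm (y' s) \<le> B"
    and gap: "set_integrable lborel {0..T} (\<lambda>s. norm (y' s - V s (y s)))"
    and "real (i + n) * d \<le> T"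
  shows "norm (y (real (i + n) * d) - euler d i n (y (real i * d))) \<le> exp (L * (n * d)) *
    ((LINT s:{real i * d..real (i + n) * d}|lborel. norm (y' s - V s (y s))) + n * (L * B * d\<^sup>2))"
  using assms(6)
proof (induction n arbitrary: i)
  case 0
  have "0 \<le> (LINT s:{real i * d..real i * d}|lborel. norm (y' s - V s (y s)))"
    unfolding set_lebesgue_integral_def by (rule Bochner_Integration.integral_nonneg) simp
  then show ?case by simp
next
  case (Suc n)
  note g = grid_step[OF d Suc.prems]
  define a where "a = real i * d"
  define b where "b = real (Suc i) * d"
  define t where "t = real (Suc i + n) * d"
  let ?A = "euler_step a b"
  let ?gap = "\<lambda>s. norm (y' s - V s (y s))"
  have ab: "0 \<le> a" "a \<le> b" "b \<le> T" "b - a = d" "t \<le> T" using g by (auto simp: a_def b_def t_def)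
  have bt: "b \<le> t" unfolding b_def t_def using d by (intro mult_right_mono) auto
  have sub: "{p..q} \<subseteq> {0..T}" if "0 \<le> p" "q \<le> T" for p q using that by auto
  have y'_ab: "set_integrable lborel {a..b} y'"
    by (rule set_integrable_subset[OF borel_integrable_compact[of "{0..T}" y', folded set_integrable_def]])
      (use ab y'_cont in auto)
  have ftc: "(LINT s:{p..q}|lborel. y' s) = y q - y p" if "0 \<le> p" "p \<le> q" "q \<le> T" for p q
    unfolding set_lebesgue_integral_def
  proof (rule integral_FTC_atLeastAtMost)
    show "(y has_vector_derivative y' s) (at s within {p..q})" if "p \<le> s" "s \<le> q" for s
      by (rule has_vector_derivative_within_subset[OF y]) (use that \<open>0 \<le> p\<close> \<open>q \<le> T\<close> in auto)
    show "continuous_on {p..q} y'" using continuous_on_subset[OF y'_cont sub] that by auto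
  qed (rule that)
  have gap_ab: "set_integrable lborel {p..q} ?gap" if "0 \<le> p" "q \<le> T" for p q
    by (rule set_integrable_subset[OF gap]) (use that in auto)
  have B0: "0 \<le> B" using order_trans[OF norm_ge_zero B[of a]] ab by simp
  have close: "norm (y s - y a) \<le> B * d" if "s \<in> {a..b}" for s
  proof -
    have "norm (y s - y a) \<le> (s - a) * B"
      using ftc[of a s] set_integral_interval_bound[of a s y' B] B that ab by auto
    also have "\<dots> \<le> d * B" using that ab B0 by (intro mult_right_mono) auto
    finally show ?thesis by (simp add: mult.commute)
  qed
  have local: "norm (y b - ?A (y a)) \<le> (LINT s:{a..b}|lborel. ?gap s) + L * B * d\<^sup>2"
  proof -
    have int: "set_integrable lborel {a..b} (\<lambda>s. y' s - V s (y a))"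
      using y'_ab V_set_integrable[of a b] ab by (intro set_integral_diff(1)) auto
    have "y b - ?A (y a) = (LINT s:{a..b}|lborel. y' s - V s (y a))"
      using ftc[of a b] ab y'_ab V_set_integrable[of a b "y a"]
      by (simp add: euler_step_def set_integral_diff(2) algebra_simps)
    also have "norm \<dots> \<le> (LINT s:{a..b}|lborel. norm (y' s - V s (y a)))"
      by (rule set_integral_norm_bound[OF int])
    also have "\<dots> \<le> (LINT s:{a..b}|lborel. ?gap s + L * (B * d))"
    proof (rule set_integral_mono)
      show "set_integrable lborel {a..b} (\<lambda>s. norm (y' s - V s (y a)))"
        by (rule set_integrable_norm[OF int])
      show "set_integrable lborel {a..b} (\<lambda>s. ?gap s + L * (B * d))"
        using gap_ab[of a b] ab by (intro set_integral_add) (auto simp: set_integrable_def)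
      fix s assume s: "s \<in> {a..b}"
      have "norm (y' s - V s (y a)) \<le> ?gap s + norm (V s (y s) - V s (y a))"
        using norm_triangle_ineq[of "y' s - V s (y s)" "V s (y s) - V s (y a)"] by simp
      also have "norm (V s (y s) - V s (y a)) \<le> L * (B * d)"
        using V_lipschitz[of s "y s" "y a"] mult_left_mono[OF close[OF s] L_nonneg] by linarith
      finally show "norm (y' s - V s (y a)) \<le> ?gap s + L * (B * d)" by simp
    qed
    also have "\<dots> = (LINT s:{a..b}|lborel. ?gap s) + (LINT s:{a..b}|lborel. L * (B * d))"
      by (rule set_integral_add) (use gap_ab[of a b] ab in \<open>auto simp: set_integrable_def\<close>)
    also have "(LINT s:{a..b}|lborel. L * (B * d)) = L * B * d\<^sup>2"
      using ab by (simp add: set_lebesgue_integral_def power2_eq_square)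
    finally show ?thesis .
  qed
  have "norm (y t - euler d i (Suc n) (y a))
      \<le> norm (y t - euler d (Suc i) n (y b)) + norm (euler d (Suc i) n (y b) - euler d (Suc i) n (?A (y a)))"
    using norm_triangle_ineq[of "y t - euler d (Suc i) n (y b)" "euler d (Suc i) n (y b) - euler d (Suc i) n (?A (y a))"]
    by (simp add: a_def b_def)
  also have "\<dots> \<le> exp (L * (n * d)) * ((LINT s:{b..t}|lborel. ?gap s) + n * (L * B * d\<^sup>2))
      + exp (L * (n * d)) * ((LINT s:{a..b}|lborel. ?gap s) + L * B * d\<^sup>2)"
  proof (rule add_mono)
    show "norm (y t - euler d (Suc i) n (y b)) \<le> exp (L * (n * d)) *
        ((LINT s:{b..t}|lborel. ?gap s) + n * (L * B * d\<^sup>2))"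
      unfolding b_def t_def by (rule Suc.IH[OF g(5)])
    show "norm (euler d (Suc i) n (y b) - euler d (Suc i) n (?A (y a)))
        \<le> exp (L * (n * d)) * ((LINT s:{a..b}|lborel. ?gap s) + L * B * d\<^sup>2)"
      using euler_lipschitz[OF d g(5), of "y b" "?A (y a)"] mult_left_mono[OF local exp_ge_zero]
      by (rule order_trans)
  qed
  also have "\<dots> = exp (L * (n * d)) * ((LINT s:{a..t}|lborel. ?gap s) + real (Suc n) * (L * B * d\<^sup>2))"
    using set_integral_adjacent[OF ab(2) bt gap_ab] ab by (simp add: algebra_simps)
  also have "\<dots> \<le> exp (L * (real (Suc n) * d)) * ((LINT s:{a..t}|lborel. ?gap s) + real (Suc n) * (L * B * d\<^sup>2))"
  proof (rule mult_right_mono)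
    show "exp (L * (n * d)) \<le> exp (L * (real (Suc n) * d))"
      using L_nonneg d by (auto intro!: mult_left_mono mult_right_mono)
    have "0 \<le> (LINT s:{a..t}|lborel. ?gap s)"
      unfolding set_lebesgue_integral_def by (rule Bochner_Integration.integral_nonneg) simp
    then show "0 \<le> (LINT s:{a..t}|lborel. ?gap s) + real (Suc n) * (L * B * d\<^sup>2)"
      using L_nonneg B0 by simp
  qed
  finally show ?case by (simp add: a_def t_def)
qed

end

section \<open>The continuity equation of a Lipschitz field\<close>

text \<open>A weak solution of \<open>\<partial>\<^sub>t \<mu> + div (V \<mu>) = 0\<close> by probability measures, in the form integrated in time. The
measures need not have a first moment, so only test functions of bounded support are available.\<close>
locale continuity_equation = lipschitz_field V L c T
  for V :: "real \<Rightarrow> 'b::euclidean_space \<Rightarrow> 'b" and L c T :: real +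
  fixes \<mu> :: "real \<Rightarrow> 'b measure"
  assumes prob: "s \<in> {0..T} \<Longrightarrow> prob_space (\<mu> s)"
    and sets_\<mu>: "s \<in> {0..T} \<Longrightarrow> sets (\<mu> s) = sets borel"
    and flux_integrable: "test_function \<phi> g \<Longrightarrow>
      set_integrable lborel {0..T} (\<lambda>s. LINT u|\<mu> s. g u \<bullet> V s u)"
    and weak_equation: "t \<in> {0..T} \<Longrightarrow> test_function \<phi> g \<Longrightarrow>
      (LINT u|\<mu> t. \<phi> u) - (LINT u|\<mu> 0. \<phi> u) = (LINT s:{0..t}|lborel. LINT u|\<mu> s. g u \<bullet> V s u)"
begin

lemma integrable_bounded:
  fixes F :: "'b \<Rightarrow> 'c::{banach, second_countable_topology}"
  assumes "s \<in> {0..T}" "F \<in> borel_measurable borel" "\<And>u. norm (F u) \<le> K"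
  shows "integrable (\<mu> s) F"
proof -
  interpret prob_space "\<mu> s" by (rule prob[OF assms(1)])
  show ?thesis
    by (rule integrable_const_bound[where B = K])
      (use assms in \<open>auto simp: measurable_cong_sets[OF sets_\<mu>[OF assms(1)] refl]\<close>)
qed

lemma integral_bounded:
  fixes F :: "'b \<Rightarrow> 'c::{banach, second_countable_topology}"
  assumes "s \<in> {0..T}" "\<And>u. norm (F u) \<le> K"
  shows "norm (LINT u|\<mu> s. F u) \<le> K"
proof (cases "integrable (\<mu> s) F")
  case True
  interpret prob_space "\<mu> s" by (rule prob[OF assms(1)])
  have "norm (LINT u|\<mu> s. F u) \<le> (LINT u|\<mu> s. norm (F u))" by (rule integral_norm_bound)
  also have "\<dots> \<le> (LINT u|\<mu> s. K)" by (rule integral_mono) (use True assms in auto)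
  finally show ?thesis by (simp add: prob_space)
next
  case False
  then show ?thesis using order_trans[OF norm_ge_zero assms(2)] by (simp add: not_integrable_integral_eq)
qed

lemma weak_equation_between:
  assumes "0 \<le> s" "s \<le> t" "t \<le> T" "test_function \<phi> g"
  shows "(LINT u|\<mu> t. \<phi> u) - (LINT u|\<mu> s. \<phi> u) = (LINT r:{s..t}|lborel. LINT u|\<mu> r. g u \<bullet> V r u)"
proof -
  have "set_integrable lborel {0..t} (\<lambda>r. LINT u|\<mu> r. g u \<bullet> V r u)"
    by (rule set_integrable_subset[OF flux_integrable[OF assms(4)]]) (use assms in auto)
  from set_integral_adjacent[OF assms(1,2) this] show ?thesis
    using weak_equation[OF _ assms(4), of t] weak_equation[OF _ assms(4), of s] assms by simp
qed

text \<open>The weak equation gives this for \<open>C\<^sup>1\<close> functions with gradient bounded by \<open>\<Lambda>\<close>; mollification preserves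
\<open>\<Lambda>\<close>, so the estimate passes to the limit.\<close>
lemma lipschitz_functional_in_time:
  assumes st: "0 \<le> s" "s \<le> t" "t \<le> T" and R: "0 \<le> R"
    and lip: "\<And>v w. \<bar>k v - k w\<bar> \<le> \<Lambda> * norm (v - w)" and \<Lambda>: "0 \<le> \<Lambda>"
    and b: "\<And>z. \<bar>k z\<bar> \<le> S" and supp: "\<And>z. R < norm z \<Longrightarrow> k z = 0"
  shows "\<bar>(LINT u|\<mu> t. k u) - (LINT u|\<mu> s. k u)\<bar> \<le> (t - s) * (\<Lambda> * (c + L * (R + 1)))"
proof (rule field_le_epsilon)
  fix \<eta> :: real assume "0 < \<eta>"
  define e where "e = min 1 (\<eta> / (2 * (\<Lambda> + 1)))"
  have e: "0 < e" "e \<le> 1" using \<open>0 < \<eta>\<close> \<Lambda> by (auto simp: e_def)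
  have "e \<le> \<eta> / (2 * (\<Lambda> + 1))" by (simp add: e_def)
  then have "e * (2 * (\<Lambda> + 1)) \<le> \<eta>" using \<Lambda> by (simp add: pos_le_divide_eq)
  then have e\<eta>: "2 * (\<Lambda> * e) \<le> \<eta>" using e \<Lambda> by (simp add: algebra_simps)
  have S: "0 \<le> S" using b[of 0] by linarith
  have k_meas: "k \<in> borel_measurable borel" by (rule lipschitz_real_measurable(2)[OF lip])
  obtain g where g: "test_function (mollify e k) g" "\<And>u. norm (g u) \<le> \<Lambda>" "\<And>u. R + e < norm u \<Longrightarrow> g u = 0"
    using mollify_test_function[OF e S, where R = R and ?'b = 'b] lip \<Lambda> b supp
    unfolding mollified_gradient_def by blast
  have mlip: "\<bar>mollify e k v - mollify e k w\<bar> \<le> \<Lambda> * norm (v - w)" for v w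
    by (rule mollify_lipschitz[OF e lip b])
  have m_meas: "mollify e k \<in> borel_measurable borel" by (rule lipschitz_real_measurable(2)[OF mlip])
  have close: "\<bar>mollify e k u - k u\<bar> \<le> \<Lambda> * e" for u by (rule mollify_close[OF e lip b \<Lambda>])
  have m_bd: "\<bar>mollify e k u\<bar> \<le> S + \<Lambda> * e" for u using close[of u] b[of u] by linarith
  have diff: "\<bar>(LINT u|\<mu> r. k u) - (LINT u|\<mu> r. mollify e k u)\<bar> \<le> \<Lambda> * e" if "r \<in> {0..T}" for r
  proof -
    have "(LINT u|\<mu> r. k u) - (LINT u|\<mu> r. mollify e k u) = (LINT u|\<mu> r. k u - mollify e k u)"
      using integrable_bounded[OF that k_meas, of S] integrable_bounded[OF that m_meas, of "S + \<Lambda> * e"]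
        b m_bd by simp
    then show ?thesis
      using integral_bounded[OF that, of "\<lambda>u. k u - mollify e k u" "\<Lambda> * e"] close
      by (simp add: abs_minus_commute)
  qed
  have "\<bar>(LINT u|\<mu> t. mollify e k u) - (LINT u|\<mu> s. mollify e k u)\<bar> \<le> (t - s) * (\<Lambda> * (c + L * (R + 1)))"
    unfolding weak_equation_between[OF st g(1)] real_norm_def[symmetric]
  proof (rule set_integral_interval_bound[OF st(2)], rule integral_bounded)
    show "r \<in> {0..T}" if "r \<in> {s..t}" for r using that st by auto
    show "norm (g u \<bullet> V r u) \<le> \<Lambda> * (c + L * (R + 1))" if "r \<in> {s..t}" for r u
    proof (cases "R + e < norm u")
      case True
      then show ?thesis using g(3)[OF True] \<Lambda> c_nonneg L_nonneg R by simp
    next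
      case False
      have "norm (V r u) \<le> c + L * norm u" using V_growth that st by auto
      also have "\<dots> \<le> c + L * (R + 1)" using False e L_nonneg by (intro add_left_mono mult_left_mono) auto
      finally have "norm (g u) * norm (V r u) \<le> \<Lambda> * (c + L * (R + 1))"
        using g(2)[of u] \<Lambda> by (intro mult_mono) auto
      then show ?thesis using Cauchy_Schwarz_ineq2[of "g u" "V r u"] by simp
    qed
  qed
  then show "\<bar>(LINT u|\<mu> t. k u) - (LINT u|\<mu> s. k u)\<bar> \<le> (t - s) * (\<Lambda> * (c + L * (R + 1))) + \<eta>"
    using diff[of s] diff[of t] st e\<eta> by (simp add: abs_le_iff)
qed

lemma euler_step_measurable:
  assumes "0 \<le> a" "a \<le> b" "b \<le> T"
  shows "euler_step a b \<in> borel_measurable borel"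
proof -
  have "(exp (L * (b - a)))-lipschitz_on UNIV (euler_step a b)"
    by (rule lipschitz_onI) (use euler_step_lipschitz[OF assms] in \<open>auto simp: dist_norm\<close>)
  then show ?thesis by (intro borel_measurable_continuous_onI lipschitz_on_continuous_on)
qed

text \<open>The constant \<open>Q\<close> may blow up as \<open>e\<close> tends to \<open>0\<close>, but it multiplies the square of the step length, while
the term that is linear in the step length carries the factor \<open>e\<close>. The latter is the commutator of
mollification and transport, small because \<open>V\<close> is Lipschitz.\<close>
lemma mollified_step:
  assumes e: "0 < e" "e \<le> 1" and R: "0 \<le> R" and S: "0 \<le> S" and M: "0 \<le> M"
  shows "\<exists>Q \<delta>. 0 \<le> Q \<and> 0 < \<delta> \<and> (\<forall>\<phi> a b.
    (\<forall>v w. \<bar>\<phi> v - \<phi> w\<bar> \<le> M * norm (v - w)) \<longrightarrow> (\<forall>z. \<bar>\<phi> z\<bar> \<le> S) \<longrightarrow>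
    (\<forall>z. R < norm z \<longrightarrow> \<phi> z = 0) \<longrightarrow> 0 \<le> a \<longrightarrow> a \<le> b \<longrightarrow> b \<le> T \<longrightarrow> b - a \<le> \<delta> \<longrightarrow>
    \<bar>(LINT u|\<mu> b. mollify e \<phi> u) - (LINT u|\<mu> a. mollify e (\<lambda>u. \<phi> (euler_step a b u)) u)\<bar>
      \<le> (b - a) * (M * L * e) + Q * (b - a)\<^sup>2)"
proof -
  obtain C where C: "0 \<le> C" and C_test: "\<And>\<phi> :: 'b \<Rightarrow> real. 
     (\<forall>v w. \<bar>\<phi> v - \<phi> w\<bar> \<le> M * norm (v - w)) \<Longrightarrow> 
     (\<forall>z. \<bar>\<phi> z\<bar> \<le> S) \<Longrightarrow> (\<forall>z. R < norm z \<longrightarrow> \<phi> z = 0) \<Longrightarrow>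
     (\<exists>g. mollified_gradient e R C M \<phi> g)"
    using mollify_test_function[OF e S, where R = R and ?'b = 'b] M by blast
  \<comment> \<open>\<open>B\<close> bounds the field on a ball outside of which neither a point nor its image under a short Euler
    step meets the support of the mollified function; on that support itself \<open>B'\<close> is a bound.\<close>
  define R' where "R' = R + e"
  define B where "B = c + L * (2 * (R' + 1))"
  define B' where "B' = c + L * R'"
  define \<Lambda> where "\<Lambda> = C * B' + M * L"
  define Q where "Q = C * B\<^sup>2 + \<Lambda> * (c + L * (R' + 1))"
  define \<delta> where "\<delta> = 1 / (2 * (B + L + 1))"
  have R'0: "0 \<le> R'" using R e by (simp add: R'_def)
  have B0: "0 \<le> B" "0 \<le> B'" "B' \<le> B" using c_nonneg L_nonneg R'0 by (auto simp: B_def B'_def intro!: mult_left_mono)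
  have \<Lambda>0: "0 \<le> \<Lambda>" using C B0 M L_nonneg by (simp add: \<Lambda>_def)
  have Q0: "0 \<le> Q" using C \<Lambda>0 c_nonneg L_nonneg R'0 by (simp add: Q_def)
  have \<delta>0: "0 < \<delta>" using B0 L_nonneg by (simp add: \<delta>_def)
  have "\<bar>(LINT u|\<mu> b. mollify e \<phi> u) - (LINT u|\<mu> a. mollify e (\<lambda>u. \<phi> (euler_step a b u)) u)\<bar>
      \<le> (b - a) * (M * L * e) + Q * (b - a)\<^sup>2"
    if lip: "\<And>v w. \<bar>\<phi> v - \<phi> w\<bar> \<le> M * norm (v - w)" and b: "\<And>z. \<bar>\<phi> z\<bar> \<le> S"
      and supp: "\<And>z. R < norm z \<Longrightarrow> \<phi> z = 0" and ab: "0 \<le> a" "a \<le> b" "b \<le> T" and small: "b - a \<le> \<delta>"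
    for \<phi> a b
  proof -
    let ?A = "euler_step a b"
    have "a \<in> {0..T}" "b \<in> {0..T}" using ab by auto
    note [measurable] = lipschitz_real_measurable(2)[OF lip] euler_step_measurable[OF ab]
    have "(b - a) * (B + L + 1) \<le> \<delta> * (B + L + 1)"
      using small B0 L_nonneg by (intro mult_right_mono) auto
    also have "\<dots> = 1 / 2" using B0 L_nonneg by (simp add: \<delta>_def divide_simps)
    finally have dB: "(b - a) * (B + L + 1) \<le> 1 / 2" .
    have nonneg: "0 \<le> (b - a) * B" "0 \<le> (b - a) * L" "0 \<le> b - a" using ab B0 L_nonneg by auto
    have dB1: "(b - a) * B \<le> 1" and dL: "(b - a) * L \<le> 1 / 2"
      using dB nonneg by (auto simp: algebra_simps)
    obtain g where test: "test_function (mollify e \<phi>) g" and gM: "\<And>u. norm (g u) \<le> M"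
      and g0: "\<And>u. R' < norm u \<Longrightarrow> g u = 0"
      and taylor: "\<And>u h. norm h \<le> 1 \<Longrightarrow>
             \<bar>mollify e \<phi> (u + h) - mollify e \<phi> u - g u \<bullet> h\<bar> \<le> C * (norm h)\<^sup>2"
      and glip: "\<And>u v. norm (g u - g v) \<le> C * norm (u - v)"
      using C_test[of \<phi>] lip b supp unfolding R'_def mollified_gradient_def by auto
    have mlip: "\<bar>mollify e \<phi> v - mollify e \<phi> w\<bar> \<le> M * norm (v - w)" for v w
      by (rule mollify_lipschitz[OF e lip b])
    note [measurable] = lipschitz_real_measurable(2)[OF mlip]
    have m0: "mollify e \<phi> u = 0" if "R' < norm u" for u
      using mollify_support[OF e(1) supp] that by (simp add: R'_def)
    have m_bd: "\<bar>mollify e \<phi> u\<bar> \<le> S + M * e" for u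
      using mollify_close[OF e lip b M, of u] b[of u] by linarith
    let ?\<psi> = "\<lambda>u. \<phi> (?A u)"
    have \<psi>lip: "\<bar>?\<psi> v - ?\<psi> w\<bar> \<le> (M * exp (L * (b - a))) * norm (v - w)" for v w
      using lip[of "?A v" "?A w"] mult_left_mono[OF euler_step_lipschitz[OF ab, of v w] M] by simp
    have \<psi>mlip: "\<bar>mollify e ?\<psi> v - mollify e ?\<psi> w\<bar> \<le> (M * exp (L * (b - a))) * norm (v - w)" for v w
      by (rule mollify_lipschitz[OF e \<psi>lip b])
    note [measurable] = lipschitz_real_measurable(2)[OF \<psi>mlip]
    have \<psi>_bd: "\<bar>mollify e ?\<psi> u\<bar> \<le> S + M * exp (L * (b - a)) * e" for u
      using mollify_close[OF e \<psi>lip b, of u] b[of "?A u"] M by simp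
    \<comment> \<open>Moving the mollifier past the Euler step costs only the Lipschitz constant of the field.\<close>
    have commute: "\<bar>mollify e ?\<psi> u - mollify e \<phi> (?A u)\<bar> \<le> (b - a) * (M * L * e)" for u
    proof -
      have "\<bar>mollify e ?\<psi> u - (LINT z|lborel. bump e z * \<phi> (?A u + z)) / (LINT z|lborel. bump e (z::'b))\<bar>
          \<le> (b - a) * (M * L * e)"
      proof (rule mollify_near[OF e])
        fix z :: 'b assume z: "norm z \<le> e"
        have "norm (?A (u + z) - (?A u + z)) \<le> (b - a) * (L * norm z)"
          using euler_step_shift[OF ab, of "u + z" u] by (simp add: algebra_simps)
        also have "\<dots> \<le> (b - a) * (L * e)" using z ab L_nonneg by (intro mult_left_mono) auto
        finally have "M * norm (?A (u + z) - (?A u + z)) \<le> M * ((b - a) * (L * e))" using M by (rule mult_left_mono)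
        then show "\<bar>?\<psi> (u + z) - \<phi> (?A u + z)\<bar> \<le> (b - a) * (M * L * e)"
          using lip[of "?A (u + z)" "?A u + z"] by (simp add: mult_ac)
      qed (use b in auto)
      then show ?thesis by (simp add: mollify_def)
    qed
    have expand: "\<bar>mollify e \<phi> (?A u) - mollify e \<phi> u - g u \<bullet> (?A u - u)\<bar> \<le> C * B\<^sup>2 * (b - a)\<^sup>2" for u
    proof (cases "norm u \<le> 2 * (R' + 1)")
      case True
      have "norm (?A u - u) \<le> (b - a) * (c + L * norm u)" by (rule euler_step_displacement[OF ab])
      also have "\<dots> \<le> (b - a) * B"
        using True L_nonneg ab unfolding B_def by (intro mult_left_mono add_left_mono) auto
      finally have *: "norm (?A u - u) \<le> (b - a) * B" .
      then have "\<bar>mollify e \<phi> (?A u) - mollify e \<phi> u - g u \<bullet> (?A u - u)\<bar> \<le> C * (norm (?A u - u))\<^sup>2"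
        using taylor[of "?A u - u" u] dB1 by simp
      also have "\<dots> \<le> C * ((b - a) * B)\<^sup>2" using * C by (intro mult_left_mono power_mono) auto
      finally show ?thesis by (simp add: power_mult_distrib mult_ac)
    next
      case False
      have "norm u - norm (?A u) \<le> (b - a) * (c + L * norm u)"
        using euler_step_displacement[OF ab, of u] norm_triangle_ineq2[of u "?A u"]
        by (simp add: norm_minus_commute)
      also have "\<dots> = (b - a) * c + ((b - a) * L) * norm u" by (simp add: algebra_simps)
      also have "\<dots> \<le> 1 + 1 / 2 * norm u"
      proof (intro add_mono mult_right_mono dL)
        have "(b - a) * c \<le> (b - a) * B" using ab L_nonneg R'0 by (intro mult_left_mono) (auto simp: B_def)
        then show "(b - a) * c \<le> 1" using dB1 by linarith
      qed simp
      finally have "R' < norm (?A u)" using False by simp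
      moreover have "R' < norm u" using False R'0 by simp
      ultimately show ?thesis using m0 g0 C by simp
    qed
    have k_bd: "norm (g u \<bullet> V r u) \<le> M * B'" if "r \<in> {0..T}" for r u
    proof (cases "R' < norm u")
      case True
      then show ?thesis using g0[OF True] M B0 by simp
    next
      case False
      have "norm (V r u) \<le> c + L * norm u" using V_growth that by auto
      also have "\<dots> \<le> B'" unfolding B'_def using False L_nonneg by (intro add_left_mono mult_left_mono) auto
      finally have "norm (g u) * norm (V r u) \<le> M * B'" using gM[of u] M by (intro mult_mono) auto
      then show ?thesis using Cauchy_Schwarz_ineq2[of "g u" "V r u"] by simp
    qed
    have k_lip: "\<bar>g v \<bullet> V r v - g w \<bullet> V r w\<bar> \<le> \<Lambda> * norm (v - w)" if r: "r \<in> {0..T}" for r v w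
    proof -
      have one: "\<bar>g v \<bullet> V r v - g w \<bullet> V r w\<bar> \<le> \<Lambda> * norm (v - w)" if "norm w \<le> R'" for v w
      proof -
        have Vw: "norm (V r w) \<le> B'"
          using V_growth[OF r, of w] mult_left_mono[OF that L_nonneg] by (simp add: B'_def)
        have "g v \<bullet> V r v - g w \<bullet> V r w = (g v - g w) \<bullet> V r w + g v \<bullet> (V r v - V r w)"
          by (simp add: inner_diff_left inner_diff_right)
        also have "\<bar>\<dots>\<bar> \<le> norm (g v - g w) * norm (V r w) + norm (g v) * norm (V r v - V r w)"
          using Cauchy_Schwarz_ineq2[of "g v - g w" "V r w"] Cauchy_Schwarz_ineq2[of "g v" "V r v - V r w"]
          by linarith
        also have "\<dots> \<le> (C * norm (v - w)) * B' + M * (L * norm (v - w))"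
          using glip[of v w] Vw gM[of v] V_lipschitz[of r v w] C M by (intro add_mono mult_mono) auto
        finally show ?thesis by (simp add: \<Lambda>_def algebra_simps)
      qed
      show ?thesis
      proof (cases "norm w \<le> R'")
        case True then show ?thesis by (rule one)
      next
        case w: False
        show ?thesis
        proof (cases "norm v \<le> R'")
          case True then show ?thesis using one[OF True, of w] by (simp add: abs_minus_commute norm_minus_commute)
        next
          case False then show ?thesis using w g0 \<Lambda>0 by simp
        qed
      qed
    qed
    have g_meas [measurable]: "g \<in> borel_measurable borel"
      using test by (auto simp: test_function_def intro: borel_measurable_continuous_onI)
    \<comment> \<open>Fubini turns the displacement of the Euler step into a time integral against the frozen measure.\<close>
    have frozen: "(LINT u|\<mu> a. g u \<bullet> (?A u - u)) = (LINT r:{a..b}|lborel. LINT u|\<mu> a. g u \<bullet> V r u)"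
    proof -
      interpret Pa: prob_space "\<mu> a" by (rule prob) fact
      interpret pair_sigma_finite "lborel :: real measure" "\<mu> a" ..
      have [measurable_cong]: "sets (\<mu> a) = sets borel" by (rule sets_\<mu>) fact
      have m[measurable]: "(\<lambda>(r, u). indicat_real {a..b} r * (g u \<bullet> V r u)) \<in> borel_measurable (lborel \<Otimes>\<^sub>M \<mu> a)"
        using V_measurable by measurable
      have int: "integrable (lborel \<Otimes>\<^sub>M \<mu> a) (\<lambda>(r, u). indicat_real {a..b} r * (g u \<bullet> V r u))"
      proof (rule Bochner_Integration.integrable_bound[OF _ m])
        show "integrable (lborel \<Otimes>\<^sub>M \<mu> a) (\<lambda>p. (M * B') * indicat_real ({a..b} \<times> space (\<mu> a)) p)"
        proof (intro integrable_mult_right integrable_real_indicator)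
          have "emeasure (lborel \<Otimes>\<^sub>M \<mu> a) ({a..b} \<times> space (\<mu> a)) = emeasure lborel {a..b} * emeasure (\<mu> a) (space (\<mu> a))"
            by (rule Pa.emeasure_pair_measure_Times) simp_all
          then show "emeasure (lborel \<Otimes>\<^sub>M \<mu> a) ({a..b} \<times> space (\<mu> a)) < \<infinity>"
            by (simp add: Pa.emeasure_space_1 emeasure_lborel_Icc_eq)
        qed simp
        show "AE p in lborel \<Otimes>\<^sub>M \<mu> a. norm (case p of (r, u) \<Rightarrow> indicat_real {a..b} r * (g u \<bullet> V r u))
            \<le> norm (M * B' * indicat_real ({a..b} \<times> space (\<mu> a)) p)"
        proof (rule AE_I2)
          fix p :: "real \<times> 'b" assume "p \<in> space (lborel \<Otimes>\<^sub>M \<mu> a)"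
          then show "norm (case p of (r, u) \<Rightarrow> indicat_real {a..b} r * (g u \<bullet> V r u))
            \<le> norm (M * B' * indicat_real ({a..b} \<times> space (\<mu> a)) p)"
            using order_trans[OF k_bd abs_ge_self] ab
            by (cases p) (auto simp: indicator_def space_pair_measure)
        qed
      qed
      have "(LINT u|\<mu> a. g u \<bullet> (?A u - u)) = (LINT u|\<mu> a. LINT r|lborel. indicat_real {a..b} r * (g u \<bullet> V r u))"
      proof (rule Bochner_Integration.integral_cong[OF refl])
        fix u
        have "g u \<bullet> (?A u - u) = (LINT r|lborel. g u \<bullet> (indicat_real {a..b} r *\<^sub>R V r u))"
          using V_set_integrable[OF ab(1,3), of u]
          by (simp add: euler_step_def set_lebesgue_integral_def set_integrable_def integral_inner_right del: inner_scaleR_right)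
        then show "g u \<bullet> (?A u - u) = (LINT r|lborel. indicat_real {a..b} r * (g u \<bullet> V r u))" by simp
      qed
      also have "\<dots> = (LINT r|lborel. LINT u|\<mu> a. indicat_real {a..b} r * (g u \<bullet> V r u))"
        by (rule Fubini_integral[OF int])
      finally show ?thesis by (simp add: set_lebesgue_integral_def)
    qed
    have flux: "(LINT u|\<mu> b. mollify e \<phi> u) - (LINT u|\<mu> a. mollify e \<phi> u) =
        (LINT r:{a..b}|lborel. LINT u|\<mu> r. g u \<bullet> V r u)"
      by (rule weak_equation_between[OF ab test])
    have flux_int: "set_integrable lborel {a..b} (\<lambda>r. LINT u|\<mu> r. g u \<bullet> V r u)"
      by (rule set_integrable_subset[OF flux_integrable[OF test]]) (use ab in auto)
    have frozen_int: "set_integrable lborel {a..b} (\<lambda>r. LINT u|\<mu> a. g u \<bullet> V r u)"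
    proof (rule set_integrable_bounded_interval)
      interpret P: prob_space "\<mu> a" by (rule prob) fact
      have [measurable_cong]: "sets (\<mu> a) = sets borel" by (rule sets_\<mu>) fact
      show "(\<lambda>r. LINT u|\<mu> a. g u \<bullet> V r u) \<in> borel_measurable borel"
        using V_measurable by measurable
      show "norm (LINT u|\<mu> a. g u \<bullet> V r u) \<le> M * B'" if "r \<in> {a..b}" for r
        by (rule integral_bounded) (use that ab k_bd in auto)
    qed
    have moved: "\<bar>(LINT u|\<mu> b. mollify e \<phi> u) - (LINT u|\<mu> a. mollify e \<phi> u) - (LINT u|\<mu> a. g u \<bullet> (?A u - u))\<bar>
        \<le> \<Lambda> * (c + L * (R' + 1)) * (b - a)\<^sup>2"
    proof -
      have "(LINT u|\<mu> b. mollify e \<phi> u) - (LINT u|\<mu> a. mollify e \<phi> u) - (LINT u|\<mu> a. g u \<bullet> (?A u - u)) =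
        (LINT r:{a..b}|lborel. (LINT u|\<mu> r. g u \<bullet> V r u) - (LINT u|\<mu> a. g u \<bullet> V r u))"
        unfolding flux frozen by (rule set_integral_diff(2)[OF flux_int frozen_int, symmetric])
      moreover have "norm \<dots> \<le> (b - a) * ((b - a) * (\<Lambda> * (c + L * (R' + 1))))"
      proof (rule set_integral_interval_bound[OF ab(2)])
        fix r assume r: "r \<in> {a..b}"
        then have rT: "r \<in> {0..T}" using ab by auto
        have "norm ((LINT u|\<mu> r. g u \<bullet> V r u) - (LINT u|\<mu> a. g u \<bullet> V r u)) \<le> (r - a) * (\<Lambda> * (c + L * (R' + 1)))"
          unfolding real_norm_def
        proof (rule lipschitz_functional_in_time[OF _ _ _ R'0 k_lip \<Lambda>0])
          show "\<bar>g z \<bullet> V r z\<bar> \<le> M * B'" for z using k_bd[OF rT, of z] by simp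
        qed (use r rT ab g0 in auto)
        also have "\<dots> \<le> (b - a) * (\<Lambda> * (c + L * (R' + 1)))"
          using r \<Lambda>0 c_nonneg L_nonneg R'0 by (intro mult_right_mono) auto
        finally show "norm ((LINT u|\<mu> r. g u \<bullet> V r u) - (LINT u|\<mu> a. g u \<bullet> V r u))
            \<le> (b - a) * (\<Lambda> * (c + L * (R' + 1)))" .
      qed
      ultimately show ?thesis by (simp add: power2_eq_square mult_ac)
    qed
    have i1: "integrable (\<mu> a) (mollify e \<phi>)"
      by (rule integrable_bounded[where K = "S + M * e"]) (use \<open>a \<in> {0..T}\<close> m_bd in auto)
    have i2: "integrable (\<mu> a) (\<lambda>u. mollify e \<phi> (?A u))"
      by (rule integrable_bounded[where K = "S + M * e"]) (use \<open>a \<in> {0..T}\<close> m_bd in auto)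
    have i3: "integrable (\<mu> a) (mollify e ?\<psi>)"
      by (rule integrable_bounded[where K = "S + M * exp (L * (b - a)) * e"]) (use \<open>a \<in> {0..T}\<close> \<psi>_bd in auto)
    have i4: "integrable (\<mu> a) (\<lambda>u. g u \<bullet> (?A u - u))"
    proof (rule integrable_bounded[where K = "M * ((b - a) * B')"])
      fix u
      show "norm (g u \<bullet> (?A u - u)) \<le> M * ((b - a) * B')"
      proof (cases "R' < norm u")
        case True
        then show ?thesis using g0[OF True] M B0 ab by simp
      next
        case False
        have "norm (?A u - u) \<le> (b - a) * (c + L * norm u)" by (rule euler_step_displacement[OF ab])
        also have "\<dots> \<le> (b - a) * B'"
          using False L_nonneg ab unfolding B'_def by (intro mult_left_mono add_left_mono) auto
        finally have "norm (g u) * norm (?A u - u) \<le> M * ((b - a) * B')" using gM[of u] M by (intro mult_mono) auto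
        then show ?thesis using Cauchy_Schwarz_ineq2[of "g u" "?A u - u"] by simp
      qed
    qed (use \<open>a \<in> {0..T}\<close> in auto)
    have c1: "\<bar>(LINT u|\<mu> a. mollify e ?\<psi> u) - (LINT u|\<mu> a. mollify e \<phi> (?A u))\<bar> \<le> (b - a) * (M * L * e)"
      using integral_bounded[OF \<open>a \<in> {0..T}\<close>, of "\<lambda>u. mollify e ?\<psi> u - mollify e \<phi> (?A u)"] commute i2 i3 by simp
    have c2: "\<bar>(LINT u|\<mu> a. mollify e \<phi> (?A u)) - (LINT u|\<mu> a. mollify e \<phi> u) - (LINT u|\<mu> a. g u \<bullet> (?A u - u))\<bar>
        \<le> C * B\<^sup>2 * (b - a)\<^sup>2"
    proof -
      have "(LINT u|\<mu> a. mollify e \<phi> (?A u)) - (LINT u|\<mu> a. mollify e \<phi> u) - (LINT u|\<mu> a. g u \<bullet> (?A u - u))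
        = (LINT u|\<mu> a. mollify e \<phi> (?A u) - mollify e \<phi> u - g u \<bullet> (?A u - u))"
        by (simp only: Bochner_Integration.integral_diff[OF Bochner_Integration.integrable_diff[OF i2 i1] i4]
            Bochner_Integration.integral_diff[OF i2 i1])
      then show ?thesis
        using integral_bounded[OF \<open>a \<in> {0..T}\<close>, of "\<lambda>u. mollify e \<phi> (?A u) - mollify e \<phi> u - g u \<bullet> (?A u - u)"]
          expand by simp
    qed
    have "Q * (b - a)\<^sup>2 = C * B\<^sup>2 * (b - a)\<^sup>2 + \<Lambda> * (c + L * (R' + 1)) * (b - a)\<^sup>2"
      by (simp add: Q_def algebra_simps)
    then show ?thesis using c1 c2 moved by linarith
  qed
  then show ?thesis using Q0 \<delta>0 by blast
qed

end

definition cutoff :: "real \<Rightarrow> 'b::euclidean_space \<Rightarrow> real" where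
  "cutoff R u = max 0 (min 1 (R + 1 - norm u))"

lemma cutoff_bounds: "0 \<le> cutoff R u" "cutoff R u \<le> 1" by (auto simp: cutoff_def)

lemma abs_cutoff_le: "\<bar>cutoff R u\<bar> \<le> 1" by (auto simp: cutoff_def)

lemma cutoff_lipschitz: "\<bar>cutoff R v - cutoff R w\<bar> \<le> 1 * norm (v - w)"
  using norm_triangle_ineq3[of v w] by (auto simp: cutoff_def)

lemma cutoff_support: "R + 1 < norm u \<Longrightarrow> cutoff R u = 0" by (auto simp: cutoff_def)

lemma cutoff_integral_tendsto:
  fixes M :: "'b::euclidean_space measure"
  assumes "prob_space M" and sets: "sets M = sets borel"
  shows "(\<lambda>n. LINT u|M. cutoff (real n) u) \<longlonglongrightarrow> 1"
proof -
  interpret prob_space M by fact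
  have "(\<lambda>n. LINT u|M. cutoff (real n) u) \<longlonglongrightarrow> (LINT u|M. 1)"
  proof (rule integral_dominated_convergence[where w = "\<lambda>_. 1"])
    show "AE u in M. (\<lambda>n. cutoff (real n) u) \<longlonglongrightarrow> 1"
    proof (rule AE_I2)
      fix u :: 'b
      obtain m :: nat where "norm u \<le> real m" using real_arch_simple by blast
      then have "\<forall>n\<ge>m. cutoff (real n) u = 1" by (auto simp: cutoff_def)
      then show "(\<lambda>n. cutoff (real n) u) \<longlonglongrightarrow> 1"
        by (intro tendsto_eventually) (auto simp: eventually_sequentially)
    qed
    show "cutoff (real n) \<in> borel_measurable M" for n
      using lipschitz_real_measurable(2)[OF cutoff_lipschitz] by (simp add: measurable_cong_sets[OF sets refl])
  qed (use abs_cutoff_le in auto)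
  then show ?thesis by (simp add: prob_space)
qed

context continuity_equation
begin

text \<open>The sum of \<open>N\<close> step errors is \<open>O(e) + Q * O(1 / N)\<close>: first \<open>e\<close> is chosen small, then \<open>N\<close> large.\<close>
lemma euler_pushforward_compact:
  assumes t: "0 < t" "t \<le> T" and R0: "0 \<le> R0" and M0: "0 \<le> M0"
    and lip: "\<And>v w. \<bar>h v - h w\<bar> \<le> M0 * norm (v - w)" and b: "\<And>z. \<bar>h z\<bar> \<le> S"
    and supp: "\<And>z. R0 < norm z \<Longrightarrow> h z = 0"
  shows "(\<lambda>N. LINT u|\<mu> 0. h (euler (t / real N) 0 N u)) \<longlonglongrightarrow> (LINT u|\<mu> t. h u)"
proof (rule LIMSEQ_I)
  fix \<eta> :: real assume \<eta>: "0 < \<eta>"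
  have T0: "0 \<le> T" using t by simp
  \<comment> \<open>\<open>M\<close> and \<open>R\<close> bound the Lipschitz constant and the support of \<open>h\<close> after any number of Euler steps.\<close>
  define M where "M = M0 * exp (L * T)"
  define R where "R = exp (2 * L * T) * (R0 + T * c)"
  have M: "0 \<le> M" "M0 \<le> M"
    using M0 L_nonneg T0 mult_left_mono[of 1 "exp (L * T)" M0] by (simp_all add: M_def)
  have R: "0 \<le> R" using R0 T0 c_nonneg by (simp add: R_def)
  have S: "0 \<le> S" using b[of 0] by linarith
  define P where "P = 2 * M + M * L * T + 1"
  have P: "0 < P" using M L_nonneg T0 by (simp add: P_def add_nonneg_pos)
  define e where "e = min 1 (\<eta> / (3 * P))"
  have e: "0 < e" "e \<le> 1" using \<eta> P by (auto simp: e_def)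
  have "e \<le> \<eta> / (3 * P)" by (simp add: e_def)
  then have eP: "3 * (P * e) \<le> \<eta>" using P by (simp add: pos_le_divide_eq mult_ac)
  obtain Q \<delta> where Q: "0 \<le> Q" and \<delta>: "0 < \<delta>" and step: "\<And>\<phi> a b.
    (\<forall>v w. \<bar>\<phi> v - \<phi> w\<bar> \<le> M * norm (v - w)) \<Longrightarrow> (\<forall>z. \<bar>\<phi> z\<bar> \<le> S) \<Longrightarrow>
    (\<forall>z. R < norm z \<longrightarrow> \<phi> z = 0) \<Longrightarrow> 0 \<le> a \<Longrightarrow> a \<le> b \<Longrightarrow> b \<le> T \<Longrightarrow> b - a \<le> \<delta> \<Longrightarrow>
    \<bar>(LINT u|\<mu> b. mollify e \<phi> u) - (LINT u|\<mu> a. mollify e (\<lambda>u. \<phi> (euler_step a b u)) u)\<bar>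
      \<le> (b - a) * (M * L * e) + Q * (b - a)\<^sup>2"
    using mollified_step[OF e R S M(1)] by blast
  have "\<forall>\<^sub>F N in sequentially. t / real N < \<delta>"
    by (rule order_tendstoD(2)[OF _ \<delta>]) (rule lim_const_over_n)
  moreover have "\<forall>\<^sub>F N in sequentially. L * (t / real N) < 1 / 2"
    by (rule order_tendstoD(2)[OF tendsto_mult_right_zero[OF lim_const_over_n]]) simp
  moreover have "\<forall>\<^sub>F N in sequentially. Q * t * (t / real N) < \<eta> / 3"
    by (rule order_tendstoD(2)[OF tendsto_mult_right_zero[OF lim_const_over_n]]) (use \<eta> in simp)
  moreover have "\<forall>\<^sub>F N in sequentially. 0 < N" by (rule eventually_gt_at_top)
  ultimately have "\<forall>\<^sub>F N in sequentially. \<bar>(LINT u|\<mu> 0. h (euler (t / real N) 0 N u)) - (LINT u|\<mu> t. h u)\<bar> < \<eta>"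
  proof eventually_elim
    fix N :: nat
    assume N: "t / real N < \<delta>" "L * (t / real N) < 1 / 2" "Q * t * (t / real N) < \<eta> / 3" "0 < N"
    define d where "d = t / real N"
    have d: "0 \<le> d" "d < \<delta>" "L * d \<le> 1 / 2" "real N * d = t" using N t by (auto simp: d_def)
    have grid: "real m * d \<le> T" if "m \<le> N" for m
      using mult_right_mono[of "real m" "real N" d] that d t by simp
    define \<phi> where "\<phi> i n u = h (euler d i n u)" for i n u
    have \<phi>_lip: "\<bar>\<phi> i n v - \<phi> i n w\<bar> \<le> M * norm (v - w)" if "i + n \<le> N" for i n v w
    proof -
      have "M0 * norm (euler d i n v - euler d i n w) \<le> M0 * (exp (L * T) * norm (v - w))"
        by (rule mult_left_mono[OF euler_lipschitz_T[OF d(1) grid[OF that]] M0])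
      then show ?thesis using lip[of "euler d i n v" "euler d i n w"] by (simp add: \<phi>_def M_def mult.assoc)
    qed
    have \<phi>_b: "\<bar>\<phi> i n u\<bar> \<le> S" for i n u by (simp add: \<phi>_def b)
    have \<phi>_supp: "\<phi> i n u = 0" if n: "i + n \<le> N" and u: "R < norm u" for i n u
    proof -
      have "R0 < norm (euler d i n u)"
      proof (rule ccontr)
        assume small: "\<not> R0 < norm (euler d i n u)"
        have nd: "real n * d \<le> T" using grid[of n] n by simp
        have "norm u \<le> exp (2 * L * (n * d)) * (norm (euler d i n u) + n * d * c)"
          by (rule euler_growth_lower[OF d(1) grid[OF n] d(3)])
        also have "\<dots> \<le> exp (2 * L * T) * (R0 + T * c)"
          using small nd L_nonneg c_nonneg d(1) R0
          by (intro mult_mono add_mono mult_right_mono) (auto intro: mult_left_mono)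
        finally show False using u by (simp add: R_def)
      qed
      then show ?thesis by (simp add: \<phi>_def supp)
    qed
    have tele: "\<bar>(LINT u|\<mu> (real (i + n) * d). mollify e h u) - (LINT u|\<mu> (real i * d). mollify e (\<phi> i n) u)\<bar>
        \<le> n * (d * (M * L * e) + Q * d\<^sup>2)" if "i + n \<le> N" for i n
      using that
    proof (induction n arbitrary: i)
      case 0
      then show ?case by (simp add: \<phi>_def)
    next
      case (Suc n)
      then have le: "Suc i + n \<le> N" by simp
      note g = grid_step[OF d(1) grid[OF Suc.prems]]
      have "\<bar>(LINT u|\<mu> (real (Suc i) * d). mollify e (\<phi> (Suc i) n) u) -
          (LINT u|\<mu> (real i * d). mollify e (\<lambda>u. \<phi> (Suc i) n (euler_step (real i * d) (real (Suc i) * d) u)) u)\<bar>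
          \<le> (real (Suc i) * d - real i * d) * (M * L * e) + Q * (real (Suc i) * d - real i * d)\<^sup>2"
        by (rule step) (use \<phi>_lip[OF le] \<phi>_b \<phi>_supp[OF le] g d(2) in auto)
      moreover have "(\<lambda>u. \<phi> (Suc i) n (euler_step (real i * d) (real (Suc i) * d) u)) = \<phi> i (Suc n)"
        by (simp add: \<phi>_def fun_eq_iff)
      ultimately have "\<bar>(LINT u|\<mu> (real (Suc i) * d). mollify e (\<phi> (Suc i) n) u) -
          (LINT u|\<mu> (real i * d). mollify e (\<phi> i (Suc n)) u)\<bar> \<le> d * (M * L * e) + Q * d\<^sup>2"
        using g(4) by simp
      moreover have "\<bar>(LINT u|\<mu> (real (Suc i + n) * d). mollify e h u) -
          (LINT u|\<mu> (real (Suc i) * d). mollify e (\<phi> (Suc i) n) u)\<bar> \<le> n * (d * (M * L * e) + Q * d\<^sup>2)"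
        by (rule Suc.IH[OF le])
      moreover have "real (Suc n) * (d * (M * L * e) + Q * d\<^sup>2) =
          n * (d * (M * L * e) + Q * d\<^sup>2) + (d * (M * L * e) + Q * d\<^sup>2)"
        by (simp add: algebra_simps)
      moreover have "i + Suc n = Suc i + n" by simp
      ultimately show ?case by (simp only:)
    qed
    have remove: "\<bar>(LINT u|\<mu> s. mollify e k u) - (LINT u|\<mu> s. k u)\<bar> \<le> M * e"
      if s: "s \<in> {0..T}" and k: "\<And>v w. \<bar>k v - k w\<bar> \<le> M * norm (v - w)" "\<And>z. \<bar>k z\<bar> \<le> S" for k s
    proof -
      have close: "\<bar>mollify e k u - k u\<bar> \<le> M * e" for u by (rule mollify_close[OF e k M(1)])
      have ml: "\<bar>mollify e k v - mollify e k w\<bar> \<le> M * norm (v - w)" for v w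
        by (rule mollify_lipschitz[OF e k])
      have "integrable (\<mu> s) k"
        by (rule integrable_bounded[OF s lipschitz_real_measurable(2)[OF k(1)], of S]) (use k in auto)
      moreover have "integrable (\<mu> s) (mollify e k)"
      proof (rule integrable_bounded[OF s lipschitz_real_measurable(2)[OF ml], of "S + M * e"])
        show "norm (mollify e k u) \<le> S + M * e" for u using close[of u] k(2)[of u] by simp
      qed
      ultimately show ?thesis
        using integral_bounded[OF s, of "\<lambda>u. mollify e k u - k u" "M * e"] close by simp
    qed
    have h_M: "\<bar>h v - h w\<bar> \<le> M * norm (v - w)" for v w
      using lip[of v w] mult_right_mono[OF M(2), of "norm (v - w)"] by simp
    have "\<bar>(LINT u|\<mu> t. mollify e h u) - (LINT u|\<mu> 0. mollify e (\<phi> 0 N) u)\<bar> \<le> t * (M * L * e) + Q * t * d"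
    proof -
      have "real N * (d * (M * L * e) + Q * d\<^sup>2) = (real N * d) * (M * L * e) + Q * (real N * d) * d"
        by (simp add: algebra_simps power2_eq_square)
      then show ?thesis using tele[of 0 N] unfolding d(4) by (simp add: d(4))
    qed
    moreover have "\<bar>(LINT u|\<mu> t. mollify e h u) - (LINT u|\<mu> t. h u)\<bar> \<le> M * e"
      by (rule remove[OF _ h_M b]) (use t in auto)
    moreover have "\<bar>(LINT u|\<mu> 0. mollify e (\<phi> 0 N) u) - (LINT u|\<mu> 0. \<phi> 0 N u)\<bar> \<le> M * e"
      by (rule remove[OF _ \<phi>_lip \<phi>_b]) (use T0 in auto)
    moreover have "t * (M * L * e) \<le> T * (M * L * e)"
      using t M L_nonneg e by (intro mult_right_mono) auto
    moreover have "P * e = 2 * (M * e) + T * (M * L * e) + e" by (simp add: P_def algebra_simps)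
    ultimately have "\<bar>(LINT u|\<mu> 0. \<phi> 0 N u) - (LINT u|\<mu> t. h u)\<bar> \<le> P * e + Q * t * d"
      using e by linarith
    also have "\<dots> < \<eta>" using eP N(3)[folded d_def] \<eta> by linarith
    finally show "\<bar>(LINT u|\<mu> 0. h (euler (t / real N) 0 N u)) - (LINT u|\<mu> t. h u)\<bar> < \<eta>"
      by (simp add: \<phi>_def d_def)
  qed
  then show "\<exists>no. \<forall>n\<ge>no. norm ((LINT u|\<mu> 0. h (euler (t / real n) 0 n u)) - (LINT u|\<mu> t. h u)) < \<eta>"
    by (simp add: eventually_sequentially)
qed

text \<open>The extension to unbounded support needs tightness at time \<open>0\<close> along the Euler maps. It is inherited
from the single measure \<open>\<mu> t\<close>, since the compactly supported case applies to the cutoff function itself.\<close>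
lemma euler_pushforward:
  assumes t: "0 < t" "t \<le> T" and M0: "0 \<le> M0"
    and lip: "\<And>v w. \<bar>h v - h w\<bar> \<le> M0 * norm (v - w)" and b: "\<And>z. \<bar>h z\<bar> \<le> S"
  shows "(\<lambda>N. LINT u|\<mu> 0. h (euler (t / real N) 0 N u)) \<longlonglongrightarrow> (LINT u|\<mu> t. h u)"
proof (rule LIMSEQ_I)
  fix \<eta> :: real assume \<eta>: "0 < \<eta>"
  have S: "0 \<le> S" using b[of 0] by linarith
  have tT: "t \<in> {0..T}" "0 \<in> {0..T}" using t by auto
  interpret P0: prob_space "\<mu> 0" by (rule prob) fact
  interpret Pt: prob_space "\<mu> t" by (rule prob) fact
  note [measurable_cong] = sets_\<mu>[OF tT(1)] sets_\<mu>[OF tT(2)]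
  have [measurable]: "(cutoff R :: 'b \<Rightarrow> real) \<in> borel_measurable borel" for R
    by (rule lipschitz_real_measurable(2)[OF cutoff_lipschitz])
  have [measurable]: "h \<in> borel_measurable borel" by (rule lipschitz_real_measurable(2)[OF lip])
  define \<eta>' where "\<eta>' = \<eta> / (4 * (S + 1))"
  have \<eta>': "0 < \<eta>'" "4 * ((S + 1) * \<eta>') = \<eta>" using \<eta> S by (simp_all add: \<eta>'_def divide_simps)
  have "(\<lambda>n. LINT u|\<mu> t. cutoff (real n) u) \<longlonglongrightarrow> 1"
    by (rule cutoff_integral_tendsto[OF prob sets_\<mu>]) fact+
  then have "\<forall>\<^sub>F n in sequentially. 1 - \<eta>' < (LINT u|\<mu> t. cutoff (real n) u)"
    by (rule order_tendstoD(1)) (use \<eta>' in simp)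
  then obtain n where n: "1 - \<eta>' < (LINT u|\<mu> t. cutoff (real n) u)"
    by (auto simp: eventually_sequentially)
  define cut :: "'b \<Rightarrow> real" where "cut = cutoff (real n)"
  have [measurable]: "cut \<in> borel_measurable borel" by (simp add: cut_def)
  have cut: "0 \<le> cut u" "cut u \<le> 1" "\<bar>cut v - cut w\<bar> \<le> 1 * norm (v - w)" "real n + 1 < norm u \<Longrightarrow> cut u = 0" for u v w
    unfolding cut_def by (rule cutoff_bounds cutoff_lipschitz cutoff_support)+
  have hcut_lip: "\<bar>h v * cut v - h w * cut w\<bar> \<le> (M0 + S) * norm (v - w)" for v w
  proof -
    have "h v * cut v - h w * cut w = (h v - h w) * cut v + h w * (cut v - cut w)" by (simp add: algebra_simps)
    also have "\<bar>\<dots>\<bar> \<le> \<bar>h v - h w\<bar> * cut v + \<bar>h w\<bar> * \<bar>cut v - cut w\<bar>"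
      using abs_triangle_ineq[of "(h v - h w) * cut v" "h w * (cut v - cut w)"] cut(1)[of v] by (simp add: abs_mult)
    also have "\<dots> \<le> (M0 * norm (v - w)) * 1 + S * (1 * norm (v - w))"
      by (intro add_mono mult_mono lip b cut) (use M0 S in auto)
    finally show ?thesis by (simp add: algebra_simps)
  qed
  let ?E = "\<lambda>N. euler (t / real N) 0 N"
  have limcut: "(\<lambda>N. LINT u|\<mu> 0. cut (?E N u)) \<longlonglongrightarrow> (LINT u|\<mu> t. cut u)"
    by (rule euler_pushforward_compact[OF t, of "real n + 1" 1 cut 1]) (use cut in \<open>auto simp: abs_le_iff\<close>)
  have limhcut: "(\<lambda>N. LINT u|\<mu> 0. h (?E N u) * cut (?E N u)) \<longlonglongrightarrow> (LINT u|\<mu> t. h u * cut u)"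
  proof (rule euler_pushforward_compact[OF t, of "real n + 1" "M0 + S" "\<lambda>u. h u * cut u" S])
    show "\<bar>h z * cut z\<bar> \<le> S" for z
      using mult_mono[OF b[of z] cut(2)[of z]] cut(1)[of z] S by (simp add: abs_mult)
  qed (use cut(4) hcut_lip M0 S in auto)
  have "\<forall>\<^sub>F N in sequentially. 1 - \<eta>' < (LINT u|\<mu> 0. cut (?E N u))"
    by (rule order_tendstoD(1)[OF limcut]) (use n in \<open>simp add: cut_def\<close>)
  moreover have "\<forall>\<^sub>F N in sequentially. dist (LINT u|\<mu> 0. h (?E N u) * cut (?E N u)) (LINT u|\<mu> t. h u * cut u) < \<eta>'"
    by (rule tendstoD[OF limhcut \<eta>'(1)])
  moreover have "\<forall>\<^sub>F N in sequentially. 0 < N" by (rule eventually_gt_at_top)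
  ultimately have "\<forall>\<^sub>F N in sequentially. \<bar>(LINT u|\<mu> 0. h (?E N u)) - (LINT u|\<mu> t. h u)\<bar> < \<eta>"
  proof eventually_elim
    fix N :: nat
    assume N: "1 - \<eta>' < (LINT u|\<mu> 0. cut (?E N u))"
      "dist (LINT u|\<mu> 0. h (?E N u) * cut (?E N u)) (LINT u|\<mu> t. h u * cut u) < \<eta>'" "0 < N"
    have [measurable]: "?E N \<in> borel_measurable borel"
      by (rule borel_measurable_continuous_onI[OF continuous_euler]) (use t N in auto)
    have tail: "\<bar>(LINT u|Q. F u) - (LINT u|Q. F u * G u)\<bar> \<le> S * \<eta>'"
      if "prob_space Q" and [measurable]: "F \<in> borel_measurable Q" "G \<in> borel_measurable Q"
        and F: "\<And>u. \<bar>F u\<bar> \<le> S" and G: "\<And>u. 0 \<le> G u" "\<And>u. G u \<le> 1" and q: "1 - \<eta>' < (LINT u|Q. G u)"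
      for Q :: "'b measure" and F G
    proof -
      interpret Q: prob_space Q by fact
      have iF: "integrable Q F" by (rule Q.integrable_const_bound[where B = S]) (use F in auto)
      have iG: "integrable Q G" by (rule Q.integrable_const_bound[where B = 1]) (use G in auto)
      have FG: "\<bar>F u * G u\<bar> \<le> S" for u using mult_mono[OF F[of u] G(2)[of u]] G S by (simp add: abs_mult)
      have iFG: "integrable Q (\<lambda>u. F u * G u)" by (rule Q.integrable_const_bound[where B = S]) (use FG in auto)
      have "\<bar>(LINT u|Q. F u) - (LINT u|Q. F u * G u)\<bar> = \<bar>LINT u|Q. F u - F u * G u\<bar>"
        using iF iFG by simp
      also have "\<dots> \<le> (LINT u|Q. \<bar>F u - F u * G u\<bar>)" by (rule integral_abs_bound)
      also have "\<dots> \<le> (LINT u|Q. S * (1 - G u))"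
      proof (rule integral_mono)
        show "\<bar>F u - F u * G u\<bar> \<le> S * (1 - G u)" for u
        proof -
          have "F u - F u * G u = F u * (1 - G u)" by (simp add: algebra_simps)
          then show ?thesis using mult_right_mono[OF F[of u], of "1 - G u"] G(2)[of u] by (simp add: abs_mult)
        qed
      qed (use iF iG iFG in auto)
      also have "\<dots> = S * (1 - (LINT u|Q. G u))" using iG by (simp add: Q.prob_space)
      also have "\<dots> \<le> S * \<eta>'" using q S by (intro mult_left_mono) auto
      finally show ?thesis .
    qed
    have "\<bar>(LINT u|\<mu> 0. h (?E N u)) - (LINT u|\<mu> 0. h (?E N u) * cut (?E N u))\<bar> \<le> S * \<eta>'"
      by (rule tail[OF P0.prob_space_axioms]) (use b cut N in auto)
    moreover have "\<bar>(LINT u|\<mu> t. h u) - (LINT u|\<mu> t. h u * cut u)\<bar> \<le> S * \<eta>'"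
      by (rule tail[OF Pt.prob_space_axioms]) (use b cut n in \<open>auto simp: cut_def\<close>)
    ultimately have "\<bar>(LINT u|\<mu> 0. h (?E N u)) - (LINT u|\<mu> t. h u)\<bar> < 2 * (S * \<eta>') + \<eta>'"
      using N(2) unfolding dist_real_def by linarith
    also have "\<dots> \<le> 4 * ((S + 1) * \<eta>')" using mult_nonneg_nonneg[of S \<eta>'] S \<eta>'(1) by (simp add: algebra_simps)
    finally show "\<bar>(LINT u|\<mu> 0. h (?E N u)) - (LINT u|\<mu> t. h u)\<bar> < \<eta>" using \<eta>' by simp
  qed
  then show "\<exists>no. \<forall>n\<ge>no. norm ((LINT u|\<mu> 0. h (?E n u)) - (LINT u|\<mu> t. h u)) < \<eta>"
    by (simp add: eventually_sequentially)
qed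

text \<open>Both the particles and the solution are compared with the images of their initial values under Euler
maps. These maps stretch distances by at most \<open>exp (L * T)\<close>, so a test function composed with them is
admissible, up to this factor, for the hypothesis on the initial values. Refining the grid removes the
discretisation error.\<close>
lemma particles_track_solution:
  fixes J :: "'j set" and y y' :: "'j \<Rightarrow> real \<Rightarrow> 'b" and B :: "'j \<Rightarrow> real"
  assumes J: "finite J" "J \<noteq> {}" and t: "0 \<le> t" "t \<le> T"
    and y: "\<And>j s. j \<in> J \<Longrightarrow> s \<in> {0..T} \<Longrightarrow> (y j has_vector_derivative y' j s) (at s within {0..T})"
    and y'_cont: "\<And>j. j \<in> J \<Longrightarrow> continuous_on {0..T} (y' j)"
    and gap: "\<And>j. j \<in> J \<Longrightarrow> set_integrable lborel {0..T} (\<lambda>s. norm (y' j s - V s (y j s)))"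
    and initial: "\<And>k. (\<And>z. \<bar>k z\<bar> \<le> 1) \<Longrightarrow> (\<And>v w. \<bar>k v - k w\<bar> \<le> norm (v - w)) \<Longrightarrow>
      \<bar>(\<Sum>j\<in>J. k (y j 0)) / card J - (LINT u|\<mu> 0. k u)\<bar> \<le> d0"
    and h: "\<And>z. \<bar>h z\<bar> \<le> 1" "\<And>v w. \<bar>h v - h w\<bar> \<le> norm (v - w)"
  shows "\<bar>(\<Sum>j\<in>J. h (y j t)) / card J - (LINT u|\<mu> t. h u)\<bar> \<le>
    exp (L * T) * (d0 + (\<Sum>j\<in>J. LINT s:{0..t}|lborel. norm (y' j s - V s (y j s))) / card J)"
proof (cases "t = 0")
  case True
  have d0: "0 \<le> d0" using initial[of "\<lambda>_. 0"] by simp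
  have g0: "0 \<le> (\<Sum>j\<in>J. LINT s:{0..t}|lborel. norm (y' j s - V s (y j s))) / card J"
    unfolding set_lebesgue_integral_def
    by (intro divide_nonneg_nonneg sum_nonneg Bochner_Integration.integral_nonneg) auto
  have "\<bar>(\<Sum>j\<in>J. h (y j t)) / card J - (LINT u|\<mu> t. h u)\<bar> \<le> 1 * d0"
    using initial[OF h] True by simp
  also have "\<dots> \<le> exp (L * T) * (d0 + (\<Sum>j\<in>J. LINT s:{0..t}|lborel. norm (y' j s - V s (y j s))) / card J)"
    using L_nonneg t d0 g0 by (intro mult_mono) auto
  finally show ?thesis .
next
  case False
  then have t0: "0 < t" using t by simp
  have T0: "0 \<le> T" using t by simp
  let ?E = "\<lambda>N. euler (t / real N) 0 N"
  let ?gap = "\<lambda>j. LINT s:{0..t}|lborel. norm (y' j s - V s (y j s))"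
  have card: "0 < real (card J)" using J by (simp add: card_gt_0_iff)
  have "\<forall>j\<in>J. \<exists>B. \<forall>s\<in>{0..T}. norm (y' j s) \<le> B"
  proof
    fix j assume "j \<in> J"
    have "bounded (y' j ` {0..T})"
      by (rule compact_imp_bounded[OF compact_continuous_image[OF y'_cont[OF \<open>j \<in> J\<close>]]]) simp
    then show "\<exists>B. \<forall>s\<in>{0..T}. norm (y' j s) \<le> B" by (auto simp: bounded_iff)
  qed
  then obtain B where B: "\<And>j s. j \<in> J \<Longrightarrow> s \<in> {0..T} \<Longrightarrow> norm (y' j s) \<le> B j" by metis
  define X where "X N = exp (L * T) * (d0 + (\<Sum>j\<in>J. ?gap j + L * B j * t * (t / real N)) / card J)
      + \<bar>(LINT u|\<mu> 0. h (?E N u)) - (LINT u|\<mu> t. h u)\<bar>" for N :: nat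
  have "(\<lambda>N. \<bar>(LINT u|\<mu> 0. h (?E N u)) - (LINT u|\<mu> t. h u)\<bar>) \<longlonglongrightarrow> \<bar>(LINT u|\<mu> t. h u) - (LINT u|\<mu> t. h u)\<bar>"
    by (intro tendsto_intros euler_pushforward[OF t0 t(2), of 1 h 1]) (use h in auto)
  moreover have "(\<lambda>N. exp (L * T) * (d0 + (\<Sum>j\<in>J. ?gap j + L * B j * t * (t / real N)) / card J))
      \<longlonglongrightarrow> exp (L * T) * (d0 + (\<Sum>j\<in>J. ?gap j + L * B j * t * 0) / card J)"
    by (intro tendsto_intros lim_const_over_n) (use card in auto)
  ultimately have X: "X \<longlonglongrightarrow> exp (L * T) * (d0 + (\<Sum>j\<in>J. ?gap j) / card J)"
    unfolding X_def using tendsto_add by fastforce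
  have "\<bar>(\<Sum>j\<in>J. h (y j t)) / card J - (LINT u|\<mu> t. h u)\<bar> \<le> X N" if N: "1 \<le> N" for N
  proof -
    define d where "d = t / real N"
    have d: "0 \<le> d" "real N * d = t" "real (0 + N) * d \<le> T" using N t by (auto simp: d_def)
    have track: "\<bar>h (y j t) - h (?E N (y j 0))\<bar> \<le> exp (L * T) * (?gap j + L * B j * t * d)" if j: "j \<in> J" for j
    proof -
      have "\<bar>h (y j t) - h (?E N (y j 0))\<bar> \<le> norm (y j t - ?E N (y j 0))" by (rule h)
      also have "\<dots> \<le> exp (L * (N * d)) * (?gap j + N * (L * B j * d\<^sup>2))"
        using euler_tracks_path[OF d(1) y[OF j] y'_cont[OF j] B[OF j] gap[OF j] d(3)] d(2)
        by (simp add: d_def)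
      also have "N * (L * B j * d\<^sup>2) = L * B j * t * d" using d(2) by (simp add: power2_eq_square mult_ac)
      also have "exp (L * (N * d)) * (?gap j + L * B j * t * d) \<le> exp (L * T) * (?gap j + L * B j * t * d)"
      proof (rule mult_right_mono)
        show "exp (L * (N * d)) \<le> exp (L * T)" using d L_nonneg by (auto intro: mult_left_mono)
        have "0 \<le> B j" using order_trans[OF norm_ge_zero B[OF j, of 0]] T0 by simp
        moreover have "0 \<le> ?gap j" unfolding set_lebesgue_integral_def
          by (intro Bochner_Integration.integral_nonneg) auto
        ultimately show "0 \<le> ?gap j + L * B j * t * d" using L_nonneg t d by simp
      qed
      finally show ?thesis .
    qed
    have "\<bar>(\<Sum>j\<in>J. h (y j t)) / card J - (\<Sum>j\<in>J. h (?E N (y j 0))) / card J\<bar>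
        = \<bar>\<Sum>j\<in>J. h (y j t) - h (?E N (y j 0))\<bar> / card J"
      using card by (simp add: sum_subtractf diff_divide_distrib[symmetric])
    also have "\<dots> \<le> (\<Sum>j\<in>J. \<bar>h (y j t) - h (?E N (y j 0))\<bar>) / card J"
      by (intro divide_right_mono sum_abs) simp
    also have "\<dots> \<le> (\<Sum>j\<in>J. exp (L * T) * (?gap j + L * B j * t * d)) / card J"
      by (intro divide_right_mono sum_mono track) auto
    also have "\<dots> = exp (L * T) * ((\<Sum>j\<in>J. ?gap j + L * B j * t * d) / card J)"
      by (simp add: sum_distrib_left)
    finally have 1: "\<bar>(\<Sum>j\<in>J. h (y j t)) / card J - (\<Sum>j\<in>J. h (?E N (y j 0))) / card J\<bar>
        \<le> exp (L * T) * ((\<Sum>j\<in>J. ?gap j + L * B j * t * d) / card J)" .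
    define k where "k u = exp (- (L * T)) * h (?E N u)" for u
    have "\<bar>(\<Sum>j\<in>J. k (y j 0)) / card J - (LINT u|\<mu> 0. k u)\<bar> \<le> d0"
    proof (rule initial)
      have "exp (- (L * T)) \<le> 1" using L_nonneg T0 by simp
      then show "\<bar>k z\<bar> \<le> 1" for z
        using mult_mono[of "exp (- (L * T))" 1 "\<bar>h (?E N z)\<bar>" 1] h(1)[of "?E N z"] by (simp add: k_def abs_mult)
      show "\<bar>k v - k w\<bar> \<le> norm (v - w)" for v w
      proof -
        have "\<bar>h (?E N v) - h (?E N w)\<bar> \<le> exp (L * T) * norm (v - w)"
          using order_trans[OF h(2) euler_lipschitz_T[OF d(1,3), of v w]] by (simp add: d_def)
        then have "exp (- (L * T)) * \<bar>h (?E N v) - h (?E N w)\<bar> \<le> exp (- (L * T)) * (exp (L * T) * norm (v - w))"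
          by (rule mult_left_mono) simp
        then show ?thesis
          by (simp add: k_def right_diff_distrib[symmetric] abs_mult mult.assoc[symmetric] mult_exp_exp)
      qed
    qed
    then have "exp (L * T) * \<bar>(\<Sum>j\<in>J. k (y j 0)) / card J - (LINT u|\<mu> 0. k u)\<bar> \<le> exp (L * T) * d0"
      by (rule mult_left_mono) simp
    moreover have "exp (L * T) * \<bar>(\<Sum>j\<in>J. k (y j 0)) / card J - (LINT u|\<mu> 0. k u)\<bar>
        = \<bar>(\<Sum>j\<in>J. h (?E N (y j 0))) / card J - (LINT u|\<mu> 0. h (?E N u))\<bar>"
    proof -
      have "(\<Sum>j\<in>J. k (y j 0)) / card J - (LINT u|\<mu> 0. k u)
          = exp (- (L * T)) * ((\<Sum>j\<in>J. h (?E N (y j 0))) / card J - (LINT u|\<mu> 0. h (?E N u)))"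
        by (simp add: k_def sum_distrib_left[symmetric] right_diff_distrib)
      then show ?thesis by (simp add: abs_mult mult.assoc[symmetric] mult_exp_exp)
    qed
    ultimately have 2: "\<bar>(\<Sum>j\<in>J. h (?E N (y j 0))) / card J - (LINT u|\<mu> 0. h (?E N u))\<bar> \<le> exp (L * T) * d0"
      by simp
    show ?thesis using 1 2 unfolding X_def d_def distrib_left by linarith
  qed
  then have "\<exists>M. \<forall>n\<ge>M. \<bar>(\<Sum>j\<in>J. h (y j t)) / card J - (LINT u|\<mu> t. h u)\<bar> \<le> X n" by blast
  then show ?thesis by (rule LIMSEQ_le_const[OF X])
qed

end

section \<open>Cell averages of an integrable function\<close>

text \<open>The generator \<open>E\<close> consists of relatively closed sets, whose indicators are limits of Lipschitz functions;
the approximation of arbitrary measurable sets starts from these.\<close>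
locale vanishing_cells = prob_space M for M :: "'z::metric_space measure" +
  fixes E :: "'z set set" and I :: "nat \<Rightarrow> 'i set" and C :: "nat \<Rightarrow> 'i \<Rightarrow> 'z set"
  assumes sets_M: "sets M = sigma_sets (space M) E" and Int_stable_E: "Int_stable E"
    and borel_sets: "closed B \<Longrightarrow> B \<inter> space M \<in> sets M"
    and E_closed: "A \<in> E \<Longrightarrow> \<exists>B. closed B \<and> A = B \<inter> space M"
    and sets_C [measurable]: "i \<in> I m \<Longrightarrow> C m i \<in> sets M"
    and C_pos: "i \<in> I m \<Longrightarrow> 0 < measure M (C m i)"
    and C_partition: "AE z in M. (\<Sum>i\<in>I m. indicat_real (C m i) z) = 1"
    and C_diam: "0 < \<eta> \<Longrightarrow> \<forall>\<^sub>F m in sequentially. \<forall>i\<in>I m. \<forall>z\<in>C m i. \<forall>z'\<in>C m i. dist z z' < \<eta>"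
begin

definition average :: "'z set \<Rightarrow> ('z \<Rightarrow> real) \<Rightarrow> real" where
  "average A G = (LINT z:A|M. G z) / measure M A"

text \<open>The \<open>L\<^sup>1\<close> distance from \<open>G\<close> to the function that is constant on cells with the averages of \<open>G\<close> as values.\<close>
definition deviation :: "nat \<Rightarrow> ('z \<Rightarrow> real) \<Rightarrow> real" where
  "deviation m G = (\<Sum>i\<in>I m. LINT z:C m i|M. \<bar>G z - average (C m i) G\<bar>)"

lemma integrable_indicator_M: "A \<in> sets M \<Longrightarrow> integrable M (indicat_real A)"
  by (intro integrable_real_indicator) (auto simp: emeasure_eq_measure)

lemma set_int: "integrable M G \<Longrightarrow> A \<in> sets M \<Longrightarrow> set_integrable M A (G :: 'z \<Rightarrow> real)"
  unfolding set_integrable_def by (rule integrable_mult_indicator)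

lemma set_int_dev: "integrable M G \<Longrightarrow> A \<in> sets M \<Longrightarrow> set_integrable M A (\<lambda>z. \<bar>G z - a\<bar> :: real)"
  by (intro set_int) auto

lemma set_lint_const: "A \<in> sets M \<Longrightarrow> (LINT z:A|M. a) = measure M A * (a::real)"
  by (simp add: set_lebesgue_integral_def)

lemma average_add:
  assumes "integrable M G" "integrable M H" "A \<in> sets M"
  shows "average A (\<lambda>z. G z + H z) = average A G + average A H"
  using set_integral_add(2)[OF set_int[OF assms(1,3)] set_int[OF assms(2,3)]]
  by (simp add: average_def add_divide_distrib)

lemma deviation_nonneg: "0 \<le> deviation m G"
  unfolding deviation_def set_lebesgue_integral_def
  by (intro sum_nonneg Bochner_Integration.integral_nonneg) auto

lemma deviation_add:
  assumes "integrable M G" "integrable M H"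
  shows "deviation m (\<lambda>z. G z + H z) \<le> deviation m G + deviation m H"
  unfolding deviation_def sum.distrib[symmetric]
proof (rule sum_mono)
  fix i assume i: "i \<in> I m"
  let ?a = "average (C m i)"
  have "(LINT z:C m i|M. \<bar>G z + H z - ?a (\<lambda>z. G z + H z)\<bar>)
      \<le> (LINT z:C m i|M. \<bar>G z - ?a G\<bar> + \<bar>H z - ?a H\<bar>)"
    by (rule set_integral_mono)
      (use assms sets_C[OF i] in \<open>auto simp: average_add intro!: set_int_dev set_int\<close>)
  also have "\<dots> = (LINT z:C m i|M. \<bar>G z - ?a G\<bar>) + (LINT z:C m i|M. \<bar>H z - ?a H\<bar>)"
    by (rule set_integral_add(2)) (use assms sets_C[OF i] in \<open>auto intro!: set_int_dev\<close>)
  finally show "(LINT z:C m i|M. \<bar>G z + H z - ?a (\<lambda>z. G z + H z)\<bar>)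
      \<le> (LINT z:C m i|M. \<bar>G z - ?a G\<bar>) + (LINT z:C m i|M. \<bar>H z - ?a H\<bar>)" .
qed

lemma deviation_scale: "deviation m (\<lambda>z. c * G z) = \<bar>c\<bar> * deviation m G"
proof -
  have a: "average A (\<lambda>z. c * G z) = c * average A G" for A
    by (simp add: average_def set_lebesgue_integral_def mult.left_commute)
  have "\<bar>c * G z - c * average A G\<bar> = \<bar>c\<bar> * \<bar>G z - average A G\<bar>" for z A
    by (simp add: right_diff_distrib[symmetric] abs_mult)
  then show ?thesis unfolding deviation_def a
    by (simp add: set_lebesgue_integral_def sum_distrib_left mult.left_commute)
qed

lemma deviation_le_norm:
  assumes G: "integrable M G"
  shows "deviation m G \<le> 2 * (LINT z|M. \<bar>G z\<bar>)"
proof -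
  have cell: "(LINT z:C m i|M. \<bar>G z - average (C m i) G\<bar>) \<le> 2 * (LINT z:C m i|M. \<bar>G z\<bar>)" if i: "i \<in> I m" for i
  proof -
    let ?a = "average (C m i) G"
    have abs: "set_integrable M (C m i) (\<lambda>z. \<bar>G z\<bar>)" by (rule set_int[OF _ sets_C[OF i]]) (use G in auto)
    have "measure M (C m i) * \<bar>?a\<bar> = \<bar>LINT z:C m i|M. G z\<bar>"
      using C_pos[OF i] by (simp add: average_def abs_mult)
    also have "\<dots> \<le> (LINT z:C m i|M. \<bar>G z\<bar>)"
      using set_integral_norm_bound[OF set_int[OF G sets_C[OF i]]] by simp
    finally have a: "measure M (C m i) * \<bar>?a\<bar> \<le> (LINT z:C m i|M. \<bar>G z\<bar>)" .
    have "(LINT z:C m i|M. \<bar>G z - ?a\<bar>) \<le> (LINT z:C m i|M. \<bar>G z\<bar> + \<bar>?a\<bar>)"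
      by (rule set_integral_mono) (use G sets_C[OF i] in \<open>auto intro!: set_int_dev set_int\<close>)
    also have "\<dots> = (LINT z:C m i|M. \<bar>G z\<bar>) + (LINT z:C m i|M. \<bar>?a\<bar>)"
      by (rule set_integral_add(2)[OF abs]) (use sets_C[OF i] in \<open>auto intro!: set_int\<close>)
    also have "\<dots> \<le> 2 * (LINT z:C m i|M. \<bar>G z\<bar>)"
      using a set_lint_const[OF sets_C[OF i], of "\<bar>?a\<bar>"] by linarith
    finally show ?thesis .
  qed
  have "deviation m G \<le> (\<Sum>i\<in>I m. 2 * (LINT z:C m i|M. \<bar>G z\<bar>))"
    unfolding deviation_def by (rule sum_mono) (rule cell)
  also have "\<dots> = 2 * (LINT z|M. (\<Sum>i\<in>I m. indicator (C m i) z * \<bar>G z\<bar>))"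
    unfolding sum_distrib_left[symmetric] set_lebesgue_integral_def
    by (subst Bochner_Integration.integral_sum)
      (use G in \<open>auto intro!: integrable_real_mult_indicator simp: mult.commute[of "indicator _ _"]\<close>)
  also have "(LINT z|M. (\<Sum>i\<in>I m. indicator (C m i) z * \<bar>G z\<bar>)) = (LINT z|M. \<bar>G z\<bar>)"
  proof (rule integral_cong_AE)
    show "AE z in M. (\<Sum>i\<in>I m. indicator (C m i) z * \<bar>G z\<bar>) = \<bar>G z\<bar>"
      using C_partition[of m] by eventually_elim (simp add: sum_distrib_right[symmetric])
  qed (use G in auto)
  finally show ?thesis .
qed

lemma deviation_le_oscillation:
  assumes G: "integrable M G" and "0 \<le> \<eta>"
    and osc: "\<And>i z z'. i \<in> I m \<Longrightarrow> z \<in> C m i \<Longrightarrow> z' \<in> C m i \<Longrightarrow> \<bar>G z - G z'\<bar> \<le> \<eta>"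
  shows "deviation m G \<le> \<eta>"
proof -
  have "(LINT z:C m i|M. \<bar>G z - average (C m i) G\<bar>) \<le> measure M (C m i) * \<eta>" if i: "i \<in> I m" for i
  proof -
    have near: "\<bar>G z - average (C m i) G\<bar> \<le> \<eta>" if z: "z \<in> C m i" for z
    proof -
      let ?p = "measure M (C m i)"
      have "\<bar>LINT z':C m i|M. G z - G z'\<bar> \<le> (LINT z':C m i|M. \<bar>G z - G z'\<bar>)"
        using set_integral_norm_bound[of M "C m i" "\<lambda>z'. G z - G z'"] set_int[of "\<lambda>z'. G z - G z'"] G sets_C[OF i]
        by simp
      also have "\<dots> \<le> (LINT z':C m i|M. \<eta>)"
        by (rule set_integral_mono) (use G sets_C[OF i] osc[OF i z] in \<open>auto intro!: set_int\<close>)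
      also have "\<dots> = ?p * \<eta>" by (rule set_lint_const[OF sets_C[OF i]])
      finally have "\<bar>LINT z':C m i|M. G z - G z'\<bar> \<le> ?p * \<eta>" .
      moreover have "(LINT z':C m i|M. G z - G z') = ?p * (G z - average (C m i) G)"
        using set_integral_diff(2)[of M "C m i" "\<lambda>_. G z" G] set_int[OF G sets_C[OF i]] set_int[of "\<lambda>_. G z"]
          sets_C[OF i] set_lint_const[OF sets_C[OF i], of "G z"] C_pos[OF i]
        by (simp add: average_def right_diff_distrib)
      ultimately show ?thesis using C_pos[OF i] by (simp add: abs_mult)
    qed
    have "(LINT z:C m i|M. \<bar>G z - average (C m i) G\<bar>) \<le> (LINT z:C m i|M. \<eta>)"
      by (rule set_integral_mono) (use G sets_C[OF i] near in \<open>auto intro!: set_int\<close>)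
    then show ?thesis using set_lint_const[OF sets_C[OF i], of \<eta>] by simp
  qed
  then have "deviation m G \<le> (\<Sum>i\<in>I m. measure M (C m i)) * \<eta>"
    unfolding deviation_def sum_distrib_right by (intro sum_mono)
  also have "(\<Sum>i\<in>I m. measure M (C m i)) = (LINT z|M. (\<Sum>i\<in>I m. indicat_real (C m i) z))"
    by (subst Bochner_Integration.integral_sum) (auto intro: integrable_indicator_M)
  also have "\<dots> = (LINT z|M. 1)" using C_partition[of m] by (intro integral_cong_AE) auto
  finally show ?thesis by (simp add: prob_space)
qed

definition flattens :: "('z \<Rightarrow> real) \<Rightarrow> bool" where
  "flattens G \<longleftrightarrow> (\<lambda>m. deviation m G) \<longlonglongrightarrow> 0"

lemma flattens_squeeze:
  assumes "\<And>\<eta>. 0 < \<eta> \<Longrightarrow> \<forall>\<^sub>F m in sequentially. deviation m G \<le> \<eta>"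
  shows "flattens G"
  unfolding flattens_def
proof (rule LIMSEQ_I)
  fix r :: real assume "0 < r"
  then have "\<forall>\<^sub>F m in sequentially. deviation m G \<le> r / 2" using assms[of "r / 2"] by simp
  then show "\<exists>no. \<forall>m\<ge>no. norm (deviation m G - 0) < r"
    using \<open>0 < r\<close> deviation_nonneg by (force simp: eventually_sequentially)
qed

lemma flattens_limit:
  assumes G: "integrable M G" and s: "\<And>n. integrable M (s n)" "\<And>n. flattens (s n)"
    and lim: "(\<lambda>n. LINT z|M. \<bar>s n z - G z\<bar>) \<longlonglongrightarrow> 0"
  shows "flattens G"
proof (rule flattens_squeeze)
  fix \<eta> :: real assume \<eta>: "0 < \<eta>"
  obtain n where n: "(LINT z|M. \<bar>s n z - G z\<bar>) < \<eta> / 4"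
    using order_tendstoD(2)[OF lim, of "\<eta> / 4"] \<eta> by (auto simp: eventually_sequentially)
  have "\<forall>\<^sub>F m in sequentially. deviation m (s n) < \<eta> / 2"
    using order_tendstoD(2)[OF s(2)[of n, unfolded flattens_def], of "\<eta> / 2"] \<eta> by simp
  then show "\<forall>\<^sub>F m in sequentially. deviation m G \<le> \<eta>"
  proof eventually_elim
    fix m assume m: "deviation m (s n) < \<eta> / 2"
    have "deviation m (\<lambda>z. s n z + (G z - s n z)) \<le> deviation m (s n) + deviation m (\<lambda>z. G z - s n z)"
      by (rule deviation_add) (use G s in auto)
    moreover have "deviation m (\<lambda>z. G z - s n z) \<le> 2 * (LINT z|M. \<bar>G z - s n z\<bar>)"
      by (rule deviation_le_norm) (use G s in auto)
    ultimately show "deviation m G \<le> \<eta>" using n m by (simp add: abs_minus_commute)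
  qed
qed

lemma flattens_add:
  assumes "integrable M G" "integrable M H" "flattens G" "flattens H"
  shows "flattens (\<lambda>z. G z + H z)"
  unfolding flattens_def
proof (rule tendsto_sandwich[of "\<lambda>_. 0"])
  show "(\<lambda>m. deviation m G + deviation m H) \<longlonglongrightarrow> 0"
    using tendsto_add[OF assms(3,4)[unfolded flattens_def]] by simp
qed (use deviation_nonneg deviation_add[OF assms(1,2)] in auto)

lemma flattens_scale: "flattens G \<Longrightarrow> flattens (\<lambda>z. c * G z)"
  unfolding flattens_def deviation_scale using tendsto_mult_right_zero by blast

text \<open>The indicator of a closed set is the \<open>L\<^sup>1\<close> limit of the Lipschitz functions \<open>max 0 (1 - n * infdist z B)\<close>,
whose oscillation on small cells is small.\<close>
lemma flattens_generator:
  assumes "A \<in> E" shows "flattens (indicator A)"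
proof -
  have A_sets: "A \<in> sets M" using assms unfolding sets_M by (rule sigma_sets.Basic)
  obtain B where B: "closed B" "A = B \<inter> space M" using E_closed[OF assms] by blast
  show ?thesis
  proof (cases "B = {}")
    case True
    then have "indicator A = (\<lambda>z. 0 :: real)" using B by auto
    then have "deviation m (indicator A) = 0" for m
      by (simp add: deviation_def average_def set_lebesgue_integral_def)
    then show ?thesis by (simp add: flattens_def)
  next
    case False
    define s where "s n z = max 0 (1 - real n * infdist z B)" for n :: nat and z
    have inA: "z \<in> A \<longleftrightarrow> infdist z B = 0" if "z \<in> space M" for z
      using in_closed_iff_infdist_zero[OF B(1) False, of z] that B(2) by auto
    have s_lip: "\<bar>s n z - s n z'\<bar> \<le> real n * dist z z'" for n z z'
    proof -
      have "\<bar>infdist z B - infdist z' B\<bar> \<le> dist z z'"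
        using infdist_triangle_abs[of z B z'] by simp
      then have "real n * \<bar>infdist z B - infdist z' B\<bar> \<le> real n * dist z z'" by (rule mult_left_mono) simp
      moreover have "\<bar>s n z - s n z'\<bar> \<le> \<bar>real n * infdist z B - real n * infdist z' B\<bar>" by (auto simp: s_def)
      ultimately show ?thesis by (simp add: right_diff_distrib[symmetric] abs_mult)
    qed
    have s01: "0 \<le> s n z" "s n z \<le> 1" for n z
      by (auto simp: s_def infdist_nonneg)
    have "(\<lambda>z. z) \<in> measurable M borel"
    proof (rule borel_measurableI)
      fix S :: "'z set" assume "open S"
      then have "space M - (- S) \<inter> space M \<in> sets M" by (intro sets.compl_sets borel_sets) auto
      moreover have "space M - (- S) \<inter> space M = (\<lambda>z. z) -` S \<inter> space M" by auto
      ultimately show "(\<lambda>z. z) -` S \<inter> space M \<in> sets M" by simp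
    qed
    then have sM [measurable]: "s n \<in> borel_measurable M" for n
      unfolding s_def
      by (intro measurable_compose[OF _ borel_measurable_continuous_onI[of "\<lambda>z. max 0 (1 - real n * infdist z B)"]])
        (auto intro!: continuous_intros)
    have s_int: "integrable M (s n)" for n
      by (rule integrable_const_bound[where B = 1]) (use s01 in \<open>auto simp: abs_le_iff\<close>)
    show ?thesis
    proof (rule flattens_limit[OF integrable_indicator_M[OF A_sets] s_int])
      show "flattens (s n)" for n
      proof (rule flattens_squeeze)
        fix \<eta> :: real assume \<eta>: "0 < \<eta>"
        have "\<forall>\<^sub>F m in sequentially. \<forall>i\<in>I m. \<forall>z\<in>C m i. \<forall>z'\<in>C m i. dist z z' < \<eta> / (real n + 1)"
          using \<eta> by (intro C_diam) simp
        then show "\<forall>\<^sub>F m in sequentially. deviation m (s n) \<le> \<eta>"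
        proof eventually_elim
          fix m assume m: "\<forall>i\<in>I m. \<forall>z\<in>C m i. \<forall>z'\<in>C m i. dist z z' < \<eta> / (real n + 1)"
          show "deviation m (s n) \<le> \<eta>"
          proof (rule deviation_le_oscillation[OF s_int])
            fix i z z' assume "i \<in> I m" "z \<in> C m i" "z' \<in> C m i"
            then have "dist z z' * (real n + 1) < \<eta>" using m by (simp add: pos_less_divide_eq)
            moreover have "real n * dist z z' \<le> dist z z' * (real n + 1)" by (simp add: algebra_simps)
            ultimately show "\<bar>s n z - s n z'\<bar> \<le> \<eta>" using s_lip[of n z z'] by linarith
          qed (use \<eta> in simp)
        qed
      qed
      have "(\<lambda>n. LINT z|M. \<bar>s n z - indicator A z\<bar>) \<longlonglongrightarrow> (LINT z|M. 0)"
      proof (rule integral_dominated_convergence[where w = "\<lambda>_. 1"])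
        show "AE z in M. (\<lambda>n. \<bar>s n z - indicator A z\<bar>) \<longlonglongrightarrow> 0"
        proof (rule AE_I2)
          fix z assume z: "z \<in> space M"
          show "(\<lambda>n. \<bar>s n z - indicator A z\<bar>) \<longlonglongrightarrow> 0"
          proof (cases "infdist z B = 0")
            case True
            then show ?thesis using inA[OF z] by (simp add: s_def)
          next
            case ne: False
            then have pos: "0 < infdist z B" using infdist_nonneg[of z B] by simp
            obtain m :: nat where "1 / infdist z B \<le> real m" using real_arch_simple by blast
            then have m: "1 \<le> real m * infdist z B" using pos by (simp add: pos_divide_le_eq)
            have "s n z = 0" if "m \<le> n" for n
            proof -
              have "1 \<le> real n * infdist z B"
                using order_trans[OF m mult_right_mono[of "real m" "real n" "infdist z B"]] that pos by simp
              then show ?thesis by (simp add: s_def)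
            qed
            then show ?thesis using inA[OF z] ne
              by (intro tendsto_eventually) (auto simp: eventually_sequentially)
          qed
        qed
        show "AE z in M. norm \<bar>s n z - indicator A z\<bar> \<le> 1" for n
        proof (rule AE_I2)
          fix z show "norm \<bar>s n z - indicator A z\<bar> \<le> 1" using s01[of n z] by (cases "z \<in> A") auto
        qed
      qed (use A_sets in auto)
      then show "(\<lambda>n. LINT z|M. \<bar>s n z - indicator A z\<bar>) \<longlonglongrightarrow> 0" by simp
    qed
  qed
qed

lemma flattens_const: "flattens (\<lambda>_. c)"
proof (rule flattens_squeeze)
  fix \<eta> :: real assume "0 < \<eta>"
  then have "deviation m (\<lambda>_. c) \<le> \<eta>" for m by (intro deviation_le_oscillation) auto
  then show "\<forall>\<^sub>F m in sequentially. deviation m (\<lambda>_. c) \<le> \<eta>" by simp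
qed

lemma deviation_cong_space:
  assumes "\<And>z. z \<in> space M \<Longrightarrow> G z = H z"
  shows "deviation m G = deviation m H"
proof -
  have a: "average A G = average A H" if "A \<in> sets M" for A
    unfolding average_def set_lebesgue_integral_def
    by (rule arg_cong[where f = "\<lambda>q. q / measure M A"]) (rule Bochner_Integration.integral_cong, use assms in auto)
  show ?thesis unfolding deviation_def set_lebesgue_integral_def
    by (intro sum.cong refl Bochner_Integration.integral_cong) (use assms a sets_C in auto)
qed

lemma flattens_indicator:
  assumes "A \<in> sets M" shows "flattens (indicator A)"
proof -
  note Int_stable_E
  moreover have "E \<subseteq> Pow (space M)"
    using sets.sets_into_space sigma_sets.Basic[of _ E "space M"] unfolding sets_M[symmetric] by blast
  moreover have "A \<in> sigma_sets (space M) E" using assms by (simp add: sets_M)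
  ultimately show ?thesis
  proof (induction A rule: sigma_sets_induct_disjoint)
    case (basic A)
    then show ?case by (rule flattens_generator)
  next
    case empty
    then show ?case using flattens_const[of 0] by (simp add: flattens_def indicator_def)
  next
    case (compl A)
    then have A: "A \<in> sets M" by (simp add: sets_M)
    have "flattens (\<lambda>z. 1 + (- 1) * indicator A z)"
      by (intro flattens_add flattens_const flattens_scale compl(2) integrable_mult_right integrable_indicator_M A) simp
    moreover have "deviation m (\<lambda>z. 1 + (- 1) * indicator A z) = deviation m (indicator (space M - A))" for m
      by (rule deviation_cong_space) (auto simp: indicator_def)
    ultimately show ?case by (simp add: flattens_def)
  next
    case (union A)
    have A: "A i \<in> sets M" for i using union(2) by (auto simp: sets_M)
    have part: "flattens (indicator (\<Union>i<n. A i))" for n :: nat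
    proof (induction n)
      case 0
      then show ?case using flattens_const[of 0] by (simp add: flattens_def indicator_def)
    next
      case (Suc n)
      have "indicat_real (\<Union>i<Suc n. A i) = (\<lambda>z. indicator (\<Union>i<n. A i) z + indicator (A n) z)"
      proof
        fix z
        have "A n \<inter> A i = {}" if "i < n" for i
          by (rule disjoint_family_onD[OF union(1)]) (use that in auto)
        then have "A n \<inter> (\<Union>i<n. A i) = {}" by auto
        then show "indicat_real (\<Union>i<Suc n. A i) z = indicator (\<Union>i<n. A i) z + indicator (A n) z"
          by (auto simp: indicator_def lessThan_Suc)
      qed
      then show ?case
        using flattens_add[OF integrable_indicator_M integrable_indicator_M Suc union(3)[of n]] A by auto
    qed
    show ?case
    proof (rule flattens_limit[OF integrable_indicator_M integrable_indicator_M part])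
      have "(\<lambda>n. LINT z|M. \<bar>indicat_real (\<Union>i<n. A i) z - indicator (\<Union>i. A i) z\<bar>) \<longlonglongrightarrow> (LINT z|M. 0)"
      proof (rule integral_dominated_convergence[where w = "\<lambda>_. 1"])
        show "AE z in M. (\<lambda>n. \<bar>indicat_real (\<Union>i<n. A i) z - indicator (\<Union>i. A i) z\<bar>) \<longlonglongrightarrow> 0"
          by (intro AE_I2 tendsto_rabs_zero LIM_zero LIMSEQ_indicator_UN)
        show "AE z in M. norm \<bar>indicat_real (\<Union>i<n. A i) z - indicator (\<Union>i. A i) z\<bar> \<le> 1" for n
          by (intro AE_I2) (auto simp: indicator_def)
      qed (use A in auto)
      then show "(\<lambda>n. LINT z|M. \<bar>indicat_real (\<Union>i<n. A i) z - indicator (\<Union>i. A i) z\<bar>) \<longlonglongrightarrow> 0" by simp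
    qed (use A in auto)
  qed
qed

text \<open>The functions with this property form a subspace closed in \<open>L\<^sup>1\<close>, and it contains the indicators of all
measurable sets by a Dynkin argument.\<close>
theorem deviation_tendsto_0:
  assumes "integrable M G" shows "(\<lambda>m. deviation m G) \<longlonglongrightarrow> 0"
proof -
  have "flattens G" using assms
  proof (induction rule: integrable_induct)
    case (base A c)
    then show ?case using flattens_scale[OF flattens_indicator[of A], of c] by (simp add: mult.commute)
  next
    case (add f g)
    then show ?case by (auto intro: flattens_add)
  next
    case (lim f s)
    show ?case
    proof (rule flattens_limit[OF lim(4,1,5)])
      have "(\<lambda>n. LINT z|M. \<bar>s n z - f z\<bar>) \<longlonglongrightarrow> (LINT z|M. 0)"
      proof (rule integral_dominated_convergence[where w = "\<lambda>z. 3 * \<bar>f z\<bar>"])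
        show "AE z in M. (\<lambda>n. \<bar>s n z - f z\<bar>) \<longlonglongrightarrow> 0"
          using lim(2) by (intro AE_I2 tendsto_rabs_zero) (simp add: LIM_zero)
        show "AE z in M. norm \<bar>s n z - f z\<bar> \<le> 3 * \<bar>f z\<bar>" for n
        proof (rule AE_I2)
          fix z assume "z \<in> space M"
          from lim(3)[OF this, of n] show "norm \<bar>s n z - f z\<bar> \<le> 3 * \<bar>f z\<bar>" by simp
        qed
      qed (use lim(1,4) in auto)
      then show "(\<lambda>n. LINT z|M. \<bar>s n z - f z\<bar>) \<longlonglongrightarrow> 0" by simp
    qed
  qed
  then show ?thesis by (simp add: flattens_def)
qed

end

section \<open>The cells of a self-similar set\<close>

lemma word_map_Nil [simp]: "word_map F [] = id" by (simp add: word_map_def)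

lemma word_map_Cons [simp]: "word_map F (i # w) = F i \<circ> word_map F w" by (simp add: word_map_def)

lemma word_map_append: "word_map F (w @ v) = word_map F w \<circ> word_map F v"
  by (induction w) (auto simp: o_assoc)

lemma cell_Nil [simp]: "cell F K [] = K" by (simp add: cell_def)

lemma cell_Cons: "cell F K (i # w) = F i ` cell F K w" by (simp add: cell_def image_comp)

lemma cell_append: "cell F K (w @ v) = word_map F w ` cell F K v"
  by (simp add: cell_def word_map_append image_comp)

lemma words_0 [simp]: "words k 0 = {[]}" by (auto simp: words_def)

lemma words_Suc: "words k (Suc n) = (\<lambda>(i, w). i # w) ` ({1..k} \<times> words k n)"
proof (intro set_eqI iffI)
  fix w assume "w \<in> words k (Suc n)"
  then show "w \<in> (\<lambda>(i, w). i # w) ` ({1..k} \<times> words k n)"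
    by (cases w) (auto simp: words_def)
qed (auto simp: words_def)

lemma words_append: "w \<in> words k m \<Longrightarrow> v \<in> words k n \<Longrightarrow> w @ v \<in> words k (m + n)"
  by (auto simp: words_def)

lemma bij_betw_words_append:
  "bij_betw (\<lambda>(w, v). w @ v) (words k m \<times> words k n) (words k (m + n))"
proof (rule bij_betwI[where g = "\<lambda>w. (take m w, drop m w)"])
  show "(\<lambda>w. (take m w, drop m w)) \<in> words k (m + n) \<rightarrow> words k m \<times> words k n"
    by (auto simp: words_def dest: in_set_takeD in_set_dropD)
  show "(\<lambda>(w, v). w @ v) \<in> words k m \<times> words k n \<rightarrow> words k (m + n)" by (auto simp: words_append)
qed (auto simp: words_def)

lemma sum_words_append: "(\<Sum>a\<in>words k (m + n). G a) = (\<Sum>w\<in>words k m. \<Sum>v\<in>words k n. G (w @ v))"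
  using sum.reindex_bij_betw[OF bij_betw_words_append, of G k m n]
  by (simp add: sum.cartesian_product split_beta)

locale self_similar_cells =
  fixes k :: nat and F :: "nat \<Rightarrow> 'a::euclidean_space \<Rightarrow> 'a" and K :: "'a set" and \<nu> :: "'a measure"
  assumes ifs: "contracting_ifs k F" and attr: "attractor k F K" and stat: "stationary_measure k F K \<nu>"
    and cells: "\<And>n w. w \<in> words k n \<Longrightarrow> measure \<nu> (cell F K w) = 1 / real k ^ n"
begin

lemma k_pos: "0 < k"
  using ifs by (auto simp: contracting_ifs_def)

sublocale prob_space \<nu> using stat by (simp add: stationary_measure_def)

lemma sets_\<nu>: "sets \<nu> = sets (restrict_space borel K)"
  using stat by (simp add: stationary_measure_def)

lemma space_\<nu>: "space \<nu> = K"
  using sets_eq_imp_space_eq[OF sets_\<nu>] by (simp add: space_restrict_space)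

lemma compact_K: "compact K" and K_ne: "K \<noteq> {}" and K_eq: "K = (\<Union>i\<in>{1..k}. F i ` K)"
  using attr by (auto simp: attractor_def)

lemma closed_in_sets: "closed B \<Longrightarrow> B \<inter> K \<in> sets \<nu>"
  unfolding sets_\<nu> by (auto simp: sets_restrict_space)

lemma uniform_contraction:
  "\<exists>r. 0 \<le> r \<and> r < 1 \<and> (\<forall>i\<in>{1..k}. \<forall>x y. norm (F i x - F i y) \<le> r * norm (x - y))"
proof -
  have "\<forall>i\<in>{1..k}. \<exists>r. 0 < r \<and> r < 1 \<and> (\<forall>x y. norm (F i x - F i y) \<le> r * norm (x - y))"
    using ifs by (auto simp: contracting_ifs_def)
  then obtain r where r: "\<And>i. i \<in> {1..k} \<Longrightarrow> 0 < r i \<and> r i < 1 \<and>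
      (\<forall>x y. norm (F i x - F i y) \<le> r i * norm (x - y))"
    by metis
  let ?R = "Max (r ` {1..k})"
  have ne: "finite (r ` {1..k})" "r ` {1..k} \<noteq> {}" using k_pos by auto
  have "?R \<in> r ` {1..k}" by (rule Max_in[OF ne])
  then have "0 \<le> ?R" "?R < 1" using r by force+
  moreover have "norm (F i x - F i y) \<le> ?R * norm (x - y)" if "i \<in> {1..k}" for i x y
  proof -
    have "norm (F i x - F i y) \<le> r i * norm (x - y)" using r that by blast
    also have "\<dots> \<le> ?R * norm (x - y)" using that ne by (intro mult_right_mono Max_ge) auto
    finally show ?thesis .
  qed
  ultimately show ?thesis by blast
qed

lemma cell_compact: "set w \<subseteq> {1..k} \<Longrightarrow> compact (cell F K w)"
proof (induction w)
  case (Cons i w)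
  obtain r where r: "0 \<le> r" "\<forall>i\<in>{1..k}. \<forall>x y. norm (F i x - F i y) \<le> r * norm (x - y)"
    using uniform_contraction by blast
  have "r-lipschitz_on (cell F K w) (F i)"
    by (rule lipschitz_onI) (use r Cons.prems in \<open>auto simp: dist_norm\<close>)
  then show ?case using Cons unfolding cell_Cons
    by (intro compact_continuous_image lipschitz_on_continuous_on) auto
qed (simp add: compact_K)

lemma cell_subset: "set w \<subseteq> {1..k} \<Longrightarrow> cell F K w \<subseteq> K"
proof (induction w)
  case (Cons i w)
  then have "F i ` cell F K w \<subseteq> F i ` K" by auto
  also have "\<dots> \<subseteq> (\<Union>i\<in>{1..k}. F i ` K)" using Cons.prems by (intro UN_upper) simp
  also have "\<dots> = K" by (rule K_eq[symmetric])
  finally show ?case by (simp add: cell_Cons)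
qed simp

lemma cell_sets [measurable]: "w \<in> words k n \<Longrightarrow> cell F K w \<in> sets \<nu>"
  using closed_in_sets[OF compact_imp_closed[OF cell_compact[of w]]] cell_subset[of w]
  by (auto simp: words_def Int_absorb2)

lemma cell_append_subset: "v \<in> words k n \<Longrightarrow> cell F K (w @ v) \<subseteq> cell F K w"
  using cell_subset[of v] by (auto simp: cell_append words_def) (auto simp: cell_def)

lemma cells_cover: "(\<Union>w\<in>words k n. cell F K w) = K"
proof (induction n)
  case (Suc n)
  have "(\<Union>w\<in>words k (Suc n). cell F K w) = (\<Union>i\<in>{1..k}. F i ` (\<Union>w\<in>words k n. cell F K w))"
  proof (intro set_eqI iffI)
    fix x assume "x \<in> (\<Union>w\<in>words k (Suc n). cell F K w)"
    then obtain i w where "i \<in> {1..k}" "w \<in> words k n" "x \<in> F i ` cell F K w"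
      by (auto simp: words_Suc cell_Cons)
    then show "x \<in> (\<Union>i\<in>{1..k}. F i ` (\<Union>w\<in>words k n. cell F K w))" by blast
  next
    fix x assume "x \<in> (\<Union>i\<in>{1..k}. F i ` (\<Union>w\<in>words k n. cell F K w))"
    then obtain i w where "i \<in> {1..k}" "w \<in> words k n" "x \<in> cell F K (i # w)"
      by (auto simp: cell_Cons)
    then show "x \<in> (\<Union>w\<in>words k (Suc n). cell F K w)" by (force simp: words_Suc)
  qed
  then show ?case using Suc K_eq by simp
qed simp

lemma cell_diameter:
  assumes "0 < \<eta>"
  shows "\<forall>\<^sub>F n in sequentially. \<forall>w\<in>words k n. \<forall>x\<in>cell F K w. \<forall>y\<in>cell F K w. dist x y < \<eta>"
proof -
  obtain r where r: "0 \<le> r" "r < 1" "\<forall>i\<in>{1..k}. \<forall>x y. norm (F i x - F i y) \<le> r * norm (x - y)"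
    using uniform_contraction by blast
  have small: "\<forall>w\<in>words k n. \<forall>x\<in>cell F K w. \<forall>y\<in>cell F K w. dist x y \<le> r ^ n * diameter K" for n
  proof (induction n)
    case 0
    then show ?case using diameter_bounded_bound[OF compact_imp_bounded[OF compact_K]] by simp
  next
    case (Suc n)
    show ?case
    proof (intro ballI)
      fix w x y assume "w \<in> words k (Suc n)" and xy: "x \<in> cell F K w" "y \<in> cell F K w"
      then obtain i v where w: "w = i # v" "i \<in> {1..k}" "v \<in> words k n" by (auto simp: words_Suc)
      then obtain x' y' where x': "x = F i x'" "y = F i y'" "x' \<in> cell F K v" "y' \<in> cell F K v"
        using xy by (auto simp: cell_Cons)
      have "dist x y \<le> r * dist x' y'" using r(3) w x' by (simp add: dist_norm)
      also have "\<dots> \<le> r * (r ^ n * diameter K)" using Suc w x' r by (intro mult_left_mono) auto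
      finally show "dist x y \<le> r ^ Suc n * diameter K" by simp
    qed
  qed
  have "(\<lambda>n. r ^ n * diameter K) \<longlonglongrightarrow> 0 * diameter K"
    by (intro tendsto_mult LIMSEQ_realpow_zero tendsto_const) (use r in auto)
  then have "\<forall>\<^sub>F n in sequentially. r ^ n * diameter K < \<eta>" by (intro order_tendstoD) (use assms in simp_all)
  then show ?thesis by eventually_elim (use small in \<open>force intro: le_less_trans\<close>)
qed

lemma word_of_cell:
  assumes "x \<in> K" shows "word_of k F K n x \<in> words k n" "x \<in> cell F K (word_of k F K n x)"
proof -
  have "\<exists>w. w \<in> words k n \<and> x \<in> cell F K w" using assms cells_cover[of n] by auto
  from someI_ex[OF this] show "word_of k F K n x \<in> words k n" "x \<in> cell F K (word_of k F K n x)"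
    unfolding word_of_def by auto
qed

lemma integrable_indicator_\<nu>: "A \<in> sets \<nu> \<Longrightarrow> integrable \<nu> (indicat_real A)"
  by (intro integrable_real_indicator) (auto simp: emeasure_eq_measure)

lemma sum_cell_indicators_ge_1: 
  assumes "x \<in> K" shows "1 \<le> (\<Sum>w\<in>words k n. indicat_real (cell F K w) x)"
proof -
  have "indicat_real (cell F K (word_of k F K n x)) x \<le> (\<Sum>w\<in>words k n. indicat_real (cell F K w) x)"
    by (rule member_le_sum) (use word_of_cell[OF assms] in auto)
  then show ?thesis using word_of_cell[OF assms] by simp
qed

text \<open>The cells of level \<open>n\<close> cover \<open>K\<close> and their measures add up to \<open>1\<close>, so the number of cells containing a
point is at least \<open>1\<close> everywhere and has mean \<open>1\<close>. Hence overlaps are null sets.\<close>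
lemma AE_sum_cell_indicators: "AE x in \<nu>. \<forall>n. (\<Sum>w\<in>words k n. indicat_real (cell F K w) x) = 1"
  unfolding AE_all_countable
proof
  fix n
  let ?S = "\<lambda>x. \<Sum>w\<in>words k n. indicat_real (cell F K w) x"
  have int: "integrable \<nu> ?S"
    by (intro Bochner_Integration.integrable_sum integrable_indicator_\<nu> cell_sets)
  have "(LINT x|\<nu>. ?S x) = (\<Sum>w\<in>words k n. measure \<nu> (cell F K w))"
    by (subst Bochner_Integration.integral_sum) (auto intro: integrable_indicator_\<nu> cell_sets)
  also have "\<dots> = 1" using k_pos by (simp add: cells card_words)
  finally have "(LINT x|\<nu>. ?S x - 1) = 0" using int by (simp add: prob_space)
  moreover have "AE x in \<nu>. 0 \<le> ?S x - 1" using sum_cell_indicators_ge_1 by (intro AE_I2) (simp add: space_\<nu>)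
  ultimately have "AE x in \<nu>. ?S x - 1 = 0"
    using integral_nonneg_eq_0_iff_AE[of \<nu> "\<lambda>x. ?S x - 1"] int by simp
  then show "AE x in \<nu>. ?S x = 1" by simp
qed

lemma AE_word_of: "AE x in \<nu>. \<forall>n. \<forall>w\<in>words k n. x \<in> cell F K w \<longleftrightarrow> w = word_of k F K n x"
  using AE_sum_cell_indicators AE_space
proof eventually_elim
  fix x assume sum: "\<forall>n. (\<Sum>w\<in>words k n. indicat_real (cell F K w) x) = 1" and "x \<in> space \<nu>"
  then have x: "x \<in> K" by (simp add: space_\<nu>)
  show "\<forall>n. \<forall>w\<in>words k n. x \<in> cell F K w \<longleftrightarrow> w = word_of k F K n x"
  proof (intro allI ballI iffI)
    fix n w assume w: "w \<in> words k n" "x \<in> cell F K w"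
    show "w = word_of k F K n x"
    proof (rule ccontr)
      assume ne: "w \<noteq> word_of k F K n x"
      have "(\<Sum>v\<in>{w, word_of k F K n x}. indicat_real (cell F K v) x)
          \<le> (\<Sum>v\<in>words k n. indicat_real (cell F K v) x)"
        by (rule sum_mono2) (use w word_of_cell[OF x] in auto)
      then show False using sum ne w word_of_cell[OF x, of n] by simp
    qed
  qed (use word_of_cell[OF x] in auto)
qed

text \<open>This replaces the choice made in \<open>word_of\<close> by a sum that is visibly measurable in \<open>x\<close>.\<close>
lemma sum_cells_eq_word_of:
  assumes "\<forall>w\<in>words k n. x \<in> cell F K w \<longleftrightarrow> w = word_of k F K n x" "x \<in> K"
  shows "(\<Sum>w\<in>words k n. indicator (cell F K w) x * G w) = (G (word_of k F K n x) :: 'c::semiring_1)"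
proof -
  have "(\<Sum>w\<in>words k n. indicator (cell F K w) x * G w)
      = (\<Sum>w\<in>words k n. if w = word_of k F K n x then G w else 0)"
    by (rule sum.cong) (use assms in auto)
  then show ?thesis using word_of_cell[OF assms(2)] by simp
qed

lemma sets_\<nu>_closed: "sets \<nu> = sigma_sets K ((\<inter>) K ` Collect closed)"
proof -
  have "sets \<nu> = (\<inter>) K ` sigma_sets UNIV (Collect closed)"
    unfolding sets_\<nu> sets_restrict_space borel_eq_closed by simp
  also have "\<dots> = sigma_sets K ((\<inter>) K ` Collect closed)"
    by (rule sigma_sets_Int) (auto intro: sigma_sets.Basic compact_imp_closed[OF compact_K])
  finally show ?thesis .
qed

lemma AE_fst_snd:
  assumes "AE x in \<nu>. P x"
  shows "AE p in \<nu> \<Otimes>\<^sub>M \<nu>. P (fst p)" "AE p in \<nu> \<Otimes>\<^sub>M \<nu>. P (snd p)"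
proof -
  obtain N where N: "N \<in> null_sets \<nu>" "{x \<in> space \<nu>. \<not> P x} \<subseteq> N" using assms by (auto simp: eventually_ae_filter)
  show "AE p in \<nu> \<Otimes>\<^sub>M \<nu>. P (fst p)"
    by (rule AE_I'[OF times_in_null_sets1[OF N(1) sets.top]]) (use N(2) in \<open>auto simp: space_pair_measure\<close>)
  show "AE p in \<nu> \<Otimes>\<^sub>M \<nu>. P (snd p)"
    by (rule AE_I'[OF times_in_null_sets2[OF sets.top N(1)]]) (use N(2) in \<open>auto simp: space_pair_measure\<close>)
qed

lemma measure_cell_pair:
  assumes "w \<in> words k m" "v \<in> words k n"
  shows "measure (\<nu> \<Otimes>\<^sub>M \<nu>) (cell F K w \<times> cell F K v) = measure \<nu> (cell F K w) * measure \<nu> (cell F K v)"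
  using assms by (simp add: measure_def emeasure_pair_measure_Times cell_sets enn2real_mult)

sublocale pair: vanishing_cells "\<nu> \<Otimes>\<^sub>M \<nu>"
  "{a \<times> b | a b. a \<in> (\<inter>) K ` Collect closed \<and> b \<in> (\<inter>) K ` Collect closed}"
  "\<lambda>m. words k m \<times> words k m" "\<lambda>m p. cell F K (fst p) \<times> cell F K (snd p)"
proof (intro vanishing_cells.intro vanishing_cells_axioms.intro)
  interpret pair_prob_space \<nu> \<nu> ..
  let ?G = "(\<inter>) K ` Collect closed"
  let ?E = "{a \<times> b | a b. a \<in> ?G \<and> b \<in> ?G}"
  have KG: "K \<in> ?G" by (rule image_eqI[of _ _ UNIV]) auto
  show "prob_space (\<nu> \<Otimes>\<^sub>M \<nu>)" by (rule P.prob_space_axioms)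
  have "sets (\<nu> \<Otimes>\<^sub>M \<nu>) = sets (sigma (space \<nu> \<times> space \<nu>) ?E)"
    by (rule sets_pair_eq[of _ _ "{K}" _ _ "{K}"]) (use KG in \<open>auto simp: space_\<nu> sets_\<nu>_closed\<close>)
  also have "\<dots> = sigma_sets (space \<nu> \<times> space \<nu>) ?E" by (rule sets_measure_of) (auto simp: space_\<nu>)
  finally show "sets (\<nu> \<Otimes>\<^sub>M \<nu>) = sigma_sets (space (\<nu> \<Otimes>\<^sub>M \<nu>)) ?E" by (simp add: space_pair_measure)
  show "Int_stable ?E"
  proof (rule Int_stableI)
    fix A B assume "A \<in> ?E" "B \<in> ?E"
    then obtain a b c d where abcd: "closed a" "closed b" "closed c" "closed d"
      "A = (K \<inter> a) \<times> (K \<inter> b)" "B = (K \<inter> c) \<times> (K \<inter> d)" by auto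
    then have "A \<inter> B = (K \<inter> (a \<inter> c)) \<times> (K \<inter> (b \<inter> d))" by auto
    then show "A \<inter> B \<in> ?E" using abcd(1-4) by auto
  qed
  show "\<exists>B. closed B \<and> A = B \<inter> space (\<nu> \<Otimes>\<^sub>M \<nu>)" if A: "A \<in> ?E" for A
  proof -
    obtain a b where "closed a" "closed b" "A = (K \<inter> a) \<times> (K \<inter> b)" using A by auto
    then show ?thesis by (intro exI[of _ "a \<times> b"]) (auto simp: space_pair_measure space_\<nu> intro: closed_Times)
  qed
  show "B \<inter> space (\<nu> \<Otimes>\<^sub>M \<nu>) \<in> sets (\<nu> \<Otimes>\<^sub>M \<nu>)" if "closed B" for B :: "('a \<times> 'a) set"
  proof -
    have id: "(\<lambda>x. x) \<in> measurable \<nu> borel"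
      by (simp add: measurable_cong_sets[OF sets_\<nu> refl] measurable_restrict_space1)
    then have "(\<lambda>p. (fst p, snd p)) \<in> measurable (\<nu> \<Otimes>\<^sub>M \<nu>) (borel \<Otimes>\<^sub>M borel)"
      by (intro measurable_Pair measurable_compose[OF measurable_fst id] measurable_compose[OF measurable_snd id])
    then have "(\<lambda>p. p) \<in> measurable (\<nu> \<Otimes>\<^sub>M \<nu>) (borel :: ('a \<times> 'a) measure)" by (simp add: borel_prod)
    from measurable_sets[OF this, of B] show ?thesis using that by simp
  qed
  fix m
  show "cell F K (fst i) \<times> cell F K (snd i) \<in> sets (\<nu> \<Otimes>\<^sub>M \<nu>)" if "i \<in> words k m \<times> words k m" for i
    using that by (auto intro!: pair_measureI cell_sets)
  show "0 < measure (\<nu> \<Otimes>\<^sub>M \<nu>) (cell F K (fst i) \<times> cell F K (snd i))" if "i \<in> words k m \<times> words k m" for i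
    using that k_pos by (auto simp: measure_cell_pair cells)
  show "AE z in \<nu> \<Otimes>\<^sub>M \<nu>. (\<Sum>i\<in>words k m \<times> words k m. indicat_real (cell F K (fst i) \<times> cell F K (snd i)) z) = 1"
    using AE_fst_snd[OF AE_sum_cell_indicators]
  proof eventually_elim
    case (elim z)
    have "(\<Sum>i\<in>words k m \<times> words k m. indicat_real (cell F K (fst i) \<times> cell F K (snd i)) z)
      = (\<Sum>w\<in>words k m. \<Sum>v\<in>words k m. indicat_real (cell F K w) (fst z) * indicat_real (cell F K v) (snd z))"
      unfolding sum.cartesian_product by (rule sum.cong) (auto simp: indicator_def mem_Times_iff)
    then show ?case using elim by (simp add: sum_distrib_left[symmetric])
  qed
next
  fix \<eta> :: real assume "0 < \<eta>"
  then have "\<forall>\<^sub>F n in sequentially. \<forall>w\<in>words k n. \<forall>x\<in>cell F K w. \<forall>y\<in>cell F K w. dist x y < \<eta> / 2"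
    by (intro cell_diameter) simp
  then show "\<forall>\<^sub>F m in sequentially. \<forall>i\<in>words k m \<times> words k m. \<forall>z\<in>cell F K (fst i) \<times> cell F K (snd i).
      \<forall>z'\<in>cell F K (fst i) \<times> cell F K (snd i). dist z z' < \<eta>"
  proof eventually_elim
    case (elim m)
    show ?case
    proof (intro ballI)
      fix i z z' assume "i \<in> words k m \<times> words k m" "z \<in> cell F K (fst i) \<times> cell F K (snd i)"
        "z' \<in> cell F K (fst i) \<times> cell F K (snd i)"
      then have "dist (fst z) (fst z') < \<eta> / 2" "dist (snd z) (snd z') < \<eta> / 2" using elim by auto
      moreover have "dist z z' \<le> dist (fst z) (fst z') + dist (snd z) (snd z')"
        unfolding dist_prod_def by (rule sqrt_sum_squares_le_sum) auto
      ultimately show "dist z z' < \<eta>" by linarith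
    qed
  qed
qed

lemma cell_average_eq_average:
  assumes "w \<in> words k m" "v \<in> words k n"
  shows "cell_average F K \<nu> W w v = pair.average (cell F K w \<times> cell F K v) W"
  using measure_cell_pair[OF assms] by (simp add: cell_average_def pair.average_def)

end

section \<open>Weak convergence of the initial data\<close>

lemma finite_partition_of_unity:
  fixes R \<eta> :: real
  assumes \<eta>: "0 < \<eta>"
  shows "\<exists>A (\<phi> :: 'b::euclidean_space \<Rightarrow> 'b \<Rightarrow> real). finite A \<and> (\<forall>a. continuous_on UNIV (\<phi> a)) \<and>
    (\<forall>a u. 0 \<le> \<phi> a u) \<and> (\<forall>a u. \<phi> a u \<noteq> 0 \<longrightarrow> dist a u \<le> \<eta>) \<and>
    (\<forall>u. (\<Sum>a\<in>A. \<phi> a u) \<le> 1) \<and> (\<forall>u. norm u \<le> R \<longrightarrow> (\<Sum>a\<in>A. \<phi> a u) = 1)"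
proof -
  have "compact (cball (0::'b) R)" by simp
  moreover have "cball (0::'b) R \<subseteq> (\<Union>a\<in>cball 0 R. ball a (\<eta> / 2))" using \<eta> by force
  ultimately obtain A where A: "A \<subseteq> cball 0 R" "finite A" "cball (0::'b) R \<subseteq> (\<Union>a\<in>A. ball a (\<eta> / 2))"
    by (elim compactE_image) auto
  define \<psi> :: "'b \<Rightarrow> 'b \<Rightarrow> real" where "\<psi> a u = max 0 (\<eta> - dist a u)" for a u
  define S where "S u = (\<Sum>a\<in>A. \<psi> a u)" for u
  have \<psi>0: "0 \<le> \<psi> a u" for a u by (simp add: \<psi>_def)
  have S0: "0 \<le> S u" for u unfolding S_def by (intro sum_nonneg \<psi>0)
  have cont\<psi>: "continuous_on UNIV (\<psi> a)" for a unfolding \<psi>_def by (intro continuous_intros)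
  have contS: "continuous_on UNIV S" unfolding S_def by (intro continuous_intros cont\<psi>)
  have low: "\<eta> / 2 \<le> S u" if u: "norm u \<le> R" for u
  proof -
    obtain a where a: "a \<in> A" "dist a u < \<eta> / 2" using A(3) u by force
    then have "\<eta> / 2 \<le> \<psi> a u" unfolding \<psi>_def by (intro max.coboundedI2) simp
    also have "\<dots> \<le> S u" unfolding S_def by (rule member_le_sum) (use a A \<psi>0 in auto)
    finally show ?thesis .
  qed
  define \<phi> where "\<phi> a u = \<psi> a u / max (S u) (\<eta> / 2)" for a u
  have pos: "0 < max (S u) (\<eta> / 2)" for u using \<eta> by (simp add: less_max_iff_disj)
  have sum: "(\<Sum>a\<in>A. \<phi> a u) = S u / max (S u) (\<eta> / 2)" for u
    by (simp add: \<phi>_def S_def sum_divide_distrib)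
  show ?thesis
  proof (intro exI[of _ A] exI[of _ \<phi>] conjI allI impI A(2))
    show "continuous_on UNIV (\<phi> a)" for a
      unfolding \<phi>_def by (intro continuous_intros cont\<psi> contS) (use pos in \<open>auto simp: less_imp_neq[symmetric]\<close>)
    show "0 \<le> \<phi> a u" for a u using \<psi>0[of a u] pos[of u] by (simp add: \<phi>_def)
    show "dist a u \<le> \<eta>" if "\<phi> a u \<noteq> 0" for a u
      using that by (auto simp: \<phi>_def \<psi>_def max_def split: if_splits)
    show "(\<Sum>a\<in>A. \<phi> a u) \<le> 1" for u unfolding sum using pos[of u] by (simp add: divide_le_eq)
    show "(\<Sum>a\<in>A. \<phi> a u) = 1" if "norm u \<le> R" for u
      unfolding sum using low[OF that] \<eta> by (simp add: max_def)
  qed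
qed

text \<open>On the support of \<open>\<phi> a\<close> a function with Lipschitz constant \<open>1\<close> differs from its value at \<open>a\<close> by at most
\<open>\<eta>\<close>, so finitely many integrals control all such functions at once. The mass of \<open>P\<close> missed by the
partition is controlled by that of \<open>Q\<close> and the same integrals.\<close>
lemma lipschitz_functional_by_partition:
  fixes P Q :: "'b::euclidean_space measure"
  assumes "prob_space P" "prob_space Q" and sets: "sets P = sets borel" "sets Q = sets borel"
    and A: "finite A" and cont: "\<And>a. continuous_on UNIV (\<phi> a)" and nonneg: "\<And>a u. 0 \<le> \<phi> a u"
    and near: "\<And>a u. \<phi> a u \<noteq> 0 \<Longrightarrow> dist a u \<le> \<eta>" and le1: "\<And>u. (\<Sum>a\<in>A. \<phi> a u) \<le> 1" and \<eta>: "0 \<le> \<eta>"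
    and h: "\<And>z. \<bar>h z\<bar> \<le> 1" "\<And>v w. \<bar>h v - h w\<bar> \<le> norm (v - w)"
  shows "\<bar>(LINT u|P. h u) - (LINT u|Q. h u)\<bar> \<le>
    2 * (\<Sum>a\<in>A. \<bar>(LINT u|P. \<phi> a u) - (LINT u|Q. \<phi> a u)\<bar>) + 2 * \<eta> + 2 * (1 - (LINT u|Q. (\<Sum>a\<in>A. \<phi> a u)))"
proof -
  let ?\<Phi> = "\<lambda>u. \<Sum>a\<in>A. \<phi> a u"
  have [measurable]: "\<phi> a \<in> borel_measurable borel" for a by (rule borel_measurable_continuous_onI[OF cont])
  have [measurable]: "h \<in> borel_measurable borel"
    by (rule lipschitz_real_measurable(2)[where M = 1]) (use h in auto)
  have \<phi>1: "\<phi> a u \<le> 1" if "a \<in> A" for a u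
    using member_le_sum[OF that, of "\<lambda>a. \<phi> a u"] nonneg A le1[of u] by force
  have one: "\<bar>(LINT u|M. h u) - (\<Sum>a\<in>A. h a * (LINT u|M. \<phi> a u))\<bar> \<le> \<eta> + 1 - (LINT u|M. ?\<Phi> u)"
    and int\<Phi>: "(LINT u|M. ?\<Phi> u) = (\<Sum>a\<in>A. LINT u|M. \<phi> a u)"
    if "prob_space M" and [measurable_cong]: "sets M = sets borel" for M
  proof -
    interpret prob_space M by fact
    have i\<phi>: "integrable M (\<phi> a)" if "a \<in> A" for a
      by (rule integrable_const_bound[where B = 1]) (use nonneg \<phi>1[OF that] in \<open>auto simp: abs_le_iff intro: order_trans[of _ 0]\<close>)
    have ih: "integrable M h" by (rule integrable_const_bound[where B = 1]) (use h in auto)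
    have i\<Phi>: "integrable M ?\<Phi>" by (intro Bochner_Integration.integrable_sum i\<phi>)
    show "(LINT u|M. ?\<Phi> u) = (\<Sum>a\<in>A. LINT u|M. \<phi> a u)" by (rule Bochner_Integration.integral_sum) (rule i\<phi>)
    have isum: "integrable M (\<lambda>u. \<Sum>a\<in>A. h a * \<phi> a u)"
      by (intro Bochner_Integration.integrable_sum integrable_mult_right i\<phi>)
    have "(LINT u|M. h u) - (\<Sum>a\<in>A. h a * (LINT u|M. \<phi> a u)) = (LINT u|M. h u - (\<Sum>a\<in>A. h a * \<phi> a u))"
    proof -
      have "(LINT u|M. (\<Sum>a\<in>A. h a * \<phi> a u)) = (\<Sum>a\<in>A. h a * (LINT u|M. \<phi> a u))"
        by (subst Bochner_Integration.integral_sum) (auto intro: i\<phi>)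
      then show ?thesis using ih isum by simp
    qed
    also have "\<bar>\<dots>\<bar> \<le> (LINT u|M. \<bar>h u - (\<Sum>a\<in>A. h a * \<phi> a u)\<bar>)" by (rule integral_abs_bound)
    also have "\<dots> \<le> (LINT u|M. \<eta> + (1 - ?\<Phi> u))"
    proof (rule integral_mono)
      fix u
      have "h u - (\<Sum>a\<in>A. h a * \<phi> a u) = (\<Sum>a\<in>A. (h u - h a) * \<phi> a u) + h u * (1 - ?\<Phi> u)"
        by (simp add: left_diff_distrib right_diff_distrib sum_subtractf sum_distrib_left)
      also have "\<bar>\<dots>\<bar> \<le> (\<Sum>a\<in>A. \<bar>(h u - h a) * \<phi> a u\<bar>) + \<bar>h u\<bar> * (1 - ?\<Phi> u)"
        using sum_abs[of "\<lambda>a. (h u - h a) * \<phi> a u" A] abs_triangle_ineq[of "\<Sum>a\<in>A. (h u - h a) * \<phi> a u" "h u * (1 - ?\<Phi> u)"]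
          le1[of u] by (simp add: abs_mult)
      also have "\<dots> \<le> (\<Sum>a\<in>A. \<eta> * \<phi> a u) + 1 * (1 - ?\<Phi> u)"
      proof (intro add_mono sum_mono mult_right_mono h)
        fix a assume "a \<in> A"
        show "\<bar>(h u - h a) * \<phi> a u\<bar> \<le> \<eta> * \<phi> a u"
        proof (cases "\<phi> a u = 0")
          case False
          have "\<bar>h u - h a\<bar> \<le> \<eta>" using h(2)[of u a] near[OF False] by (simp add: dist_norm norm_minus_commute)
          then show ?thesis using nonneg[of a u] by (simp add: abs_mult mult_right_mono)
        qed simp
      qed (use le1[of u] in auto)
      also have "\<dots> \<le> \<eta> + (1 - ?\<Phi> u)"
        using mult_left_mono[OF le1[of u] \<eta>] by (simp add: sum_distrib_left)
      finally show "\<bar>h u - (\<Sum>a\<in>A. h a * \<phi> a u)\<bar> \<le> \<eta> + (1 - ?\<Phi> u)" .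
    qed (use ih isum i\<Phi> in auto)
    also have "\<dots> = \<eta> + 1 - (LINT u|M. ?\<Phi> u)" using i\<Phi> by (simp add: prob_space)
    finally show "\<bar>(LINT u|M. h u) - (\<Sum>a\<in>A. h a * (LINT u|M. \<phi> a u))\<bar> \<le> \<eta> + 1 - (LINT u|M. ?\<Phi> u)" .
  qed
  let ?d = "\<Sum>a\<in>A. \<bar>(LINT u|P. \<phi> a u) - (LINT u|Q. \<phi> a u)\<bar>"
  have "\<bar>(\<Sum>a\<in>A. h a * (LINT u|P. \<phi> a u)) - (\<Sum>a\<in>A. h a * (LINT u|Q. \<phi> a u))\<bar>
      = \<bar>\<Sum>a\<in>A. h a * ((LINT u|P. \<phi> a u) - (LINT u|Q. \<phi> a u))\<bar>"
    by (simp add: right_diff_distrib sum_subtractf)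
  also have "\<dots> \<le> (\<Sum>a\<in>A. \<bar>h a * ((LINT u|P. \<phi> a u) - (LINT u|Q. \<phi> a u))\<bar>)" by (rule sum_abs)
  also have "\<dots> \<le> ?d"
    unfolding abs_mult by (intro sum_mono mult_left_le_one_le h) auto
  finally have "\<bar>(\<Sum>a\<in>A. h a * (LINT u|P. \<phi> a u)) - (\<Sum>a\<in>A. h a * (LINT u|Q. \<phi> a u))\<bar> \<le> ?d" .
  moreover have "\<bar>(LINT u|P. ?\<Phi> u) - (LINT u|Q. ?\<Phi> u)\<bar> \<le> ?d"
    unfolding int\<Phi>[OF assms(1,3)] int\<Phi>[OF assms(2,4)] sum_subtractf[symmetric] by (rule sum_abs)
  moreover have "\<bar>p - q\<bar> \<le> 2 * d + 2 * \<eta> + 2 * (1 - b)"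
    if "\<bar>p' - q'\<bar> \<le> d" "\<bar>a - b\<bar> \<le> d" "\<bar>p - p'\<bar> \<le> \<eta> + 1 - a" "\<bar>q - q'\<bar> \<le> \<eta> + 1 - b"
    for p q p' q' a b d :: real
    using that by (auto simp: abs_le_iff)
  ultimately show ?thesis using one[OF assms(1,3)] one[OF assms(2,4)] by blast
qed

lemma prob_space_local_empirical:
  assumes "0 < k" shows "prob_space (local_empirical k F K u m l t x)"
proof -
  interpret prob_space "uniform_count_measure (words k l)"
    by (rule prob_space_uniform_count_measure) (use assms card_words[of k l] in \<open>auto simp: card_eq_0_iff\<close>)
  show ?thesis unfolding local_empirical_def
    by (rule prob_space_distr) (simp add: uniform_count_measure_def)
qed

lemma sets_local_empirical [simp]: "sets (local_empirical k F K u m l t x) = sets borel"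
  by (simp add: local_empirical_def)

lemma integral_local_empirical:
  fixes h :: "'b::euclidean_space \<Rightarrow> real"
  assumes "h \<in> borel_measurable borel"
  shows "(LINT v|local_empirical k F K u m l t x. h v) =
    (\<Sum>j\<in>words k l. h (u (word_of k F K m x @ j) t)) / card (words k l)"
  unfolding local_empirical_def
  by (subst integral_distr) (use assms in \<open>auto simp: integral_uniform_count_measure measurable_def space_uniform_count_measure sets_uniform_count_measure\<close>)

context self_similar_cells
begin

text \<open>Weak convergence at almost every point has to be turned into convergence of an integral of suprema over
test functions. The partition of unity provides a majorant \<open>d\<close> built from finitely many integrals, to which
dominated convergence applies. The partition is chosen on a ball that carries most of the mass of
\<open>\<mu>0 x\<close> on average over \<open>x\<close>.\<close>
lemma initial_majorant:
  fixes u :: "nat list \<Rightarrow> real \<Rightarrow> 'b::euclidean_space" and \<mu>0 :: "'a \<Rightarrow> 'b measure"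
  assumes init: "AE x in \<nu>. weakly_converges (\<lambda>(m, l). local_empirical k F K u m l 0 x) (\<mu>0 x)
      (sequentially \<times>\<^sub>F sequentially)"
    and prob0: "\<And>x. x \<in> K \<Longrightarrow> prob_space (\<mu>0 x)" and sets0: "\<And>x. sets (\<mu>0 x) = sets borel"
    and meas0: "\<And>h :: 'b \<Rightarrow> real. continuous_on UNIV h \<Longrightarrow> (\<lambda>x. LINT v|\<mu>0 x. h v) \<in> borel_measurable \<nu>"
    and \<epsilon>: "0 < \<epsilon>"
  shows "\<exists>N. \<forall>m\<ge>N. \<forall>l\<ge>N. \<exists>d. d \<in> borel_measurable \<nu> \<and> (\<forall>x\<in>K. 0 \<le> d x \<and> d x \<le> 2) \<and> (LINT x|\<nu>. d x) \<le> \<epsilon> \<and>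
    (AE x in \<nu>. \<forall>h. (\<forall>z. \<bar>h z\<bar> \<le> 1) \<longrightarrow> (\<forall>v w. \<bar>h v - h w\<bar> \<le> norm (v - w)) \<longrightarrow>
      \<bar>(LINT v|local_empirical k F K u m l 0 x. h v) - (LINT v|\<mu>0 x. h v)\<bar> \<le> d x)"
proof -
  \<comment> \<open>The majorant is the sum of three terms, each with mean at most \<open>2 * \<eta>\<close>.\<close>
  define \<eta> where "\<eta> = \<epsilon> / 6"
  have \<eta>: "0 < \<eta>" using \<epsilon> by (simp add: \<eta>_def)
  have cut_cont: "continuous_on UNIV (cutoff r :: 'b \<Rightarrow> real)" for r
    by (rule lipschitz_real_measurable(1)[OF cutoff_lipschitz])
  have bounded0: "integrable (\<mu>0 x) h" if "x \<in> K" "continuous_on UNIV h" "\<And>v. \<bar>h v\<bar> \<le> B" for x and h :: "'b \<Rightarrow> real" and B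
  proof -
    interpret Q: prob_space "\<mu>0 x" using prob0 that by blast
    have "h \<in> borel_measurable (\<mu>0 x)"
      using borel_measurable_continuous_onI[OF that(2)] by (simp add: measurable_cong_sets[OF sets0 refl])
    then show ?thesis by (intro Q.integrable_const_bound[where B = B]) (use that in auto)
  qed
  have in01: "0 \<le> (LINT v|\<mu>0 x. h v) \<and> (LINT v|\<mu>0 x. h v) \<le> 1"
    if "x \<in> K" "continuous_on UNIV h" "\<And>v. 0 \<le> h v" "\<And>v. h v \<le> 1" for x and h :: "'b \<Rightarrow> real"
  proof -
    interpret Q: prob_space "\<mu>0 x" using prob0 that by blast
    have "integrable (\<mu>0 x) h" by (rule bounded0[OF that(1,2), of 1]) (use that in \<open>auto simp: abs_le_iff intro: order_trans[of _ 0]\<close>)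
    then have "(LINT v|\<mu>0 x. h v) \<le> (LINT v|\<mu>0 x. 1)" by (intro integral_mono) (use that in auto)
    then show ?thesis using that by (auto simp: Q.prob_space intro!: Bochner_Integration.integral_nonneg)
  qed
  have "(\<lambda>n. LINT x|\<nu>. LINT v|\<mu>0 x. cutoff (real n) v) \<longlonglongrightarrow> (LINT x|\<nu>. 1)"
  proof (rule integral_dominated_convergence[where w = "\<lambda>_. 1"])
    show "AE x in \<nu>. (\<lambda>n. LINT v|\<mu>0 x. cutoff (real n) v) \<longlonglongrightarrow> 1"
    proof (rule AE_I2)
      fix x assume "x \<in> space \<nu>"
      then have x: "x \<in> K" by (simp add: space_\<nu>)
      show "(\<lambda>n. LINT v|\<mu>0 x. cutoff (real n) v) \<longlonglongrightarrow> 1"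
        by (rule cutoff_integral_tendsto[OF prob0[OF x] sets0])
    qed
    show "AE x in \<nu>. norm (LINT v|\<mu>0 x. cutoff (real n) v) \<le> 1" for n
    proof (rule AE_I2)
      fix x assume "x \<in> space \<nu>"
      then have "0 \<le> (LINT v|\<mu>0 x. cutoff (real n) v) \<and> (LINT v|\<mu>0 x. cutoff (real n) v) \<le> 1"
        by (intro in01 cut_cont cutoff_bounds) (simp add: space_\<nu>)
      then show "norm (LINT v|\<mu>0 x. cutoff (real n) v) \<le> 1" by simp
    qed
  qed (use meas0[OF cut_cont] in auto)
  then have "\<forall>\<^sub>F n in sequentially. 1 - \<eta> < (LINT x|\<nu>. LINT v|\<mu>0 x. cutoff (real n) v)"
    by (rule order_tendstoD(1)) (use \<eta> in \<open>simp add: prob_space\<close>)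
  then obtain n where n: "1 - \<eta> < (LINT x|\<nu>. LINT v|\<mu>0 x. cutoff (real n) v)"
    by (auto simp: eventually_sequentially)
  obtain A and \<phi> :: "'b \<Rightarrow> 'b \<Rightarrow> real" where A: "finite A" and cont: "\<And>a. continuous_on UNIV (\<phi> a)"
    and nonneg: "\<And>a v. 0 \<le> \<phi> a v" and near: "\<And>a v. \<phi> a v \<noteq> 0 \<Longrightarrow> dist a v \<le> \<eta>"
    and le1: "\<And>v. (\<Sum>a\<in>A. \<phi> a v) \<le> 1" and eq1: "\<And>v. norm v \<le> real n + 1 \<Longrightarrow> (\<Sum>a\<in>A. \<phi> a v) = 1"
    using finite_partition_of_unity[OF \<eta>, of "real n + 1", where ?'b = 'b] by metis
  have \<phi>1: "\<phi> a v \<le> 1" if "a \<in> A" for a v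
    using member_le_sum[OF that, of "\<lambda>a. \<phi> a v"] nonneg A le1[of v] by force
  have cont\<Phi>: "continuous_on UNIV (\<lambda>v. \<Sum>a\<in>A. \<phi> a v)" by (intro continuous_intros cont)
  have [measurable]: "\<phi> a \<in> borel_measurable borel" for a by (rule borel_measurable_continuous_onI[OF cont])
  define emp where "emp a l w = (\<Sum>j\<in>words k l. \<phi> a (u (w @ j) 0)) / card (words k l)" for a l w
  have emp01: "0 \<le> emp a l w" "emp a l w \<le> 1" if "a \<in> A" for a l w
  proof -
    show "0 \<le> emp a l w" unfolding emp_def by (intro divide_nonneg_nonneg sum_nonneg nonneg) simp
    have "(\<Sum>j\<in>words k l. \<phi> a (u (w @ j) 0)) \<le> (\<Sum>j\<in>words k l. 1)" by (intro sum_mono \<phi>1 that)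
    then show "emp a l w \<le> 1" using k_pos by (simp add: emp_def divide_le_eq card_words)
  qed
  define q where "q m l x = (\<Sum>a\<in>A. \<bar>(\<Sum>w\<in>words k m. indicator (cell F K w) x * emp a l w) - (LINT v|\<mu>0 x. \<phi> a v)\<bar>)" for m l x
  have q_meas [measurable]: "q m l \<in> borel_measurable \<nu>" for m l
    unfolding q_def
    by (intro borel_measurable_sum borel_measurable_abs borel_measurable_diff borel_measurable_times
        borel_measurable_indicator borel_measurable_const meas0 cont cell_sets)
  have q_word: "AE x in \<nu>. \<forall>m l. q m l x = (\<Sum>a\<in>A. \<bar>(LINT v|local_empirical k F K u m l 0 x. \<phi> a v) - (LINT v|\<mu>0 x. \<phi> a v)\<bar>)"
    using AE_word_of AE_space
  proof eventually_elim
    case (elim x)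
    have "(\<Sum>w\<in>words k m. indicator (cell F K w) x * emp a l w) = emp a l (word_of k F K m x)" for a m l
      by (rule sum_cells_eq_word_of) (use elim space_\<nu> in auto)
    then show ?case unfolding q_def by (simp only: integral_local_empirical[OF borel_measurable_continuous_onI[OF cont]] emp_def) simp
  qed
  have q_bound: "AE x in \<nu>. \<forall>m l. 0 \<le> q m l x \<and> q m l x \<le> card A"
    using AE_word_of AE_space
  proof eventually_elim
    case (elim x)
    then have x: "x \<in> K" by (simp add: space_\<nu>)
    show ?case
    proof (intro allI conjI)
      fix m l
      show "0 \<le> q m l x" unfolding q_def by (intro sum_nonneg) auto
      have "q m l x \<le> (\<Sum>a\<in>A. 1)" unfolding q_def
      proof (rule sum_mono)
        fix a assume a: "a \<in> A"
        have "(\<Sum>w\<in>words k m. indicator (cell F K w) x * emp a l w) = emp a l (word_of k F K m x)"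
          by (rule sum_cells_eq_word_of) (use elim x in auto)
        then show "\<bar>(\<Sum>w\<in>words k m. indicator (cell F K w) x * emp a l w) - (LINT v|\<mu>0 x. \<phi> a v)\<bar> \<le> 1"
          using emp01[OF a, of l "word_of k F K m x"] in01[OF x cont nonneg \<phi>1[OF a]] by auto
      qed
      then show "q m l x \<le> card A" by simp
    qed
  qed
  have q_int: "integrable \<nu> (q m l)" for m l
    by (rule integrable_const_bound[where B = "card A"]) (use q_bound in \<open>auto elim: eventually_mono\<close>)
  have "\<exists>N. \<forall>m\<ge>N. \<forall>l\<ge>N. (LINT x|\<nu>. q m l x) \<le> \<eta>"
  proof (rule ccontr)
    assume "\<not> ?thesis"
    then have "\<forall>N. \<exists>m l. N \<le> m \<and> N \<le> l \<and> \<eta> < (LINT x|\<nu>. q m l x)" by (auto simp: not_le)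
    then obtain fm fl where f: "\<And>N. N \<le> fm N" "\<And>N. N \<le> fl N" "\<And>N. \<eta> < (LINT x|\<nu>. q (fm N) (fl N) x)" by metis
    have lim: "filterlim (\<lambda>i. (fm i, fl i)) (sequentially \<times>\<^sub>F sequentially) sequentially"
      by (intro filterlim_Pair filterlim_at_top_mono[OF filterlim_ident]) (use f in auto)
    have "(\<lambda>i. LINT x|\<nu>. q (fm i) (fl i) x) \<longlonglongrightarrow> (LINT x|\<nu>. 0)"
    proof (rule integral_dominated_convergence[where w = "\<lambda>_. card A"])
      show "AE x in \<nu>. (\<lambda>i. q (fm i) (fl i) x) \<longlonglongrightarrow> 0"
        using init q_word AE_space
      proof eventually_elim
        case (elim x)
        have "(\<lambda>i. \<Sum>a\<in>A. \<bar>(LINT v|local_empirical k F K u (fm i) (fl i) 0 x. \<phi> a v) - (LINT v|\<mu>0 x. \<phi> a v)\<bar>)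
            \<longlonglongrightarrow> (\<Sum>a\<in>A. 0)"
        proof (rule tendsto_sum)
          fix a assume a: "a \<in> A"
          have "bounded (range (\<phi> a))"
            unfolding bounded_iff using nonneg \<phi>1[OF a] by (auto intro!: exI[of _ 1])
          then have "((\<lambda>i. LINT v|(case i of (m, l) \<Rightarrow> local_empirical k F K u m l 0 x). \<phi> a v) \<longlongrightarrow> (LINT v|\<mu>0 x. \<phi> a v))
              (sequentially \<times>\<^sub>F sequentially)"
            using elim(1) cont by (auto simp: weakly_converges_def)
          from filterlim_compose[OF this lim]
          show "(\<lambda>i. \<bar>(LINT v|local_empirical k F K u (fm i) (fl i) 0 x. \<phi> a v) - (LINT v|\<mu>0 x. \<phi> a v)\<bar>) \<longlonglongrightarrow> 0"
            by (intro tendsto_rabs_zero LIM_zero) simp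
        qed
        then show ?case using elim(2) by simp
      qed
      show "AE x in \<nu>. norm (q (fm i) (fl i) x) \<le> card A" for i
        using q_bound by eventually_elim auto
    qed auto
    then have "\<forall>\<^sub>F i in sequentially. (LINT x|\<nu>. q (fm i) (fl i) x) < \<eta>" by (intro order_tendstoD) (use \<eta> in auto)
    then show False using f(3) by (auto simp: eventually_sequentially intro: less_asym)
  qed
  then obtain N where N: "\<And>m l. N \<le> m \<Longrightarrow> N \<le> l \<Longrightarrow> (LINT x|\<nu>. q m l x) \<le> \<eta>" by blast
  define \<tau> where "\<tau> x = 1 - (LINT v|\<mu>0 x. (\<Sum>a\<in>A. \<phi> a v))" for x
  have \<tau>01: "0 \<le> \<tau> x" "\<tau> x \<le> 1" if "x \<in> K" for x
    using in01[OF that cont\<Phi> sum_nonneg le1] nonneg by (auto simp: \<tau>_def)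
  have [measurable]: "\<tau> \<in> borel_measurable \<nu>" unfolding \<tau>_def by (intro borel_measurable_diff meas0 cont\<Phi>) auto
  have \<tau>_int: "integrable \<nu> \<tau>"
    by (rule integrable_const_bound[where B = 1]) (use \<tau>01 in \<open>auto simp: space_\<nu> abs_le_iff intro!: AE_I2 intro: order_trans[of _ 0]\<close>)
  have "(LINT x|\<nu>. \<tau> x) \<le> (LINT x|\<nu>. 1 - (LINT v|\<mu>0 x. cutoff (real n) v))"
  proof (rule integral_mono[OF \<tau>_int])
    show "integrable \<nu> (\<lambda>x. 1 - (LINT v|\<mu>0 x. cutoff (real n) v))"
      by (rule integrable_const_bound[where B = 1])
        (use in01[OF _ cut_cont cutoff_bounds] meas0[OF cut_cont] in \<open>auto simp: space_\<nu> intro!: AE_I2\<close>)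
    fix x assume "x \<in> space \<nu>"
    then have x: "x \<in> K" by (simp add: space_\<nu>)
    have "(LINT v|\<mu>0 x. cutoff (real n) v) \<le> (LINT v|\<mu>0 x. (\<Sum>a\<in>A. \<phi> a v))"
    proof (rule integral_mono)
      show "integrable (\<mu>0 x) (cutoff (real n))"
        by (rule bounded0[OF x cut_cont abs_cutoff_le])
      show "integrable (\<mu>0 x) (\<lambda>v. \<Sum>a\<in>A. \<phi> a v)"
        by (rule bounded0[OF x cont\<Phi>, of 1]) (use le1 in \<open>simp add: abs_of_nonneg sum_nonneg nonneg\<close>)
      show "cutoff (real n) v \<le> (\<Sum>a\<in>A. \<phi> a v)" for v
        using eq1[of v] cutoff_bounds[of "real n" v] cutoff_support[of "real n" v] sum_nonneg[of A "\<lambda>a. \<phi> a v"] nonneg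
        by (cases "norm v \<le> real n + 1") auto
    qed
    then show "\<tau> x \<le> 1 - (LINT v|\<mu>0 x. cutoff (real n) v)" by (simp add: \<tau>_def)
  qed
  also have "\<dots> = 1 - (LINT x|\<nu>. LINT v|\<mu>0 x. cutoff (real n) v)"
  proof -
    have "integrable \<nu> (\<lambda>x. LINT v|\<mu>0 x. cutoff (real n) v)"
      by (rule integrable_const_bound[where B = 1])
        (use in01[OF _ cut_cont cutoff_bounds] meas0[OF cut_cont] in \<open>auto simp: space_\<nu> intro!: AE_I2\<close>)
    then show ?thesis by (simp add: prob_space)
  qed
  also have "\<dots> \<le> \<eta>" using n by simp
  finally have \<tau>_small: "(LINT x|\<nu>. \<tau> x) \<le> \<eta>" .
  show ?thesis
  proof (intro exI[of _ N] allI impI)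
    fix m l assume ml: "N \<le> m" "N \<le> l"
    define d' where "d' x = 2 * q m l x + 2 * \<eta> + 2 * \<tau> x" for x
    define d where "d x = min 2 (d' x)" for x
    have d'_int: "integrable \<nu> d'" unfolding d'_def using q_int \<tau>_int by auto
    have d'0: "0 \<le> d' x" if "x \<in> K" for x
    proof -
      have "0 \<le> q m l x" unfolding q_def by (intro sum_nonneg) auto
      then show ?thesis using \<tau>01[OF that] \<eta> by (simp add: d'_def)
    qed
    have d_meas: "d \<in> borel_measurable \<nu>" unfolding d_def using d'_int by measurable
    show "\<exists>d. d \<in> borel_measurable \<nu> \<and> (\<forall>x\<in>K. 0 \<le> d x \<and> d x \<le> 2) \<and> (LINT x|\<nu>. d x) \<le> \<epsilon> \<and>
      (AE x in \<nu>. \<forall>h. (\<forall>z. \<bar>h z\<bar> \<le> 1) \<longrightarrow> (\<forall>v w. \<bar>h v - h w\<bar> \<le> norm (v - w)) \<longrightarrow>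
      \<bar>(LINT v|local_empirical k F K u m l 0 x. h v) - (LINT v|\<mu>0 x. h v)\<bar> \<le> d x)"
    proof (intro exI[of _ d] conjI ballI)
      show "d \<in> borel_measurable \<nu>" by (rule d_meas)
      show "0 \<le> d x" "d x \<le> 2" if "x \<in> K" for x using d'0[OF that] by (auto simp: d_def)
      have "integrable \<nu> d"
        by (rule integrable_const_bound[where B = 2])
          (use d_meas d'0 in \<open>auto simp: d_def space_\<nu> intro!: AE_I2\<close>)
      then have "(LINT x|\<nu>. d x) \<le> (LINT x|\<nu>. d' x)"
        by (rule integral_mono[OF _ d'_int]) (auto simp: d_def)
      also have "\<dots> = 2 * (LINT x|\<nu>. q m l x) + 2 * \<eta> + 2 * (LINT x|\<nu>. \<tau> x)"
        unfolding d'_def using q_int \<tau>_int by (simp add: prob_space)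
      also have "\<dots> \<le> \<epsilon>" using N[OF ml] \<tau>_small by (simp add: \<eta>_def)
      finally show "(LINT x|\<nu>. d x) \<le> \<epsilon>" .
      show "AE x in \<nu>. \<forall>h. (\<forall>z. \<bar>h z\<bar> \<le> 1) \<longrightarrow> (\<forall>v w. \<bar>h v - h w\<bar> \<le> norm (v - w)) \<longrightarrow>
        \<bar>(LINT v|local_empirical k F K u m l 0 x. h v) - (LINT v|\<mu>0 x. h v)\<bar> \<le> d x"
        using q_word AE_space
      proof eventually_elim
        case (elim x)
        then have x: "x \<in> K" by (simp add: space_\<nu>)
        show ?case
        proof (intro allI impI)
          fix h :: "'b \<Rightarrow> real"
          assume h: "\<forall>z. \<bar>h z\<bar> \<le> 1" "\<forall>v w. \<bar>h v - h w\<bar> \<le> norm (v - w)"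
          have crude: "\<bar>(LINT v|local_empirical k F K u m l 0 x. h v) - (LINT v|\<mu>0 x. h v)\<bar> \<le> 2"
          proof -
            have "\<bar>LINT v|P. h v\<bar> \<le> 1" if "prob_space P" "sets P = sets borel" for P
            proof -
              interpret P: prob_space P by fact
              have "h \<in> borel_measurable P" using lipschitz_real_measurable(2)[of h 1] h(2)
                by (simp add: measurable_cong_sets[OF that(2) refl])
              then have "integrable P h" by (rule P.integrable_const_bound[rotated]) (use h in auto)
              then have "(LINT v|P. \<bar>h v\<bar>) \<le> (LINT v|P. 1)" by (intro integral_mono) (use h in auto)
              then show ?thesis by (intro order_trans[OF integral_abs_bound]) (simp add: P.prob_space)
            qed
            from this[OF prob_space_local_empirical[OF k_pos] sets_local_empirical, of F K u m l 0 x]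
              this[OF prob0[OF x] sets0]
            show ?thesis by linarith
          qed
          have "\<bar>(LINT v|local_empirical k F K u m l 0 x. h v) - (LINT v|\<mu>0 x. h v)\<bar> \<le>
            2 * (\<Sum>a\<in>A. \<bar>(LINT v|local_empirical k F K u m l 0 x. \<phi> a v) - (LINT v|\<mu>0 x. \<phi> a v)\<bar>) + 2 * \<eta>
            + 2 * (1 - (LINT v|\<mu>0 x. (\<Sum>a\<in>A. \<phi> a v)))"
            by (rule lipschitz_functional_by_partition[OF prob_space_local_empirical[OF k_pos] prob0[OF x]
                  sets_local_empirical sets0 A cont nonneg near le1]) (use h \<eta> in auto)
          then show "\<bar>(LINT v|local_empirical k F K u m l 0 x. h v) - (LINT v|\<mu>0 x. h v)\<bar> \<le> d x"
            using elim(1) crude by (simp add: d_def d'_def \<tau>_def)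
        qed
      qed
    qed
  qed
qed

end

section \<open>The mean-field interaction\<close>

text \<open>A test function vanishes on an open set outside a ball, hence so does its gradient.\<close>
lemma test_gradient_bounded_support:
  fixes \<phi> :: "'b::euclidean_space \<Rightarrow> real"
  assumes "test_function \<phi> g"
  obtains B R where "0 \<le> B" "0 \<le> R" "\<And>u. norm (g u) \<le> B" "\<And>u. R < norm u \<Longrightarrow> g u = 0"
proof -
  have grad: "\<And>u. GDERIV \<phi> u :> g u" and cont: "continuous_on UNIV g" and "bounded {u. \<phi> u \<noteq> 0}"
    using assms by (auto simp: test_function_def)
  then obtain R0 where R0: "\<And>u. \<phi> u \<noteq> 0 \<Longrightarrow> norm u \<le> R0" by (auto simp: bounded_iff)
  define R where "R = max 0 R0"
  have zero: "g u = 0" if "R < norm u" for u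
  proof -
    have "open {v::'b. R < norm v}" by (intro open_Collect_less continuous_intros)
    then have "\<forall>\<^sub>F v in nhds u. R < norm v" using that eventually_nhds by blast
    then have "\<forall>\<^sub>F v in nhds u. \<phi> v = 0" by eventually_elim (use R0 in \<open>force simp: R_def\<close>)
    then have ev: "\<forall>\<^sub>F v in at u. (0::real) = \<phi> v" by (auto simp: eventually_at_filter elim: eventually_mono)
    have "\<phi> u = 0" using R0[of u] that by (force simp: R_def)
    have "((\<lambda>_. 0) has_derivative (\<lambda>h. 0)) (at u)" by simp
    from has_derivative_transform_eventually[OF this ev] have "(\<phi> has_derivative (\<lambda>h. 0)) (at u)"
      using \<open>\<phi> u = 0\<close> by simp
    from has_derivative_unique[OF this grad[of u, unfolded gderiv_def]] have "g u \<bullet> g u = 0"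
      by (metis (no_types))
    then show ?thesis by simp
  qed
  have "compact (g ` cball 0 R)" by (rule compact_continuous_image[OF continuous_on_subset[OF cont]]) auto
  then obtain B where "\<forall>x\<in>cball 0 R. norm (g x) \<le> B"
    by (auto dest!: compact_imp_bounded simp: bounded_iff)
  then have B: "\<And>u. norm u \<le> R \<Longrightarrow> norm (g u) \<le> B" by simp
  have B0: "0 \<le> B" using order_trans[OF norm_ge_zero B[of 0]] by (simp add: R_def)
  show ?thesis
  proof (rule that[of B R])
    show "norm (g u) \<le> B" for u using B[of u] zero[of u] B0 by (cases "norm u \<le> R") auto
  qed (use B0 zero in \<open>auto simp: R_def\<close>)
qed

lemma integrable_by_nn_bound:
  fixes h :: "'z \<Rightarrow> real"
  assumes meas: "h \<in> borel_measurable M" and le: "(\<integral>\<^sup>+y. ennreal \<bar>h y\<bar> \<partial>M) \<le> ennreal C" and "0 \<le> C"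
  shows "integrable M h" "(LINT y|M. \<bar>h y\<bar>) \<le> C"
proof -
  show int: "integrable M h" using meas le by (intro integrableI_bounded) (auto intro: le_less_trans)
  have "ennreal (LINT y|M. \<bar>h y\<bar>) = (\<integral>\<^sup>+y. ennreal \<bar>h y\<bar> \<partial>M)"
    by (rule nn_integral_eq_integral[symmetric]) (use int in auto)
  then have "ennreal (LINT y|M. \<bar>h y\<bar>) \<le> ennreal C" by (rule ord_eq_le_trans[OF _ le])
  then show "(LINT y|M. \<bar>h y\<bar>) \<le> C" by (simp only: ennreal_le_iff[OF \<open>0 \<le> C\<close>])
qed

locale mean_field = self_similar_cells k F K \<nu>
  for k and F :: "nat \<Rightarrow> 'a::euclidean_space \<Rightarrow> 'a" and K and \<nu> :: "'a measure" +
  fixes W :: "'a \<times> 'a \<Rightarrow> real" and f :: "real \<Rightarrow> 'b::euclidean_space \<Rightarrow> 'b" and D :: "'b \<Rightarrow> 'b \<Rightarrow> 'b"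
    and L\<^sub>f L\<^sub>D :: real and u :: "nat list \<Rightarrow> real \<Rightarrow> 'b" and \<rho> :: "real \<Rightarrow> 'b \<Rightarrow> 'a \<Rightarrow> real"
  assumes W_meas: "W \<in> borel_measurable (\<nu> \<Otimes>\<^sub>M \<nu>)"
    and W_L2: "integrable (\<nu> \<Otimes>\<^sub>M \<nu>) (\<lambda>p. (W p)\<^sup>2)"
    and W_bound: "max (esssup \<nu> (\<lambda>x. \<integral>\<^sup>+y. ennreal \<bar>W (x, y)\<bar> \<partial>\<nu>))
                      (esssup \<nu> (\<lambda>y. \<integral>\<^sup>+x. ennreal \<bar>W (x, y)\<bar> \<partial>\<nu>)) < \<infinity>"
    and f_cont: "continuous_on UNIV (\<lambda>(t, u). f t u)"
    and f_lip: "\<And>t u u'. norm (f t u - f t u') \<le> L\<^sub>f * norm (u - u')"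
    and D_cont: "continuous_on UNIV (\<lambda>(u, v). D u v)"
    and D_lip: "\<And>u v u' v'. norm (D u v - D u' v') \<le> L\<^sub>D * (norm (u - u') + norm (v - v'))"
    and D_bound: "\<And>u v. norm (D u v) \<le> 1"
    and u_sol: "\<And>n. n \<ge> 1 \<Longrightarrow> particle_solution k F K \<nu> W f D n u"
    and \<rho>_sol: "vlasov_solution K \<nu> W f D \<rho>"
begin

lemma lipschitz_constants_nonneg: "0 \<le> L\<^sub>f" "0 \<le> L\<^sub>D"
proof -
  obtain b :: 'b where b: "norm b = 1" using vector_choose_size[of 1] by auto
  show "0 \<le> L\<^sub>f" using order_trans[OF norm_ge_zero f_lip[of 0 b 0]] b by simp
  show "0 \<le> L\<^sub>D" using order_trans[OF norm_ge_zero D_lip[of b 0 0 0]] b by simp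
qed

definition C\<^sub>W :: real where
  "C\<^sub>W = enn2real (max (esssup \<nu> (\<lambda>x. \<integral>\<^sup>+y. ennreal \<bar>W (x, y)\<bar> \<partial>\<nu>))
                      (esssup \<nu> (\<lambda>y. \<integral>\<^sup>+x. ennreal \<bar>W (x, y)\<bar> \<partial>\<nu>)))"

lemma C\<^sub>W_nonneg: "0 \<le> C\<^sub>W" by (simp add: C\<^sub>W_def)

lemma kernel_row_bound: "AE x in \<nu>. (\<integral>\<^sup>+y. ennreal \<bar>W (x, y)\<bar> \<partial>\<nu>) \<le> ennreal C\<^sub>W"
  and kernel_column_bound: "AE y in \<nu>. (\<integral>\<^sup>+x. ennreal \<bar>W (x, y)\<bar> \<partial>\<nu>) \<le> ennreal C\<^sub>W"
proof -
  let ?r = "esssup \<nu> (\<lambda>x. \<integral>\<^sup>+y. ennreal \<bar>W (x, y)\<bar> \<partial>\<nu>)"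
  let ?c = "esssup \<nu> (\<lambda>y. \<integral>\<^sup>+x. ennreal \<bar>W (x, y)\<bar> \<partial>\<nu>)"
  have "ennreal C\<^sub>W = max ?r ?c" unfolding C\<^sub>W_def using W_bound by (intro ennreal_enn2real) simp
  then have le: "?r \<le> ennreal C\<^sub>W" "?c \<le> ennreal C\<^sub>W" by auto
  show "AE x in \<nu>. (\<integral>\<^sup>+y. ennreal \<bar>W (x, y)\<bar> \<partial>\<nu>) \<le> ennreal C\<^sub>W"
    using esssup_AE[of "\<lambda>x. \<integral>\<^sup>+y. ennreal \<bar>W (x, y)\<bar> \<partial>\<nu>" \<nu>] by eventually_elim (use le in \<open>auto intro: order_trans\<close>)
  show "AE y in \<nu>. (\<integral>\<^sup>+x. ennreal \<bar>W (x, y)\<bar> \<partial>\<nu>) \<le> ennreal C\<^sub>W"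
    using esssup_AE[of "\<lambda>y. \<integral>\<^sup>+x. ennreal \<bar>W (x, y)\<bar> \<partial>\<nu>" \<nu>] by eventually_elim (use le in \<open>auto intro: order_trans\<close>)
qed

lemma W_measurable [measurable (raw)]:
  "a \<in> measurable N \<nu> \<Longrightarrow> b \<in> measurable N \<nu> \<Longrightarrow> (\<lambda>z. W (a z, b z)) \<in> borel_measurable N"
  by (rule measurable_compose[OF measurable_Pair W_meas])

lemma f_measurable [measurable (raw)]:
  "a \<in> borel_measurable N \<Longrightarrow> b \<in> borel_measurable N \<Longrightarrow> (\<lambda>z. f (a z) (b z)) \<in> borel_measurable N"
  using borel_measurable_continuous_Pair[of a N b "\<lambda>t u. f t u"] f_cont by (simp add: split_beta)

lemma D_measurable [measurable (raw)]:
  "a \<in> borel_measurable N \<Longrightarrow> b \<in> borel_measurable N \<Longrightarrow> (\<lambda>z. D (a z) (b z)) \<in> borel_measurable N"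
  using borel_measurable_continuous_Pair[of a N b "\<lambda>t u. D t u"] D_cont by (simp add: split_beta)

text \<open>Freezing the density at negative times makes it jointly measurable on the whole time axis.\<close>
definition dens :: "real \<Rightarrow> 'b \<Rightarrow> 'a \<Rightarrow> real" where
  "dens s v y = \<rho> (max 0 s) v y"

lemma dens_measurable [measurable (raw)]:
  assumes "a \<in> borel_measurable N" "b \<in> borel_measurable N" "c \<in> measurable N \<nu>"
  shows "(\<lambda>z. dens (a z) (b z) (c z)) \<in> borel_measurable N"
proof -
  have \<rho>: "(\<lambda>(t, u, x). \<rho> t u x) \<in> borel_measurable (restrict_space borel {0..} \<Otimes>\<^sub>M borel \<Otimes>\<^sub>M \<nu>)"
    using \<rho>_sol by (simp add: vlasov_solution_def)
  have "(\<lambda>z. max 0 (a z)) \<in> measurable N (restrict_space borel {0..})"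
    by (rule measurable_restrict_space2) (use assms in auto)
  then have "(\<lambda>z. (max 0 (a z), b z, c z)) \<in> measurable N (restrict_space borel {0..} \<Otimes>\<^sub>M borel \<Otimes>\<^sub>M \<nu>)"
    using assms by (intro measurable_Pair)
  from measurable_compose[OF this \<rho>] show ?thesis by (simp add: dens_def)
qed

lemma dens_nonneg: "y \<in> K \<Longrightarrow> 0 \<le> dens s v y"
  and dens_mass: "y \<in> K \<Longrightarrow> (\<integral>\<^sup>+v. ennreal (dens s v y) \<partial>lborel) = 1"
proof -
  have *: "\<forall>t\<ge>0. \<forall>x\<in>K. (\<forall>u. 0 \<le> \<rho> t u x) \<and> (\<integral>\<^sup>+u. ennreal (\<rho> t u x) \<partial>lborel) = 1"
    using \<rho>_sol unfolding vlasov_solution_def by (elim conjE)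
  show "y \<in> K \<Longrightarrow> 0 \<le> dens s v y" "y \<in> K \<Longrightarrow> (\<integral>\<^sup>+v. ennreal (dens s v y) \<partial>lborel) = 1"
    using *[rule_format, of "max 0 s" y] by (auto simp: dens_def)
qed

lemma dens_section [measurable]: "y \<in> K \<Longrightarrow> (\<lambda>v. dens s v y) \<in> borel_measurable borel"
  by (rule dens_measurable[OF borel_measurable_const measurable_ident_sets[OF refl] measurable_const])
    (simp add: space_\<nu>)

lemma prob_vlasov: "y \<in> K \<Longrightarrow> 0 \<le> s \<Longrightarrow> prob_space (vlasov_measure \<rho> s y)"
  using dens_mass[of y s] dens_section[of y s]
  by (intro prob_spaceI) (simp add: vlasov_measure_def dens_def emeasure_density max_absorb2)

lemma sets_vlasov [simp]: "sets (vlasov_measure \<rho> s y) = sets borel" by (simp add: vlasov_measure_def)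

lemma integral_vlasov:
  fixes h :: "'b \<Rightarrow> 'c::{banach, second_countable_topology}"
  assumes "y \<in> K" "0 \<le> s" "h \<in> borel_measurable borel"
  shows "(LINT v|vlasov_measure \<rho> s y. h v) = (LINT v|lborel. dens s v y *\<^sub>R h v)"
  unfolding vlasov_measure_def
  by (subst integral_density) (use assms dens_section[of y s] dens_nonneg[of y s] in \<open>auto simp: dens_def max_absorb2\<close>)

definition drift :: "real \<Rightarrow> 'b \<Rightarrow> 'a \<Rightarrow> 'b" where
  "drift s p y = (LINT v|lborel. dens s v y *\<^sub>R D p v)"

lemma drift_measurable [measurable (raw)]:
  assumes [measurable]: "a \<in> borel_measurable N" "b \<in> borel_measurable N" "c \<in> measurable N \<nu>"
  shows "(\<lambda>z. drift (a z) (b z) (c z)) \<in> borel_measurable N"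
proof -
  have "(\<lambda>(z, v). dens (a z) v (c z) *\<^sub>R D (b z) v) \<in> borel_measurable (N \<Otimes>\<^sub>M lborel)"
    unfolding split_beta
    by (rule borel_measurable_scaleR[OF
          dens_measurable[OF measurable_compose[OF measurable_fst assms(1)] _
            measurable_compose[OF measurable_fst assms(3)]]
          D_measurable[OF measurable_compose[OF measurable_fst assms(2)]]]) auto
  then show ?thesis unfolding drift_def by (rule lborel.borel_measurable_lebesgue_integral)
qed

lemma dens_integrable:
  fixes h :: "'b \<Rightarrow> 'c::{banach, second_countable_topology}"
  assumes y: "y \<in> K" and [measurable]: "h \<in> borel_measurable borel" and b: "\<And>v. norm (h v) \<le> B"
  shows "integrable lborel (\<lambda>v. dens s v y *\<^sub>R h v)"
proof -
  note [measurable] = dens_section[OF y]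
  have "integrable lborel (\<lambda>v. dens s v y)"
    using dens_nonneg[OF y] dens_mass[OF y] by (intro integrableI_nonneg) auto
  then have "integrable lborel (\<lambda>v. B * dens s v y)" by simp
  then show ?thesis
  proof (rule Bochner_Integration.integrable_bound)
    show "AE v in lborel. norm (dens s v y *\<^sub>R h v) \<le> norm (B * dens s v y)"
    proof (rule AE_I2)
      fix v show "norm (dens s v y *\<^sub>R h v) \<le> norm (B * dens s v y)"
        using mult_left_mono[OF order_trans[OF b[of v] abs_ge_self], of "dens s v y"] dens_nonneg[OF y, of s v]
        by (simp add: abs_mult mult.commute)
    qed
  qed simp
qed

lemma drift_le:
  fixes h :: "'b \<Rightarrow> 'c::{banach, second_countable_topology}"
  assumes y: "y \<in> K" and b: "\<And>v. norm (h v) \<le> B" and [measurable]: "h \<in> borel_measurable borel"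
  shows "norm (LINT v|lborel. dens s v y *\<^sub>R h v) \<le> B"
proof -
  note [measurable] = dens_section[OF y]
  have int: "integrable lborel (\<lambda>v. dens s v y)"
    using dens_nonneg[OF y] dens_mass[OF y] by (intro integrableI_nonneg) auto
  have mass: "(LINT v|lborel. dens s v y) = 1"
    using nn_integral_eq_integral[OF int] dens_nonneg[OF y] dens_mass[OF y] by simp
  have "norm (LINT v|lborel. dens s v y *\<^sub>R h v) \<le> (LINT v|lborel. norm (dens s v y *\<^sub>R h v))"
    by (rule integral_norm_bound)
  also have "\<dots> \<le> (LINT v|lborel. B * dens s v y)"
  proof (rule integral_mono)
    show "integrable lborel (\<lambda>v. norm (dens s v y *\<^sub>R h v))"
      by (intro integrable_norm dens_integrable[OF y _ b]) simp
    show "norm (dens s v y *\<^sub>R h v) \<le> B * dens s v y" for v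
      using mult_left_mono[OF b[of v], of "dens s v y"] dens_nonneg[OF y, of s v] by (simp add: mult.commute)
  qed (use int in simp)
  finally show ?thesis using mass by simp
qed

lemma D_section [measurable]: "D p \<in> borel_measurable borel"
  by (rule D_measurable[OF borel_measurable_const measurable_ident_sets[OF refl]])

lemma drift_bound: "y \<in> K \<Longrightarrow> norm (drift s p y) \<le> 1"
  unfolding drift_def by (rule drift_le[where h = "D p"]) (auto intro: D_bound D_section)

lemma drift_lipschitz:
  assumes "y \<in> K" shows "norm (drift s p y - drift s q y) \<le> L\<^sub>D * norm (p - q)"
proof -
  have "drift s p y - drift s q y = (LINT v|lborel. dens s v y *\<^sub>R (D p v - D q v))"
    unfolding drift_def scaleR_diff_right
    by (rule Bochner_Integration.integral_diff[symmetric]) (rule dens_integrable[OF assms D_section, of _ 1], rule D_bound)+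
  also have "norm \<dots> \<le> L\<^sub>D * norm (p - q)"
  proof (rule drift_le[OF assms])
    show "norm (D p v - D q v) \<le> L\<^sub>D * norm (p - q)" for v using D_lip[of p v q v] by simp
    show "(\<lambda>v. D p v - D q v) \<in> borel_measurable borel" by (intro borel_measurable_diff D_section)
  qed
  finally show ?thesis .
qed

definition interaction :: "'a \<Rightarrow> real \<Rightarrow> 'b \<Rightarrow> 'b" where
  "interaction x s p = (LINT y|\<nu>. W (x, y) *\<^sub>R drift s p y)"

lemma interaction_measurable [measurable (raw)]:
  assumes [measurable]: "a \<in> borel_measurable N" "b \<in> borel_measurable N" "c \<in> measurable N \<nu>"
  shows "(\<lambda>z. interaction (c z) (a z) (b z)) \<in> borel_measurable N"
proof -
  have "(\<lambda>(z, y). W (c z, y) *\<^sub>R drift (a z) (b z) y) \<in> borel_measurable (N \<Otimes>\<^sub>M \<nu>)"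
    unfolding split_beta
    by (rule borel_measurable_scaleR[OF
          W_measurable[OF measurable_compose[OF measurable_fst assms(3)] measurable_snd]
          drift_measurable[OF measurable_compose[OF measurable_fst assms(1)]
            measurable_compose[OF measurable_fst assms(2)] measurable_snd]])
  then show ?thesis unfolding interaction_def by (rule borel_measurable_lebesgue_integral)
qed

definition field :: "'a \<Rightarrow> real \<Rightarrow> 'b \<Rightarrow> 'b" where
  "field x s p = f s p + interaction x s p"

lemma vlasov_field_eq: "0 \<le> s \<Longrightarrow> vlasov_field \<nu> W f D \<rho> s p x = field x s p"
proof -
  assume s: "0 \<le> s"
  have "(LINT v|lborel. (W (x, y) * \<rho> s v y) *\<^sub>R D p v) = W (x, y) *\<^sub>R drift s p y" for y
    by (simp only: drift_def dens_def max_absorb2[OF s] scaleR_scaleR[symmetric] integral_scaleR_right)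
  then show ?thesis by (simp add: vlasov_field_def field_def interaction_def)
qed

lemma row_integrable:
  assumes x: "x \<in> K" and "(\<integral>\<^sup>+y. ennreal \<bar>W (x, y)\<bar> \<partial>\<nu>) \<le> ennreal C\<^sub>W"
  shows "integrable \<nu> (\<lambda>y. W (x, y))" "(LINT y|\<nu>. \<bar>W (x, y)\<bar>) \<le> C\<^sub>W"
  by (rule integrable_by_nn_bound[OF W_measurable assms(2) C\<^sub>W_nonneg]; use x in \<open>simp add: space_\<nu>\<close>)+

lemma column_le:
  assumes y: "y \<in> K" and "(\<integral>\<^sup>+x. ennreal \<bar>W (x, y)\<bar> \<partial>\<nu>) \<le> ennreal C\<^sub>W"
  shows "(LINT x|\<nu>. \<bar>W (x, y)\<bar>) \<le> C\<^sub>W"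
  by (rule integrable_by_nn_bound(2)[OF W_measurable assms(2) C\<^sub>W_nonneg]; use y in \<open>simp add: space_\<nu>\<close>)

lemma row_weighted:
  fixes h :: "'a \<Rightarrow> 'c::{banach, second_countable_topology}"
  assumes x: "x \<in> K" "(\<integral>\<^sup>+y. ennreal \<bar>W (x, y)\<bar> \<partial>\<nu>) \<le> ennreal C\<^sub>W"
    and [measurable]: "h \<in> borel_measurable \<nu>" and b: "\<And>y. y \<in> K \<Longrightarrow> norm (h y) \<le> B"
  shows "integrable \<nu> (\<lambda>y. W (x, y) *\<^sub>R h y)" "norm (LINT y|\<nu>. W (x, y) *\<^sub>R h y) \<le> C\<^sub>W * B"
proof -
  note row = row_integrable[OF x]
  have B: "0 \<le> B" using K_ne order_trans[OF norm_ge_zero b] by auto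
  have le: "norm (W (x, y) *\<^sub>R h y) \<le> \<bar>W (x, y)\<bar> * B" if "y \<in> K" for y
    using mult_left_mono[OF b[OF that], of "\<bar>W (x, y)\<bar>"] by simp
  show int: "integrable \<nu> (\<lambda>y. W (x, y) *\<^sub>R h y)"
  proof (rule Bochner_Integration.integrable_bound)
    show "integrable \<nu> (\<lambda>y. \<bar>W (x, y)\<bar> * B)" using row(1) by simp
    show "(\<lambda>y. W (x, y) *\<^sub>R h y) \<in> borel_measurable \<nu>" using row(1) by measurable
    show "AE y in \<nu>. norm (W (x, y) *\<^sub>R h y) \<le> norm (\<bar>W (x, y)\<bar> * B)"
      using le B by (intro AE_I2) (simp add: space_\<nu> abs_mult)
  qed
  have "norm (LINT y|\<nu>. W (x, y) *\<^sub>R h y) \<le> (LINT y|\<nu>. norm (W (x, y) *\<^sub>R h y))" by (rule integral_norm_bound)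
  also have "\<dots> \<le> (LINT y|\<nu>. \<bar>W (x, y)\<bar> * B)"
  proof (rule integral_mono)
    show "integrable \<nu> (\<lambda>y. norm (W (x, y) *\<^sub>R h y))" by (rule integrable_norm[OF int])
    show "integrable \<nu> (\<lambda>y. \<bar>W (x, y)\<bar> * B)" using row(1) by simp
  qed (use le in \<open>simp add: space_\<nu>\<close>)
  also have "\<dots> = (LINT y|\<nu>. \<bar>W (x, y)\<bar>) * B" by simp
  also have "\<dots> \<le> C\<^sub>W * B" by (rule mult_right_mono[OF row(2) B])
  finally show "norm (LINT y|\<nu>. W (x, y) *\<^sub>R h y) \<le> C\<^sub>W * B" .
qed

lemma drift_section [measurable]: "(\<lambda>y. drift s p y) \<in> borel_measurable \<nu>" by measurable

lemma interaction_bounds: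
  assumes x: "x \<in> K" "(\<integral>\<^sup>+y. ennreal \<bar>W (x, y)\<bar> \<partial>\<nu>) \<le> ennreal C\<^sub>W"
  shows "norm (interaction x s p) \<le> C\<^sub>W"
    and "norm (interaction x s p - interaction x s q) \<le> C\<^sub>W * (L\<^sub>D * norm (p - q))"
proof -
  show "norm (interaction x s p) \<le> C\<^sub>W"
    unfolding interaction_def using row_weighted(2)[OF x drift_section drift_bound] by simp
  have "interaction x s p - interaction x s q = (LINT y|\<nu>. W (x, y) *\<^sub>R (drift s p y - drift s q y))"
    unfolding interaction_def scaleR_diff_right
    by (rule Bochner_Integration.integral_diff[OF row_weighted(1)[OF x drift_section drift_bound]
          row_weighted(1)[OF x drift_section drift_bound], symmetric])
  also have "norm \<dots> \<le> C\<^sub>W * (L\<^sub>D * norm (p - q))"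
    by (rule row_weighted(2)[OF x]) (use drift_lipschitz in auto)
  finally show "norm (interaction x s p - interaction x s q) \<le> C\<^sub>W * (L\<^sub>D * norm (p - q))" .
qed

definition L\<^sub>V :: real where "L\<^sub>V = L\<^sub>f + C\<^sub>W * L\<^sub>D"

lemma L\<^sub>V_nonneg: "0 \<le> L\<^sub>V" using lipschitz_constants_nonneg C\<^sub>W_nonneg by (simp add: L\<^sub>V_def)

lemma field_measurable [measurable (raw)]:
  assumes [measurable]: "a \<in> borel_measurable N" "b \<in> borel_measurable N" "c \<in> measurable N \<nu>"
  shows "(\<lambda>z. field (c z) (a z) (b z)) \<in> borel_measurable N"
  unfolding field_def by measurable

text \<open>The row bound on \<open>W\<close> makes the field Lipschitz in \<open>u\<close> and bounds its interaction part, with constants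
independent of \<open>x\<close>.\<close>
lemma AE_continuity_equation:
  assumes T: "0 < T"
  shows "\<exists>c. AE x in \<nu>. continuity_equation (field x) L\<^sub>V c T (\<lambda>s. vlasov_measure \<rho> s x)"
proof -
  have "continuous_on {0..T} (\<lambda>s. f s 0)"
    by (rule continuous_on_compose2[OF f_cont, of _ "\<lambda>s. (s, 0)", simplified]) (auto intro: continuous_intros)
  then have "compact ((\<lambda>s. f s 0) ` {0..T})" by (rule compact_continuous_image) simp
  then obtain c0 where "\<forall>s\<in>{0..T}. norm (f s 0) \<le> c0"
    by (auto dest!: compact_imp_bounded simp: bounded_iff)
  then have c0: "\<And>s. s \<in> {0..T} \<Longrightarrow> norm (f s 0) \<le> c0" by blast
  have c00: "0 \<le> c0" using order_trans[OF norm_ge_zero c0[of 0]] T by simp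
  have weak: "AE x in \<nu>. \<forall>t\<ge>0. \<forall>\<phi> g. test_function \<phi> g \<longrightarrow>
        (LINT u|lborel. \<phi> u * \<rho> t u x) - (LINT u|lborel. \<phi> u * \<rho> 0 u x) =
        (LINT s:{0..t}|lborel.
           (LINT u|lborel. (g u \<bullet> vlasov_field \<nu> W f D \<rho> s u x) * \<rho> s u x))"
    using \<rho>_sol by (simp add: vlasov_solution_def)
  show ?thesis
  proof (rule exI[of _ "c0 + C\<^sub>W"])
    show "AE x in \<nu>. continuity_equation (field x) L\<^sub>V (c0 + C\<^sub>W) T (\<lambda>s. vlasov_measure \<rho> s x)"
      using kernel_row_bound weak AE_space
    proof eventually_elim
      case (elim x)
      then have x: "x \<in> K" "(\<integral>\<^sup>+y. ennreal \<bar>W (x, y)\<bar> \<partial>\<nu>) \<le> ennreal C\<^sub>W" by (auto simp: space_\<nu>)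
      have x': "x \<in> space \<nu>" using x by (simp add: space_\<nu>)
      have field_meas: "(\<lambda>z. field x (a z) (b z)) \<in> borel_measurable N"
        if "a \<in> borel_measurable N" "b \<in> borel_measurable N" for a b and N :: "'z measure"
        by (rule field_measurable) (use that x' in auto)
      have lipf: "lipschitz_field (field x) L\<^sub>V (c0 + C\<^sub>W) T"
      proof
        show "(\<lambda>(s, u). field x s u) \<in> borel_measurable (borel \<Otimes>\<^sub>M borel)"
          unfolding split_beta by (rule field_measurable) (use x' in auto)
        show "norm (field x s v - field x s w) \<le> L\<^sub>V * norm (v - w)" for s v w
        proof -
          have "norm (field x s v - field x s w) \<le> norm (f s v - f s w) + norm (interaction x s v - interaction x s w)"
            using norm_triangle_ineq[of "f s v - f s w" "interaction x s v - interaction x s w"]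
            by (simp add: field_def algebra_simps)
          also have "\<dots> \<le> L\<^sub>f * norm (v - w) + C\<^sub>W * (L\<^sub>D * norm (v - w))"
            by (intro add_mono f_lip interaction_bounds(2)[OF x])
          finally show ?thesis by (simp add: L\<^sub>V_def algebra_simps)
        qed
        show "norm (field x s 0) \<le> c0 + C\<^sub>W" if "s \<in> {0..T}" for s
          using norm_triangle_ineq[of "f s 0" "interaction x s 0"] c0[OF that] interaction_bounds(1)[OF x, of s 0]
          by (simp add: field_def)
      qed (use L\<^sub>V_nonneg c00 C\<^sub>W_nonneg in auto)
      then interpret lf: lipschitz_field "field x" L\<^sub>V "c0 + C\<^sub>W" T .
      have flux_eq: "(LINT u|vlasov_measure \<rho> s x. g u \<bullet> field x s u) = (LINT u|lborel. dens s u x * (g u \<bullet> field x s u))"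
        if "0 \<le> s" "continuous_on UNIV g" for s g
      proof -
        have [measurable]: "g \<in> borel_measurable borel" by (rule borel_measurable_continuous_onI) fact
        have "(\<lambda>u. field x s u) \<in> borel_measurable borel" by (rule field_measurable) (use x' in auto)
        then have "(\<lambda>u. g u \<bullet> field x s u) \<in> borel_measurable borel" by measurable
        from integral_vlasov[OF x(1) that(1) this] show ?thesis by simp
      qed
      show ?case
      proof (intro continuity_equation.intro continuity_equation_axioms.intro lipf)
        show "prob_space (vlasov_measure \<rho> s x)" if "s \<in> {0..T}" for s using prob_vlasov[OF x(1)] that by simp
        show "sets (vlasov_measure \<rho> s x) = sets borel" for s by simp
        fix \<phi> :: "'b \<Rightarrow> real" and g assume test: "test_function \<phi> g"
        obtain B R where BR: "0 \<le> B" "0 \<le> R" "\<And>u. norm (g u) \<le> B" "\<And>u. R < norm u \<Longrightarrow> g u = 0"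
          using test_gradient_bounded_support[OF test] by metis
        have g_cont: "continuous_on UNIV g" and grad: "\<And>u. GDERIV \<phi> u :> g u"
          using test by (auto simp: test_function_def)
        have [measurable]: "g \<in> borel_measurable borel" by (rule borel_measurable_continuous_onI[OF g_cont])
        have "\<phi> \<in> borel_measurable borel"
          using grad by (intro borel_measurable_continuous_onI continuous_at_imp_continuous_on)
            (auto simp: gderiv_def intro: has_derivative_continuous)
        note [measurable] = this
        have F_meas: "(\<lambda>s. LINT u|lborel. dens s u x * (g u \<bullet> field x s u)) \<in> borel_measurable borel"
        proof -
          have [measurable]: "(\<lambda>p. field x (fst p) (snd p)) \<in> borel_measurable (borel \<Otimes>\<^sub>M lborel)"
            by (rule field_measurable) (use x' in auto)
          have [measurable]: "(\<lambda>p. dens (fst p) (snd p) x) \<in> borel_measurable (borel \<Otimes>\<^sub>M lborel)"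
            by (rule dens_measurable) (use x' in auto)
          have "(\<lambda>(s, u). dens s u x * (g u \<bullet> field x s u)) \<in> borel_measurable (borel \<Otimes>\<^sub>M lborel)"
            unfolding split_beta by measurable
          then show ?thesis by (rule lborel.borel_measurable_lebesgue_integral)
        qed
        have F_bound: "norm (LINT u|lborel. dens s u x * (g u \<bullet> field x s u)) \<le> B * (c0 + C\<^sub>W + L\<^sub>V * R)"
          if s: "s \<in> {0..T}" for s
        proof -
          have "norm (g u \<bullet> field x s u) \<le> B * (c0 + C\<^sub>W + L\<^sub>V * R)" for u
          proof (cases "R < norm u")
            case True
            then show ?thesis using BR(4)[OF True] BR(1,2) c00 C\<^sub>W_nonneg L\<^sub>V_nonneg by simp
          next
            case False
            have "norm (field x s u) \<le> c0 + C\<^sub>W + L\<^sub>V * norm u" by (rule lf.V_growth[OF s])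
            also have "\<dots> \<le> c0 + C\<^sub>W + L\<^sub>V * R" using False L\<^sub>V_nonneg by (intro add_left_mono mult_left_mono) auto
            finally have "norm (g u) * norm (field x s u) \<le> B * (c0 + C\<^sub>W + L\<^sub>V * R)"
              using BR by (intro mult_mono) auto
            then show ?thesis using Cauchy_Schwarz_ineq2[of "g u" "field x s u"] by simp
          qed
          moreover have "(\<lambda>u. g u \<bullet> field x s u) \<in> borel_measurable borel"
          proof -
            have [measurable]: "(\<lambda>u. field x s u) \<in> borel_measurable borel" by (rule field_measurable) (use x' in auto)
            show ?thesis by measurable
          qed
          ultimately show ?thesis using drift_le[OF x(1), of "\<lambda>u. g u \<bullet> field x s u" _ s] by simp
        qed
        have "set_integrable lborel {0..T} (\<lambda>s. LINT u|lborel. dens s u x * (g u \<bullet> field x s u))"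
          by (rule set_integrable_bounded_interval[OF F_meas F_bound])
        moreover have "set_integrable lborel {0..T} (\<lambda>s. LINT u|lborel. dens s u x * (g u \<bullet> field x s u)) =
            set_integrable lborel {0..T} (\<lambda>s. LINT u|vlasov_measure \<rho> s x. g u \<bullet> field x s u)"
          by (rule set_integrable_cong) (auto simp: flux_eq[OF _ g_cont])
        ultimately show "set_integrable lborel {0..T} (\<lambda>s. LINT u|vlasov_measure \<rho> s x. g u \<bullet> field x s u)" by simp
        show "(LINT u|vlasov_measure \<rho> t x. \<phi> u) - (LINT u|vlasov_measure \<rho> 0 x. \<phi> u) =
          (LINT s:{0..t}|lborel. LINT u|vlasov_measure \<rho> s x. g u \<bullet> field x s u)" if t: "t \<in> {0..T}" for t
        proof -
          have "(LINT u|vlasov_measure \<rho> s x. \<phi> u) = (LINT u|lborel. \<phi> u * \<rho> s u x)" if "0 \<le> s" for s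
            using integral_vlasov[OF x(1) that, of \<phi>] that by (simp add: dens_def max_absorb2 mult.commute)
          moreover have "(LINT s:{0..t}|lborel. LINT u|vlasov_measure \<rho> s x. g u \<bullet> field x s u) =
            (LINT s:{0..t}|lborel. (LINT u|lborel. (g u \<bullet> vlasov_field \<nu> W f D \<rho> s u x) * \<rho> s u x))"
            by (rule set_lebesgue_integral_cong)
              (auto simp: flux_eq[OF _ g_cont] vlasov_field_eq dens_def max_absorb2 mult.commute)
          ultimately show ?thesis using elim(2) t test by auto
        qed
      qed
    qed
  qed
qed

end

section \<open>Gronwall estimate and convergence\<close>

text \<open>With the weight \<open>exp (- (2 * c + 1) * s)\<close> the integral term is at most half of the supremum of the
weighted function, which is finite because \<open>e\<close> is bounded.\<close>
lemma gronwall_integral: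
  fixes e :: "real \<Rightarrow> real"
  assumes e_meas [measurable]: "e \<in> borel_measurable borel" and range: "\<And>s. 0 \<le> e s" "\<And>s. e s \<le> M"
    and nonneg: "0 \<le> a" "0 \<le> c"
    and ineq: "\<And>s. s \<in> {0..T} \<Longrightarrow> e s \<le> a + c * (LINT r:{0..s}|lborel. e r)"
    and t: "t \<in> {0..T}"
  shows "e t \<le> 2 * a * exp ((2 * c + 1) * T)"
proof -
  define \<kappa> where "\<kappa> = 2 * c + 1"
  have l: "0 < \<kappa>" using nonneg by (simp add: \<kappa>_def)
  define S where "S = (SUP s\<in>{0..T}. e s * exp (- \<kappa> * s))"
  have "e s * exp (- \<kappa> * s) \<le> M" if "s \<in> {0..T}" for s
  proof -
    have "exp (- \<kappa> * s) \<le> 1" using l that by simp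
    then have "e s * exp (- \<kappa> * s) \<le> e s * 1" by (rule mult_left_mono) (rule range)
    then show ?thesis using range(2)[of s] by simp
  qed
  then have bdd: "bdd_above ((\<lambda>s. e s * exp (- \<kappa> * s)) ` {0..T})" by (intro bdd_aboveI2[where M = M])
  have S: "e s * exp (- \<kappa> * s) \<le> S" if "s \<in> {0..T}" for s
    unfolding S_def by (rule cSUP_upper[OF that bdd])
  have e_le: "e s \<le> S * exp (\<kappa> * s)" if "s \<in> {0..T}" for s
    using mult_right_mono[OF S[OF that], of "exp (\<kappa> * s)"] by (simp add: mult.assoc mult_exp_exp)
  have T0: "0 \<in> {0..T}" using t by auto
  have S0: "0 \<le> S" using order_trans[OF range(1)[of 0]] S[OF T0] by simp
  have "e s * exp (- \<kappa> * s) \<le> a + S / 2" if s: "s \<in> {0..T}" for s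
  proof -
    have int: "(LINT r:{0..s}|lborel. exp (\<kappa> * r)) = exp (\<kappa> * s) / \<kappa> - exp (\<kappa> * 0) / \<kappa>"
      unfolding set_lebesgue_integral_def
    proof (rule integral_FTC_atLeastAtMost)
      show "((\<lambda>r. exp (\<kappa> * r) / \<kappa>) has_vector_derivative exp (\<kappa> * r)) (at r within {0..s})" for r
        using l unfolding has_real_derivative_iff_has_vector_derivative[symmetric]
        by (auto intro!: derivative_eq_intros)
    qed (use s in \<open>auto intro!: continuous_intros\<close>)
    have "(LINT r:{0..s}|lborel. e r) \<le> (LINT r:{0..s}|lborel. S * exp (\<kappa> * r))"
    proof (rule set_integral_mono)
      show "set_integrable lborel {0..s} e"
        by (rule set_integrable_bounded_interval[where K = M]) (use range in auto)
      show "set_integrable lborel {0..s} (\<lambda>r. S * exp (\<kappa> * r))"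
        by (rule set_integrable_bounded_interval[where K = "S * exp (\<kappa> * s)"])
          (use S0 l in \<open>auto intro!: mult_left_mono simp: abs_mult\<close>)
    qed (use e_le s in auto)
    also have "\<dots> = S * (LINT r:{0..s}|lborel. exp (\<kappa> * r))" by simp
    also have "\<dots> \<le> S * (exp (\<kappa> * s) / \<kappa>)" unfolding int using S0 l by (intro mult_left_mono) auto
    finally have "e s \<le> a + c * (S * (exp (\<kappa> * s) / \<kappa>))"
      using ineq[OF s] mult_left_mono[OF _ nonneg(2)] by fastforce
    then have "e s * exp (- \<kappa> * s) \<le> (a + c * (S * (exp (\<kappa> * s) / \<kappa>))) * exp (- \<kappa> * s)"
      by (rule mult_right_mono) simp
    also have "\<dots> = a * exp (- \<kappa> * s) + c / \<kappa> * S"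
    proof -
      have "exp (\<kappa> * s) * exp (- \<kappa> * s) = 1" by (simp add: mult_exp_exp)
      then show ?thesis using l by (simp add: field_simps)
    qed
    also have "\<dots> \<le> a * 1 + 1 / 2 * S"
    proof (intro add_mono mult_left_mono mult_right_mono)
      show "exp (- \<kappa> * s) \<le> 1" using l s by simp
      show "c / \<kappa> \<le> 1 / 2" using nonneg by (simp add: \<kappa>_def divide_simps)
    qed (use nonneg S0 in auto)
    finally show ?thesis by simp
  qed
  then have "S \<le> a + S / 2" unfolding S_def by (intro cSUP_least) (use T0 in auto)
  then have S2: "S \<le> 2 * a" by simp
  have "e t \<le> S * exp (\<kappa> * t)" by (rule e_le[OF t])
  also have "\<dots> \<le> (2 * a) * exp (\<kappa> * T)" using S2 S0 l t nonneg by (intro mult_mono) auto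
  finally show ?thesis by (simp add: \<kappa>_def)
qed

context mean_field
begin

text \<open>The solutions are specified at nonnegative times only; freezing them before time \<open>0\<close> makes them continuous
on the whole time axis.\<close>
definition U :: "nat list \<Rightarrow> real \<Rightarrow> 'b" where "U w s = u w (max 0 s)"

lemma U_eq: "0 \<le> s \<Longrightarrow> U w s = u w s" by (simp add: U_def max_absorb2)

definition force :: "nat list \<Rightarrow> real \<Rightarrow> 'b" where
  "force a s = (\<Sum>v\<in>words k (length a). (cell_average F K \<nu> W a v / real k ^ length a) *\<^sub>R D (U a s) (U v s))"

lemma U_derivative:
  assumes "1 \<le> n" "a \<in> words k n" "s \<in> {0..T}"
  shows "(U a has_vector_derivative (f s (U a s) + force a s)) (at s within {0..T})"
proof -
  have "(u a has_vector_derivative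
           f s (u a s) + (\<Sum>v\<in>words k n.
             (cell_average F K \<nu> W a v * measure \<nu> (cell F K v)) *\<^sub>R D (u a s) (u v s)))
        (at s within {0..})"
    using u_sol[OF assms(1)] assms(2,3) by (auto simp: particle_solution_def)
  moreover have "(\<Sum>v\<in>words k n.
             (cell_average F K \<nu> W a v * measure \<nu> (cell F K v)) *\<^sub>R D (u a s) (u v s)) = force a s"
  proof -
    have "length a = n" using assms(2) by (simp add: words_def)
    then show ?thesis unfolding force_def by (intro sum.cong) (use assms(3) cells in \<open>auto simp: U_eq\<close>)
  qed
  moreover have "f s (u a s) = f s (U a s)" using assms(3) by (simp add: U_eq)
  ultimately have "(u a has_vector_derivative f s (U a s) + force a s) (at s within {0..T})"
    by (auto intro: has_vector_derivative_within_subset)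
  then show ?thesis
    by (rule has_vector_derivative_transform[OF assms(3), rotated]) (simp add: U_eq)
qed

lemma U_continuous:
  assumes "1 \<le> n" "a \<in> words k n"
  shows "continuous_on UNIV (U a)"
proof -
  have "continuous_on {0..} (u a)"
  proof (rule continuous_on_eq_continuous_within[THEN iffD2], rule ballI)
    fix s :: real assume "s \<in> {0..}"
    then have "\<exists>d. (u a has_vector_derivative d) (at s within {0..})"
      using u_sol[OF assms(1)] assms(2) unfolding particle_solution_def by auto
    then show "continuous (at s within {0..}) (u a)" by (auto intro: has_vector_derivative_continuous)
  qed
  then have "continuous_on UNIV (\<lambda>s. u a (max 0 s))"
    by (rule continuous_on_compose2) (auto intro!: continuous_intros)
  then show ?thesis by (simp add: U_def[abs_def])
qed

lemma U_measurable: "1 \<le> n \<Longrightarrow> a \<in> words k n \<Longrightarrow> U a \<in> borel_measurable borel"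
  by (rule borel_measurable_continuous_onI[OF U_continuous])

lemma force_continuous:
  assumes "1 \<le> n" "a \<in> words k n" shows "continuous_on UNIV (force a)"
proof -
  have len: "length a = n" using assms by (simp add: words_def)
  have D2: "continuous_on UNIV (\<lambda>s. D (U a s) (U v s))" if "v \<in> words k n" for v
    using continuous_on_compose2[OF D_cont, of UNIV "\<lambda>s. (U a s, U v s)"]
      continuous_on_Pair[OF U_continuous[OF assms] U_continuous[OF assms(1) that]] by simp
  show ?thesis unfolding force_def len by (intro continuous_on_sum continuous_on_scaleR continuous_on_const D2)
qed

lemma force_bound: "norm (force a s) \<le> (\<Sum>v\<in>words k (length a). \<bar>cell_average F K \<nu> W a v\<bar> / real k ^ length a)"
  unfolding force_def
proof (rule sum_norm_le)
  fix v
  show "norm ((cell_average F K \<nu> W a v / real k ^ length a) *\<^sub>R D (U a s) (U v s))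
      \<le> \<bar>cell_average F K \<nu> W a v\<bar> / real k ^ length a"
    using mult_left_mono[OF D_bound[of "U a s" "U v s"], of "\<bar>cell_average F K \<nu> W a v\<bar> / real k ^ length a"]
    by simp
qed

definition gap :: "nat list \<Rightarrow> real \<Rightarrow> 'a \<Rightarrow> real" where
  "gap a s x = norm (force a s - interaction x s (U a s))"

lemma gap_nonneg [simp]: "0 \<le> gap a s x" by (simp add: gap_def)

lemma gap_measurable:
  assumes "1 \<le> n" "a \<in> words k n" "p \<in> borel_measurable N" "q \<in> measurable N \<nu>"
  shows "(\<lambda>z. gap a (p z) (q z)) \<in> borel_measurable N"
proof -
  have 1: "(\<lambda>z. force a (p z)) \<in> borel_measurable N" and 2: "(\<lambda>z. U a (p z)) \<in> borel_measurable N"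
    using measurable_compose[OF assms(3) borel_measurable_continuous_onI[OF force_continuous[OF assms(1,2)]]]
      measurable_compose[OF assms(3) U_measurable[OF assms(1,2)]] by auto
  show ?thesis
    unfolding gap_def by (rule measurable_compose[OF
          borel_measurable_diff[OF 1 interaction_measurable[OF assms(3) 2 assms(4)]] borel_measurable_norm])
qed

lemma integrable_W: "integrable (\<nu> \<Otimes>\<^sub>M \<nu>) W"
proof -
  have "integrable (\<nu> \<Otimes>\<^sub>M \<nu>) (\<lambda>p. 1 + (W p)\<^sup>2)" using W_L2 by simp
  then show ?thesis
  proof (rule Bochner_Integration.integrable_bound[OF _ W_meas])
    have "\<bar>r\<bar> \<le> 1 + r\<^sup>2" for r :: real
      using zero_le_power2[of "\<bar>r\<bar> - 1"] by (simp add: power2_diff)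
    then show "AE p in \<nu> \<Otimes>\<^sub>M \<nu>. norm (W p) \<le> norm (1 + (W p)\<^sup>2)" by simp
  qed
qed

lemma integral_cell_decomposition:
  fixes G :: "'a \<Rightarrow> 'c::{banach, second_countable_topology}"
  assumes "integrable \<nu> G"
  shows "(LINT y|\<nu>. G y) = (\<Sum>v\<in>words k m. LINT y:cell F K v|\<nu>. G y)"
proof -
  have "(\<Sum>v\<in>words k m. LINT y:cell F K v|\<nu>. G y) = (LINT y|\<nu>. (\<Sum>v\<in>words k m. indicat_real (cell F K v) y *\<^sub>R G y))"
    unfolding set_lebesgue_integral_def
    by (rule Bochner_Integration.integral_sum[symmetric]) (rule integrable_mult_indicator[OF cell_sets assms])
  also have "\<dots> = (LINT y|\<nu>. G y)"
  proof (rule integral_cong_AE)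
    show "AE y in \<nu>. (\<Sum>v\<in>words k m. indicat_real (cell F K v) y *\<^sub>R G y) = G y"
      using AE_sum_cell_indicators by eventually_elim (simp add: scaleR_sum_left[symmetric])
    show "(\<lambda>y. \<Sum>v\<in>words k m. indicat_real (cell F K v) y *\<^sub>R G y) \<in> borel_measurable \<nu>"
      using assms cell_sets by (intro borel_measurable_sum borel_measurable_scaleR borel_measurable_indicator) auto
  qed (use assms in auto)
  finally show ?thesis by simp
qed

end

text \<open>The level \<open>m + l\<close> is fixed, and \<open>d\<close> is a majorant of the distance between the initial measures.\<close>
locale mean_field_level = mean_field k F K \<nu> W f D L\<^sub>f L\<^sub>D u \<rho>
  for k and F :: "nat \<Rightarrow> 'a::euclidean_space \<Rightarrow> 'a" and K and \<nu> :: "'a measure"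
    and W :: "'a \<times> 'a \<Rightarrow> real" and f :: "real \<Rightarrow> 'b::euclidean_space \<Rightarrow> 'b" and D :: "'b \<Rightarrow> 'b \<Rightarrow> 'b"
    and L\<^sub>f L\<^sub>D :: real and u :: "nat list \<Rightarrow> real \<Rightarrow> 'b" and \<rho> :: "real \<Rightarrow> 'b \<Rightarrow> 'a \<Rightarrow> real" +
  fixes m l :: nat and T :: real and d :: "'a \<Rightarrow> real"
  assumes m_pos: "1 \<le> m" and T_pos: "0 < T" and d_measurable [measurable]: "d \<in> borel_measurable \<nu>"
    and d_range: "\<And>x. x \<in> K \<Longrightarrow> 0 \<le> d x" "\<And>x. x \<in> K \<Longrightarrow> d x \<le> 2"
    and d_initial: "AE x in \<nu>. \<forall>h. (\<forall>z. \<bar>h z\<bar> \<le> 1) \<longrightarrow> (\<forall>v w. \<bar>h v - h w\<bar> \<le> norm (v - w)) \<longrightarrow>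
      \<bar>(LINT v|local_empirical k F K u m l 0 x. h v) - (LINT v|vlasov_measure \<rho> 0 x. h v)\<bar> \<le> d x"
begin

lemma child_words: "w \<in> words k m \<Longrightarrow> j \<in> words k l \<Longrightarrow> w @ j \<in> words k (m + l)"
  by (rule words_append)

lemma level_pos: "1 \<le> m + l" using m_pos by simp

lemma card_words_pos: "0 < real (card (words k l))" using k_pos by (simp add: card_words)

definition gap_cap :: real where
  "gap_cap = C\<^sub>W + (\<Sum>a\<in>words k (m + l). \<Sum>v\<in>words k (m + l). \<bar>cell_average F K \<nu> W a v\<bar> / real k ^ (m + l))"

lemma gap_cap_nonneg: "0 \<le> gap_cap"
  unfolding gap_cap_def by (intro add_nonneg_nonneg C\<^sub>W_nonneg sum_nonneg) auto

text \<open>The mean gap of the particles in the cell of \<open>x\<close>. The cap has no effect almost everywhere; it makes the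
function bounded everywhere, so that all integrals below exist.\<close>
definition total_gap :: "real \<Rightarrow> 'a \<Rightarrow> real" where
  "total_gap s x = min gap_cap (\<Sum>w\<in>words k m. indicator (cell F K w) x *
      ((\<Sum>j\<in>words k l. gap (w @ j) s x) / card (words k l)))"

lemma total_gap_range: "0 \<le> total_gap s x" "total_gap s x \<le> gap_cap"
  unfolding total_gap_def using gap_cap_nonneg
  by (auto intro!: sum_nonneg mult_nonneg_nonneg divide_nonneg_nonneg)

lemma total_gap_measurable [measurable (raw)]:
  assumes p: "p \<in> borel_measurable N" and q: "q \<in> measurable N \<nu>"
  shows "(\<lambda>z. total_gap (p z) (q z)) \<in> borel_measurable N"
proof -
  have "(\<lambda>z. indicat_real (cell F K w) (q z)) \<in> borel_measurable N" if "w \<in> words k m" for w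
    by (rule measurable_compose[OF q borel_measurable_indicator[OF cell_sets[OF that]]])
  moreover have "(\<lambda>z. gap (w @ j) (p z) (q z)) \<in> borel_measurable N" if "w \<in> words k m" "j \<in> words k l" for w j
    by (rule gap_measurable[OF level_pos child_words[OF that] p q])
  ultimately show ?thesis unfolding total_gap_def
    by (intro borel_measurable_min borel_measurable_const borel_measurable_sum borel_measurable_times
        borel_measurable_divide)
qed

lemma gap_le_cap:
  assumes x: "x \<in> K" "(\<integral>\<^sup>+y. ennreal \<bar>W (x, y)\<bar> \<partial>\<nu>) \<le> ennreal C\<^sub>W" and a: "a \<in> words k (m + l)"
  shows "gap a s x \<le> gap_cap"
proof -
  have len: "length a = m + l" using a by (simp add: words_def)
  have "gap a s x \<le> norm (force a s) + norm (interaction x s (U a s))" unfolding gap_def by (rule norm_triangle_ineq4)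
  also have "norm (force a s) \<le> (\<Sum>v\<in>words k (m + l). \<bar>cell_average F K \<nu> W a v\<bar> / real k ^ (m + l))"
    using force_bound[of a s] by (simp add: len)
  also have "\<dots> \<le> (\<Sum>a\<in>words k (m + l). \<Sum>v\<in>words k (m + l). \<bar>cell_average F K \<nu> W a v\<bar> / real k ^ (m + l))"
    by (rule member_le_sum[OF a]) (auto intro!: sum_nonneg)
  finally show ?thesis using interaction_bounds(1)[OF x, of s "U a s"] by (simp add: gap_cap_def)
qed

lemma AE_total_gap:
  "AE x in \<nu>. \<forall>s. total_gap s x = (\<Sum>j\<in>words k l. gap (word_of k F K m x @ j) s x) / card (words k l)"
  using AE_word_of kernel_row_bound AE_space
proof eventually_elim
  case (elim x)
  then have x: "x \<in> K" by (simp add: space_\<nu>)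
  show ?case
  proof
    fix s
    let ?w = "word_of k F K m x"
    have "(\<Sum>j\<in>words k l. gap (?w @ j) s x) \<le> (\<Sum>j\<in>words k l. gap_cap)"
      by (intro sum_mono gap_le_cap[OF x elim(2)] child_words word_of_cell[OF x])
    then have "(\<Sum>j\<in>words k l. gap (?w @ j) s x) / card (words k l) \<le> gap_cap"
      using card_words_pos by (simp add: divide_le_eq mult.commute)
    moreover have "(\<Sum>w\<in>words k m. indicator (cell F K w) x * ((\<Sum>j\<in>words k l. gap (w @ j) s x) / card (words k l)))
      = (\<Sum>j\<in>words k l. gap (?w @ j) s x) / card (words k l)"
      by (rule sum_cells_eq_word_of[where G = "\<lambda>w. (\<Sum>j\<in>words k l. gap (w @ j) s x) / card (words k l)"]) (use elim x in auto)
    ultimately show "total_gap s x = (\<Sum>j\<in>words k l. gap (?w @ j) s x) / card (words k l)"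
      by (simp add: total_gap_def)
  qed
qed

definition growth :: real where "growth = exp (L\<^sub>V * T)"

lemma growth_pos: "0 < growth" by (simp add: growth_def)

text \<open>The bound of the stability estimate for the distance of the two measures at \<open>x\<close> and time \<open>t\<close>.\<close>
definition err :: "real \<Rightarrow> 'a \<Rightarrow> real" where
  "err t x = growth * (d x + (LINT s:{0..t}|lborel. total_gap s x))"

lemma comparison:
  "AE x in \<nu>. \<forall>t\<in>{0..T}. \<forall>h. (\<forall>z. \<bar>h z\<bar> \<le> 1) \<longrightarrow> (\<forall>v w. \<bar>h v - h w\<bar> \<le> norm (v - w)) \<longrightarrow>
      \<bar>(LINT v|local_empirical k F K u m l t x. h v) - (LINT v|vlasov_measure \<rho> t x. h v)\<bar> \<le> err t x"
proof -
  obtain c where "AE x in \<nu>. continuity_equation (field x) L\<^sub>V c T (\<lambda>s. vlasov_measure \<rho> s x)"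
    using AE_continuity_equation[OF T_pos] by blast
  then show ?thesis using AE_total_gap d_initial kernel_row_bound AE_space
  proof eventually_elim
    case (elim x)
    then have x: "x \<in> K" by (simp add: space_\<nu>)
    interpret ce: continuity_equation "field x" L\<^sub>V c T "\<lambda>s. vlasov_measure \<rho> s x" by fact
    let ?w = "word_of k F K m x"
    let ?J = "words k l"
    have wj: "?w @ j \<in> words k (m + l)" if "j \<in> ?J" for j by (rule child_words[OF word_of_cell(1)[OF x] that])
    have J: "finite ?J" "?J \<noteq> {}" using card_words_pos by auto
    let ?y' = "\<lambda>j s. f s (U (?w @ j) s) + force (?w @ j) s"
    have gap_eq: "norm (?y' j s - field x s (U (?w @ j) s)) = gap (?w @ j) s x" for j s
      by (simp add: field_def gap_def algebra_simps)
    have gap_int: "set_integrable lborel {0..t} (\<lambda>s. gap (?w @ j) s x)" if "j \<in> ?J" for j t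
    proof (rule set_integrable_bounded_interval)
      show "(\<lambda>s. gap (?w @ j) s x) \<in> borel_measurable borel"
        by (rule gap_measurable[OF level_pos wj[OF that]]) (use x in \<open>auto simp: space_\<nu>\<close>)
      show "norm (gap (?w @ j) s x) \<le> gap_cap" for s
        using gap_le_cap[OF x elim(4) wj[OF that]] by simp
    qed
    show ?case
    proof (intro ballI allI impI)
      fix t and h :: "'b \<Rightarrow> real"
      assume t: "t \<in> {0..T}" and h: "\<forall>z. \<bar>h z\<bar> \<le> 1" "\<forall>v w. \<bar>h v - h w\<bar> \<le> norm (v - w)"
      have emp: "(LINT v|local_empirical k F K u m l s x. h v) = (\<Sum>j\<in>?J. h (U (?w @ j) s)) / card ?J"
        if "0 \<le> s" "\<forall>v w. \<bar>h v - h w\<bar> \<le> norm (v - w)" for s and h :: "'b \<Rightarrow> real"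
        using integral_local_empirical[OF lipschitz_real_measurable(2)[of h 1]] that by (simp add: U_eq)
      have "\<bar>(\<Sum>j\<in>?J. h (U (?w @ j) t)) / card ?J - (LINT v|vlasov_measure \<rho> t x. h v)\<bar> \<le>
        exp (L\<^sub>V * T) * (d x + (\<Sum>j\<in>?J. LINT s:{0..t}|lborel. norm (?y' j s - field x s (U (?w @ j) s))) / card ?J)"
      proof (rule ce.particles_track_solution[OF J])
        show "(U (?w @ j) has_vector_derivative ?y' j s) (at s within {0..T})" if "j \<in> ?J" "s \<in> {0..T}" for j s
          by (rule U_derivative[OF level_pos wj[OF that(1)] that(2)])
        show "continuous_on {0..T} (?y' j)" if "j \<in> ?J" for j
        proof (rule continuous_on_add)
          have "continuous_on {0..T} (\<lambda>s. (s, U (?w @ j) s))"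
            by (intro continuous_on_Pair continuous_on_id continuous_on_subset[OF U_continuous[OF level_pos wj[OF that]]]) auto
          from continuous_on_compose2[OF f_cont this] show "continuous_on {0..T} (\<lambda>s. f s (U (?w @ j) s))" by simp
          show "continuous_on {0..T} (force (?w @ j))"
            by (rule continuous_on_subset[OF force_continuous[OF level_pos wj[OF that]]]) simp
        qed
        show "set_integrable lborel {0..T} (\<lambda>s. norm (?y' j s - field x s (U (?w @ j) s)))" if "j \<in> ?J" for j
          unfolding gap_eq by (rule gap_int[OF that])
        show "\<bar>(\<Sum>j\<in>?J. h (U (?w @ j) 0)) / card ?J - (LINT v|vlasov_measure \<rho> 0 x. h v)\<bar> \<le> d x"
          if "\<And>z. \<bar>h z\<bar> \<le> 1" "\<And>v w. \<bar>h v - h w\<bar> \<le> norm (v - w)" for h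
          using elim(3) that by (simp add: emp[symmetric])
      qed (use t h in auto)
      also have "(\<Sum>j\<in>?J. LINT s:{0..t}|lborel. norm (?y' j s - field x s (U (?w @ j) s))) / card ?J
          = (LINT s:{0..t}|lborel. total_gap s x)"
      proof -
        have "(\<Sum>j\<in>?J. LINT s:{0..t}|lborel. gap (?w @ j) s x) = (LINT s:{0..t}|lborel. (\<Sum>j\<in>?J. gap (?w @ j) s x))"
          unfolding set_lebesgue_integral_def scaleR_sum_right
          by (rule Bochner_Integration.integral_sum[symmetric]) (rule gap_int[unfolded set_integrable_def])
        then show ?thesis unfolding gap_eq using elim(2) by (simp add: set_lebesgue_integral_def)
      qed
      finally show "\<bar>(LINT v|local_empirical k F K u m l t x. h v) - (LINT v|vlasov_measure \<rho> t x. h v)\<bar> \<le> err t x"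
        using emp[of t h] h t by (simp add: err_def growth_def)
    qed
  qed
qed

lemma d_BL_le_err:
  "AE x in \<nu>. \<forall>t\<in>{0..T}. d_BL (local_empirical k F K u m l t x) (vlasov_measure \<rho> t x) \<le> ennreal (err t x)"
  using comparison
proof eventually_elim
  case (elim x)
  show ?case
  proof
    fix t assume t: "t \<in> {0..T}"
    show "d_BL (local_empirical k F K u m l t x) (vlasov_measure \<rho> t x) \<le> ennreal (err t x)"
      unfolding d_BL_def
    proof (rule SUP_least, rule ennreal_leI)
      fix h :: "'b \<Rightarrow> real" assume "h \<in> {h. sup_abs h + lip_const h \<le> 1}"
      then have le: "sup_abs h \<le> 1" "lip_const h \<le> 1"
        by (auto intro: order_trans[OF _ order_trans[of _ "sup_abs h + lip_const h"]])
      have "\<bar>h z\<bar> \<le> 1" for z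
      proof -
        have "ennreal \<bar>h z\<bar> \<le> sup_abs h" unfolding sup_abs_def by (rule SUP_upper) simp
        then show ?thesis using le(1) by (metis ennreal_1 ennreal_le_iff order_trans zero_le_one)
      qed
      moreover have "\<bar>h v - h w\<bar> \<le> norm (v - w)" for v w
      proof (cases "v = w")
        case False
        have "ennreal (\<bar>h v - h w\<bar> / dist v w) \<le> lip_const h"
          unfolding lip_const_def by (rule SUP_upper2[of "(v, w)"]) (use False in auto)
        then have "\<bar>h v - h w\<bar> / dist v w \<le> 1" using le(2) by (metis ennreal_1 ennreal_le_iff order_trans zero_le_one)
        then show ?thesis using False by (simp add: dist_norm divide_le_eq)
      qed simp
      ultimately show "\<bar>(LINT v|local_empirical k F K u m l t x. h v) - (LINT v|vlasov_measure \<rho> t x. h v)\<bar> \<le> err t x"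
        using elim t by blast
    qed
  qed
qed

end

lemma (in self_similar_cells) AE_children_le:
  "AE x in \<nu>. \<forall>w\<in>words k m. (\<Sum>j\<in>words k l. indicat_real (cell F K (w @ j)) x) \<le> indicator (cell F K w) x"
  using AE_sum_cell_indicators
proof eventually_elim
  case (elim x)
  show ?case
  proof
    fix w assume w: "w \<in> words k m"
    show "(\<Sum>j\<in>words k l. indicat_real (cell F K (w @ j)) x) \<le> indicator (cell F K w) x"
    proof (cases "x \<in> cell F K w")
      case True
      have "(\<Sum>j\<in>words k l. indicat_real (cell F K (w @ j)) x)
          \<le> (\<Sum>w\<in>words k m. \<Sum>j\<in>words k l. indicat_real (cell F K (w @ j)) x)"
        by (rule member_le_sum[OF w]) (auto intro: sum_nonneg)
      also have "\<dots> = 1" using elim[rule_format, of "m + l"] by (simp only: sum_words_append)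
      finally show ?thesis using True by simp
    next
      case False
      then have "x \<notin> cell F K (w @ j)" if "j \<in> words k l" for j using cell_append_subset[OF that, of w] by auto
      then show ?thesis by simp
    qed
  qed
qed

context mean_field_level
begin

definition mean_gap :: "real \<Rightarrow> real" where "mean_gap s = (LINT x|\<nu>. total_gap s x)"

lemma total_gap_pair_measurable: "(\<lambda>(s, x). total_gap s x) \<in> borel_measurable (borel \<Otimes>\<^sub>M \<nu>)"
  unfolding split_beta by (rule total_gap_measurable[OF measurable_fst measurable_snd])

lemma total_gap_integrable: "integrable \<nu> (total_gap s)"
  by (rule integrable_const_bound[where B = gap_cap])
    (use total_gap_range total_gap_measurable[OF borel_measurable_const measurable_ident_sets[OF refl]] in auto)

lemma mean_gap_measurable: "mean_gap \<in> borel_measurable borel"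
  unfolding mean_gap_def by (rule borel_measurable_lebesgue_integral[OF total_gap_pair_measurable])

lemma mean_gap_range: "0 \<le> mean_gap s" "mean_gap s \<le> gap_cap"
proof -
  show "0 \<le> mean_gap s" unfolding mean_gap_def by (rule Bochner_Integration.integral_nonneg) (rule total_gap_range)
  have "mean_gap s \<le> (LINT x|\<nu>. gap_cap)"
    unfolding mean_gap_def by (rule integral_mono[OF total_gap_integrable]) (use total_gap_range in auto)
  then show "mean_gap s \<le> gap_cap" by (simp add: prob_space)
qed

lemma err_measurable [measurable]: "err t \<in> borel_measurable \<nu>"
proof -
  have "(\<lambda>(x, s). indicat_real {0..t} s * total_gap s x) \<in> borel_measurable (\<nu> \<Otimes>\<^sub>M lborel)"
    unfolding split_beta
    by (intro borel_measurable_times total_gap_measurable measurable_fst) auto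
  then have "(\<lambda>x. LINT s|lborel. indicat_real {0..t} s * total_gap s x) \<in> borel_measurable \<nu>"
    by (rule lborel.borel_measurable_lebesgue_integral)
  then show ?thesis
    unfolding err_def[abs_def] set_lebesgue_integral_def
    by (intro borel_measurable_times borel_measurable_add d_measurable) auto
qed

definition err_cap :: real where "err_cap = growth * (2 + T * gap_cap)"

lemma err_range:
  assumes "t \<in> {0..T}" "x \<in> K" shows "0 \<le> err t x" "err t x \<le> err_cap"
proof -
  have "0 \<le> (LINT s:{0..t}|lborel. total_gap s x)"
    unfolding set_lebesgue_integral_def by (rule Bochner_Integration.integral_nonneg) (simp add: total_gap_range)
  then show "0 \<le> err t x" using growth_pos d_range(1)[OF assms(2)] by (simp add: err_def)
  have "norm (LINT s:{0..t}|lborel. total_gap s x) \<le> (t - 0) * gap_cap"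
    by (rule set_integral_interval_bound) (use assms total_gap_range in auto)
  also have "\<dots> \<le> T * gap_cap" using assms gap_cap_nonneg by (intro mult_right_mono) auto
  finally show "err t x \<le> err_cap"
    unfolding err_def err_cap_def using growth_pos d_range(2)[OF assms(2)] by (intro mult_left_mono) auto
qed

lemma err_cap_nonneg: "0 \<le> err_cap"
  using growth_pos T_pos gap_cap_nonneg by (simp add: err_cap_def)

lemma err_integrable: "t \<in> {0..T} \<Longrightarrow> integrable \<nu> (err t)"
  by (rule integrable_const_bound[where B = err_cap]) (use err_range in \<open>auto simp: space_\<nu> intro!: AE_I2\<close>)

lemma d_integrable: "integrable \<nu> d"
  by (rule integrable_const_bound[where B = 2]) (use d_range in \<open>auto simp: space_\<nu> intro!: AE_I2\<close>)

lemma mean_err: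
  assumes t: "t \<in> {0..T}"
  shows "(LINT x|\<nu>. err t x) = growth * ((LINT x|\<nu>. d x) + (LINT s:{0..t}|lborel. mean_gap s))"
proof -
  interpret lb: pair_sigma_finite "lborel :: real measure" \<nu> ..
  let ?f = "\<lambda>s x. indicat_real {0..t} s * total_gap s x"
  have meas: "(\<lambda>(s, x). ?f s x) \<in> borel_measurable (lborel \<Otimes>\<^sub>M \<nu>)"
    unfolding split_beta by (intro borel_measurable_times total_gap_measurable measurable_snd) auto
  have int: "integrable (lborel \<Otimes>\<^sub>M \<nu>) (\<lambda>(s, x). ?f s x)"
  proof (rule Bochner_Integration.integrable_bound[OF _ meas])
    show "integrable (lborel \<Otimes>\<^sub>M \<nu>) (\<lambda>p. gap_cap * indicat_real ({0..t} \<times> space \<nu>) p)"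
    proof (intro integrable_mult_right integrable_real_indicator)
      have "emeasure (lborel \<Otimes>\<^sub>M \<nu>) ({0..t} \<times> space \<nu>) = emeasure lborel {0..t} * emeasure \<nu> (space \<nu>)"
        by (rule emeasure_pair_measure_Times) simp_all
      then show "emeasure (lborel \<Otimes>\<^sub>M \<nu>) ({0..t} \<times> space \<nu>) < \<infinity>"
        by (simp add: emeasure_space_1 emeasure_lborel_Icc_eq)
    qed simp
    show "AE p in lborel \<Otimes>\<^sub>M \<nu>. norm (case p of (s, x) \<Rightarrow> ?f s x) \<le> norm (gap_cap * indicat_real ({0..t} \<times> space \<nu>) p)"
    proof (rule AE_I2)
      fix p :: "real \<times> 'a" assume "p \<in> space (lborel \<Otimes>\<^sub>M \<nu>)"
      then show "norm (case p of (s, x) \<Rightarrow> ?f s x) \<le> norm (gap_cap * indicat_real ({0..t} \<times> space \<nu>) p)"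
        using total_gap_range gap_cap_nonneg by (cases p) (auto simp: indicator_def space_pair_measure)
    qed
  qed
  have "(LINT x|\<nu>. (LINT s:{0..t}|lborel. total_gap s x)) = (LINT x|\<nu>. LINT s|lborel. ?f s x)"
    by (simp add: set_lebesgue_integral_def)
  also have "\<dots> = (LINT s|lborel. LINT x|\<nu>. ?f s x)" by (rule lb.Fubini_integral[OF int])
  also have "\<dots> = (LINT s:{0..t}|lborel. mean_gap s)" by (simp add: set_lebesgue_integral_def mean_gap_def)
  finally have *: "(LINT x|\<nu>. (LINT s:{0..t}|lborel. total_gap s x)) = (LINT s:{0..t}|lborel. mean_gap s)" .
  have "integrable \<nu> (\<lambda>x. LINT s|lborel. ?f s x)" using lb.integrable_snd[OF int] by simp
  then have "integrable \<nu> (\<lambda>x. LINT s:{0..t}|lborel. total_gap s x)" by (simp add: set_lebesgue_integral_def)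
  then show ?thesis unfolding err_def using d_integrable * by simp
qed

text \<open>The vector-valued function \<open>D p\<close> is tested in the direction of the difference; the component of
\<open>D p\<close> in this direction, divided by \<open>1 + L\<^sub>D\<close>, is an admissible test function. No factor depending on the
dimension appears.\<close>
lemma drift_close:
  assumes s: "s \<in> {0..T}"
  shows "AE y in \<nu>. \<forall>v\<in>words k m. y \<in> cell F K v \<longrightarrow> (\<forall>p.
    norm ((1 / card (words k l)) *\<^sub>R (\<Sum>i\<in>words k l. D p (U (v @ i) s)) - drift s p y) \<le> (1 + L\<^sub>D) * err s y)"
  using comparison AE_word_of AE_space
proof eventually_elim
  case (elim y)
  then have y: "y \<in> K" by (simp add: space_\<nu>)
  have s0: "0 \<le> s" using s by simp
  interpret P: prob_space "vlasov_measure \<rho> s y" by (rule prob_vlasov[OF y s0])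
  show ?case
  proof (intro ballI impI allI)
    fix v p assume v: "v \<in> words k m" "y \<in> cell F K v"
    then have word: "v = word_of k F K m y" using elim(2) by blast
    define N where "N = real (card (words k l))"
    define z where "z = (1 / N) *\<^sub>R (\<Sum>i\<in>words k l. D p (U (v @ i) s)) - drift s p y"
    have L: "0 < 1 + L\<^sub>D" using lipschitz_constants_nonneg by simp
    have "norm z \<le> (1 + L\<^sub>D) * err s y"
    proof (cases "z = 0")
      case True
      then show ?thesis using err_range(1)[OF s y] L by simp
    next
      case False
      define h where "h q = (D p q \<bullet> sgn z) / (1 + L\<^sub>D)" for q
      have sgn: "norm (sgn z) = 1" using False by (simp add: norm_sgn)
      have "\<bar>h q\<bar> \<le> 1" for q
      proof -
        have "\<bar>D p q \<bullet> sgn z\<bar> \<le> 1" using Cauchy_Schwarz_ineq2[of "D p q" "sgn z"] D_bound[of p q] sgn by simp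
        then show ?thesis using L lipschitz_constants_nonneg by (simp add: h_def divide_le_eq)
      qed
      moreover have h_lip: "\<bar>h q - h q'\<bar> \<le> norm (q - q')" for q q'
      proof -
        have "\<bar>(D p q - D p q') \<bullet> sgn z\<bar> \<le> L\<^sub>D * norm (q - q')"
          using Cauchy_Schwarz_ineq2[of "D p q - D p q'" "sgn z"] D_lip[of p q p q'] sgn by simp
        also have "\<dots> \<le> norm (q - q') * (1 + L\<^sub>D)" by (simp add: algebra_simps)
        finally have "\<bar>(D p q - D p q') \<bullet> sgn z\<bar> / (1 + L\<^sub>D) \<le> norm (q - q')" using L by (simp add: pos_divide_le_eq)
        moreover have "h q - h q' = ((D p q - D p q') \<bullet> sgn z) / (1 + L\<^sub>D)"
          by (simp add: h_def inner_diff_left diff_divide_distrib)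
        ultimately show ?thesis using L by simp
      qed
      ultimately have "\<bar>(LINT q|local_empirical k F K u m l s y. h q) - (LINT q|vlasov_measure \<rho> s y. h q)\<bar> \<le> err s y"
        using elim(1) s by blast
      moreover have "(LINT q|local_empirical k F K u m l s y. h q) = (\<Sum>i\<in>words k l. h (U (v @ i) s)) / N"
        using integral_local_empirical[OF lipschitz_real_measurable(2)[of h 1]] h_lip s0 by (simp add: U_eq word N_def)
      moreover have "(LINT q|vlasov_measure \<rho> s y. h q) = (drift s p y \<bullet> sgn z) / (1 + L\<^sub>D)"
      proof -
        have "integrable (vlasov_measure \<rho> s y) (D p)"
          by (rule P.integrable_const_bound[where B = 1])
            (use D_bound D_section[of p] in \<open>auto simp: measurable_cong_sets[OF sets_vlasov refl]\<close>)
        then have "(LINT q|vlasov_measure \<rho> s y. D p q \<bullet> sgn z) = (LINT q|vlasov_measure \<rho> s y. D p q) \<bullet> sgn z"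
          by (intro integral_inner_left) simp
        moreover have "(LINT q|vlasov_measure \<rho> s y. D p q) = drift s p y"
          unfolding drift_def by (rule integral_vlasov[OF y s0 D_section])
        ultimately show ?thesis by (simp add: h_def)
      qed
      moreover have "(\<Sum>i\<in>words k l. h (U (v @ i) s)) / N - (drift s p y \<bullet> sgn z) / (1 + L\<^sub>D) = (z \<bullet> sgn z) / (1 + L\<^sub>D)"
        by (simp add: h_def z_def inner_diff_left inner_sum_left sum_divide_distrib diff_divide_distrib mult.commute)
      moreover have "z \<bullet> sgn z = norm z"
        using False by (simp add: sgn_div_norm power2_norm_eq_inner[symmetric] power2_eq_square)
      ultimately have "norm z / (1 + L\<^sub>D) \<le> err s y" using L by simp
      then show ?thesis using L by (simp add: pos_divide_le_eq mult.commute)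
    qed
    then show "norm ((1 / card (words k l)) *\<^sub>R (\<Sum>i\<in>words k l. D p (U (v @ i) s)) - drift s p y) \<le> (1 + L\<^sub>D) * err s y"
      by (simp add: z_def N_def)
  qed
qed

text \<open>\<open>fine_error\<close> and \<open>coarse_error\<close> measure the distance from the averages of \<open>W\<close> over cells of level \<open>m\<close>
to the averages at level \<open>m + l\<close> and to \<open>W\<close> itself.\<close>
definition fine_error :: "nat list \<Rightarrow> nat list \<Rightarrow> real" where
  "fine_error w j = (\<Sum>v\<in>words k m. \<Sum>i\<in>words k l.
     \<bar>cell_average F K \<nu> W (w @ j) (v @ i) - cell_average F K \<nu> W w v\<bar> / real k ^ (m + l))"

definition coarse_error :: "nat list \<Rightarrow> 'a \<Rightarrow> real" where
  "coarse_error w x = (\<Sum>v\<in>words k m. LINT y:cell F K v|\<nu>. \<bar>cell_average F K \<nu> W w v - W (x, y)\<bar>)"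

text \<open>The force on the particle \<open>w @ j\<close> is changed into the interaction at \<open>x\<close> in three steps: averages of \<open>W\<close> at
level \<open>m + l\<close> become averages at level \<open>m\<close>, these become \<open>W(x,y)\<close>, and the empirical measure at \<open>y\<close>
becomes the Vlasov solution.\<close>
lemma gap_le:
  assumes s: "s \<in> {0..T}" and x: "x \<in> K" "(\<integral>\<^sup>+y. ennreal \<bar>W (x, y)\<bar> \<partial>\<nu>) \<le> ennreal C\<^sub>W"
    and w: "w \<in> words k m" and j: "j \<in> words k l"
  shows "gap (w @ j) s x \<le> fine_error w j + coarse_error w x + (1 + L\<^sub>D) * (LINT y|\<nu>. \<bar>W (x, y)\<bar> * err s y)"
proof -
  define p where "p = U (w @ j) s"
  define c where "c = cell_average F K \<nu> W"
  define N where "N = real k ^ (m + l)"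
  define Dm where "Dm v = (1 / card (words k l)) *\<^sub>R (\<Sum>i\<in>words k l. D p (U (v @ i) s))" for v
  have k0: "real k \<noteq> 0" using k_pos by simp
  have Dm1: "norm (Dm v) \<le> 1" for v
  proof -
    have "norm (\<Sum>i\<in>words k l. D p (U (v @ i) s)) \<le> (\<Sum>i\<in>words k l. 1)" by (rule sum_norm_le) (rule D_bound)
    then show ?thesis using card_words_pos by (simp add: Dm_def divide_le_eq)
  qed
  have len: "length (w @ j) = m + l" using w j by (simp add: words_def)
  have "force (w @ j) s = (\<Sum>v\<in>words k m. \<Sum>i\<in>words k l. (c (w @ j) (v @ i) / N) *\<^sub>R D p (U (v @ i) s))"
    unfolding force_def len sum_words_append by (simp add: c_def N_def p_def)
  also have "\<dots> = (\<Sum>v\<in>words k m. (\<Sum>i\<in>words k l. ((c (w @ j) (v @ i) - c w v) / N) *\<^sub>R D p (U (v @ i) s))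
      + (c w v / real k ^ m) *\<^sub>R Dm v)"
  proof (rule sum.cong[OF refl])
    fix v
    have "(c w v / real k ^ m) *\<^sub>R Dm v = (\<Sum>i\<in>words k l. (c w v / N) *\<^sub>R D p (U (v @ i) s))"
      by (simp add: Dm_def N_def card_words scaleR_sum_right power_add)
    then show "(\<Sum>i\<in>words k l. (c (w @ j) (v @ i) / N) *\<^sub>R D p (U (v @ i) s)) =
        (\<Sum>i\<in>words k l. ((c (w @ j) (v @ i) - c w v) / N) *\<^sub>R D p (U (v @ i) s)) + (c w v / real k ^ m) *\<^sub>R Dm v"
      by (simp add: sum.distrib[symmetric] scaleR_add_left[symmetric] diff_divide_distrib)
  qed
  also have "\<dots> = (\<Sum>v\<in>words k m. \<Sum>i\<in>words k l. ((c (w @ j) (v @ i) - c w v) / N) *\<^sub>R D p (U (v @ i) s))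
      + (\<Sum>v\<in>words k m. (c w v / real k ^ m) *\<^sub>R Dm v)" by (rule sum.distrib)
  finally have force_eq: "force (w @ j) s = (\<Sum>v\<in>words k m. \<Sum>i\<in>words k l. ((c (w @ j) (v @ i) - c w v) / N) *\<^sub>R D p (U (v @ i) s))
      + (\<Sum>v\<in>words k m. (c w v / real k ^ m) *\<^sub>R Dm v)" .
  have fine: "norm (\<Sum>v\<in>words k m. \<Sum>i\<in>words k l. ((c (w @ j) (v @ i) - c w v) / N) *\<^sub>R D p (U (v @ i) s)) \<le> fine_error w j"
    unfolding fine_error_def
  proof (intro sum_norm_le)
    fix v i
    show "norm (((c (w @ j) (v @ i) - c w v) / N) *\<^sub>R D p (U (v @ i) s))
        \<le> \<bar>cell_average F K \<nu> W (w @ j) (v @ i) - cell_average F K \<nu> W w v\<bar> / real k ^ (m + l)"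
      using mult_left_mono[OF D_bound[of p "U (v @ i) s"], of "\<bar>c (w @ j) (v @ i) - c w v\<bar> / N"]
      by (simp add: c_def N_def abs_mult)
  qed
  have Wrow: "integrable \<nu> (\<lambda>y. W (x, y))" by (rule row_integrable[OF x])
  have Wdrift: "integrable \<nu> (\<lambda>y. W (x, y) *\<^sub>R drift s p y)" by (rule row_weighted(1)[OF x drift_section drift_bound])
  have Werr: "integrable \<nu> (\<lambda>y. W (x, y) *\<^sub>R err s y)"
    by (rule row_weighted(1)[OF x err_measurable, of s err_cap]) (use err_range[OF s] in auto)
  have Werr': "integrable \<nu> (\<lambda>y. \<bar>W (x, y)\<bar> * err s y)"
  proof -
    have "integrable \<nu> (\<lambda>y. norm (W (x, y) *\<^sub>R err s y))" by (rule integrable_norm[OF Werr])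
    moreover have "integrable \<nu> (\<lambda>y. norm (W (x, y) *\<^sub>R err s y)) \<longleftrightarrow> integrable \<nu> (\<lambda>y. \<bar>W (x, y)\<bar> * err s y)"
      by (rule Bochner_Integration.integrable_cong) (use err_range(1)[OF s] in \<open>auto simp: space_\<nu> abs_mult\<close>)
    ultimately show ?thesis by simp
  qed
  let ?b = "\<lambda>v y. \<bar>c w v - W (x, y)\<bar> + (1 + L\<^sub>D) * (\<bar>W (x, y)\<bar> * err s y)"
  have cell_le: "norm ((c w v / real k ^ m) *\<^sub>R Dm v - (LINT y:cell F K v|\<nu>. W (x, y) *\<^sub>R drift s p y))
      \<le> (LINT y:cell F K v|\<nu>. \<bar>c w v - W (x, y)\<bar>) + (1 + L\<^sub>D) * (LINT y:cell F K v|\<nu>. \<bar>W (x, y)\<bar> * err s y)"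
    if v: "v \<in> words k m" for v
  proof -
    have ind: "set_integrable \<nu> (cell F K v) G" if "integrable \<nu> G" for G :: "'a \<Rightarrow> 'z::{banach, second_countable_topology}"
      unfolding set_integrable_def by (rule integrable_mult_indicator[OF cell_sets[OF v] that])
    have "(LINT y:cell F K v|\<nu>. c w v *\<^sub>R Dm v) = (c w v / real k ^ m) *\<^sub>R Dm v"
    proof -
      have "(LINT y|\<nu>. indicat_real (cell F K v) y *\<^sub>R (c w v *\<^sub>R Dm v))
          = (LINT y|\<nu>. indicat_real (cell F K v) y) *\<^sub>R (c w v *\<^sub>R Dm v)"
        by (rule integral_scaleR_left) (rule integrable_indicator_\<nu>[OF cell_sets[OF v]])
      then show ?thesis
        unfolding set_lebesgue_integral_def using cells[OF v] cell_sets[OF v]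
        by (simp only:) (simp add: divide_inverse mult.commute)
    qed
    then have "(c w v / real k ^ m) *\<^sub>R Dm v - (LINT y:cell F K v|\<nu>. W (x, y) *\<^sub>R drift s p y)
        = (LINT y:cell F K v|\<nu>. c w v *\<^sub>R Dm v - W (x, y) *\<^sub>R drift s p y)"
      using set_integral_diff(2)[OF ind[of "\<lambda>_. c w v *\<^sub>R Dm v"] ind[OF Wdrift]] by simp
    also have "norm \<dots> \<le> (LINT y:cell F K v|\<nu>. norm (c w v *\<^sub>R Dm v - W (x, y) *\<^sub>R drift s p y))"
      by (rule set_integral_norm_bound[OF ind]) (use Wdrift in simp)
    also have "\<dots> \<le> (LINT y:cell F K v|\<nu>. ?b v y)"
      unfolding set_lebesgue_integral_def
    proof (rule integral_mono_AE)
      show "integrable \<nu> (\<lambda>y. indicat_real (cell F K v) y *\<^sub>R norm (c w v *\<^sub>R Dm v - W (x, y) *\<^sub>R drift s p y))"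
        by (rule ind[unfolded set_integrable_def]) (use Wdrift in \<open>auto intro!: integrable_norm\<close>)
      show "integrable \<nu> (\<lambda>y. indicat_real (cell F K v) y *\<^sub>R ?b v y)"
        by (rule ind[unfolded set_integrable_def]) (use Wrow Werr' in auto)
      show "AE y in \<nu>. indicat_real (cell F K v) y *\<^sub>R norm (c w v *\<^sub>R Dm v - W (x, y) *\<^sub>R drift s p y)
          \<le> indicat_real (cell F K v) y *\<^sub>R ?b v y"
        using drift_close[OF s]
      proof eventually_elim
        case (elim y)
        show ?case
        proof (cases "y \<in> cell F K v")
          case True
          then have close: "norm (Dm v - drift s p y) \<le> (1 + L\<^sub>D) * err s y" using elim v unfolding Dm_def by blast
          \<comment> \<open>First the averaged kernel is replaced by \<open>W\<close>, then the empirical measure by the Vlasov solution.\<close>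
          have "c w v *\<^sub>R Dm v - W (x, y) *\<^sub>R drift s p y = (c w v - W (x, y)) *\<^sub>R Dm v + W (x, y) *\<^sub>R (Dm v - drift s p y)"
            by (simp add: algebra_simps)
          also have "norm \<dots> \<le> \<bar>c w v - W (x, y)\<bar> * norm (Dm v) + \<bar>W (x, y)\<bar> * norm (Dm v - drift s p y)"
            using norm_triangle_ineq[of "(c w v - W (x, y)) *\<^sub>R Dm v" "W (x, y) *\<^sub>R (Dm v - drift s p y)"] by simp
          also have "\<dots> \<le> \<bar>c w v - W (x, y)\<bar> * 1 + \<bar>W (x, y)\<bar> * ((1 + L\<^sub>D) * err s y)"
            by (intro add_mono mult_left_mono Dm1 close) auto
          finally show ?thesis using True by (simp add: mult_ac)
        qed simp
      qed
    qed
    also have "\<dots> = (LINT y:cell F K v|\<nu>. \<bar>c w v - W (x, y)\<bar>) + (LINT y:cell F K v|\<nu>. (1 + L\<^sub>D) * (\<bar>W (x, y)\<bar> * err s y))"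
      by (rule set_integral_add(2)) (use Wrow Werr' in \<open>auto intro!: ind\<close>)
    finally show ?thesis by simp
  qed
  have "norm ((\<Sum>v\<in>words k m. (c w v / real k ^ m) *\<^sub>R Dm v) - interaction x s p)
      = norm (\<Sum>v\<in>words k m. (c w v / real k ^ m) *\<^sub>R Dm v - (LINT y:cell F K v|\<nu>. W (x, y) *\<^sub>R drift s p y))"
    unfolding interaction_def integral_cell_decomposition[OF Wdrift, of m] sum_subtractf ..
  also have "\<dots> \<le> (\<Sum>v\<in>words k m. (LINT y:cell F K v|\<nu>. \<bar>c w v - W (x, y)\<bar>)
      + (1 + L\<^sub>D) * (LINT y:cell F K v|\<nu>. \<bar>W (x, y)\<bar> * err s y))"
    by (rule sum_norm_le) (rule cell_le)
  also have "\<dots> = coarse_error w x + (1 + L\<^sub>D) * (LINT y|\<nu>. \<bar>W (x, y)\<bar> * err s y)"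
    unfolding integral_cell_decomposition[OF Werr', of m]
    by (simp add: sum.distrib coarse_error_def c_def sum_distrib_left)
  finally have coarse: "norm ((\<Sum>v\<in>words k m. (c w v / real k ^ m) *\<^sub>R Dm v) - interaction x s p)
      \<le> coarse_error w x + (1 + L\<^sub>D) * (LINT y|\<nu>. \<bar>W (x, y)\<bar> * err s y)" .
  have "gap (w @ j) s x \<le> norm (\<Sum>v\<in>words k m. \<Sum>i\<in>words k l. ((c (w @ j) (v @ i) - c w v) / N) *\<^sub>R D p (U (v @ i) s))
      + norm ((\<Sum>v\<in>words k m. (c w v / real k ^ m) *\<^sub>R Dm v) - interaction x s p)"
    unfolding gap_def force_eq p_def[symmetric] add_diff_eq[symmetric] by (rule norm_triangle_ineq)
  then show ?thesis using fine coarse by linarith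
qed

lemma integrable_W_shift: "integrable (\<nu> \<Otimes>\<^sub>M \<nu>) (\<lambda>z. \<bar>W z - r\<bar>)"
proof -
  have "integrable (\<nu> \<Otimes>\<^sub>M \<nu>) (\<lambda>_. r)" by (rule pair.integrable_const)
  then show ?thesis using integrable_W by (intro integrable_abs Bochner_Integration.integrable_diff)
qed

lemma deviation_as_double_sum:
  "pair.deviation m W = (\<Sum>w\<in>words k m. \<Sum>v\<in>words k m.
    LINT z:cell F K w \<times> cell F K v|(\<nu> \<Otimes>\<^sub>M \<nu>). \<bar>W z - cell_average F K \<nu> W w v\<bar>)"
  unfolding pair.deviation_def sum.cartesian_product
  by (rule sum.cong) (auto simp: cell_average_eq_average[of _ m _ m])

text \<open>An average over a product of subcells differs from a constant by at most the average of the difference,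
and the subcells of a cell are almost disjoint.\<close>
lemma fine_error_le:
  "(\<Sum>w\<in>words k m. ((\<Sum>j\<in>words k l. fine_error w j) / card (words k l)) / real k ^ m) \<le> pair.deviation m W"
proof -
  define N where "N = real k ^ (m + l)"
  let ?c = "cell_average F K \<nu> W"
  let ?I = "\<lambda>a b w v. LINT z:cell F K a \<times> cell F K b|(\<nu> \<Otimes>\<^sub>M \<nu>). \<bar>W z - ?c w v\<bar>"
  have N: "0 < N" using k_pos by (simp add: N_def)
  have one: "\<bar>?c a b - r\<bar> / N / N \<le> (LINT z:cell F K a \<times> cell F K b|(\<nu> \<Otimes>\<^sub>M \<nu>). \<bar>W z - r\<bar>)"
    if ab: "a \<in> words k (m + l)" "b \<in> words k (m + l)" for a b r
  proof -
    let ?A = "cell F K a \<times> cell F K b"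
    have A: "?A \<in> sets (\<nu> \<Otimes>\<^sub>M \<nu>)" using cell_sets[OF ab(1)] cell_sets[OF ab(2)] by simp
    have mA: "measure (\<nu> \<Otimes>\<^sub>M \<nu>) ?A = 1 / N / N" by (simp add: measure_cell_pair[OF ab] cells[OF ab(1)] cells[OF ab(2)] N_def)
    have "(LINT z:?A|(\<nu> \<Otimes>\<^sub>M \<nu>). W z - r) = (LINT z:?A|(\<nu> \<Otimes>\<^sub>M \<nu>). W z) - (LINT z:?A|(\<nu> \<Otimes>\<^sub>M \<nu>). r)"
      by (rule set_integral_diff(2)) (auto intro!: pair.set_int integrable_W A)
    also have "\<dots> = (?c a b - r) / N / N"
      unfolding cell_average_eq_average[OF ab] pair.average_def pair.set_lint_const[OF A] mA
      using N by (simp add: divide_simps)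
    finally have "\<bar>?c a b - r\<bar> / N / N = \<bar>LINT z:?A|(\<nu> \<Otimes>\<^sub>M \<nu>). W z - r\<bar>" using N by simp
    also have "\<dots> \<le> (LINT z:?A|(\<nu> \<Otimes>\<^sub>M \<nu>). \<bar>W z - r\<bar>)"
      using set_integral_norm_bound[of "\<nu> \<Otimes>\<^sub>M \<nu>" ?A "\<lambda>z. W z - r"] integrable_W
      by (simp add: pair.set_int A)
    finally show ?thesis .
  qed
  have children: "(\<Sum>j\<in>words k l. \<Sum>i\<in>words k l. ?I (w @ j) (v @ i) w v) \<le> ?I w v w v"
    if wv: "w \<in> words k m" "v \<in> words k m" for w v
  proof -
    let ?h = "\<lambda>z. \<bar>W z - ?c w v\<bar>"
    have sets: "cell F K a \<times> cell F K b \<in> sets (\<nu> \<Otimes>\<^sub>M \<nu>)" if "a \<in> words k n" "b \<in> words k n" for a b n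
      using cell_sets[OF that(1)] cell_sets[OF that(2)] by simp
    have int: "integrable (\<nu> \<Otimes>\<^sub>M \<nu>) (\<lambda>z. indicat_real (cell F K a \<times> cell F K b) z *\<^sub>R ?h z)"
      if "a \<in> words k n" "b \<in> words k n" for a b n
      by (rule integrable_mult_indicator[OF sets[OF that] integrable_W_shift])
    have int': "integrable (\<nu> \<Otimes>\<^sub>M \<nu>) (\<lambda>z. \<Sum>j\<in>words k l. \<Sum>i\<in>words k l.
        indicat_real (cell F K (w @ j) \<times> cell F K (v @ i)) z *\<^sub>R ?h z)"
      by (intro Bochner_Integration.integrable_sum int[of _ "m + l"] words_append wv)
    have "(\<Sum>j\<in>words k l. \<Sum>i\<in>words k l. ?I (w @ j) (v @ i) w v) =
        (LINT z|(\<nu> \<Otimes>\<^sub>M \<nu>). (\<Sum>j\<in>words k l. \<Sum>i\<in>words k l.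
          indicat_real (cell F K (w @ j) \<times> cell F K (v @ i)) z *\<^sub>R ?h z))"
      unfolding set_lebesgue_integral_def
      by (subst Bochner_Integration.integral_sum,
          intro Bochner_Integration.integrable_sum int[of _ "m + l"] words_append wv, assumption, assumption,
          intro sum.cong refl, subst Bochner_Integration.integral_sum,
          intro int[of _ "m + l"] words_append wv, assumption, assumption, rule refl)
    also have "\<dots> \<le> ?I w v w v"
      unfolding set_lebesgue_integral_def
    proof (rule integral_mono_AE[OF int' int[OF wv]])
      show "AE z in \<nu> \<Otimes>\<^sub>M \<nu>. (\<Sum>j\<in>words k l. \<Sum>i\<in>words k l.
          indicat_real (cell F K (w @ j) \<times> cell F K (v @ i)) z *\<^sub>R ?h z)
          \<le> indicat_real (cell F K w \<times> cell F K v) z *\<^sub>R ?h z"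
        using AE_fst_snd[OF AE_children_le[of m l]]
      proof eventually_elim
        case (elim z)
        have "(\<Sum>j\<in>words k l. \<Sum>i\<in>words k l. indicat_real (cell F K (w @ j) \<times> cell F K (v @ i)) z *\<^sub>R ?h z)
          = ((\<Sum>j\<in>words k l. indicat_real (cell F K (w @ j)) (fst z)) * (\<Sum>i\<in>words k l. indicat_real (cell F K (v @ i)) (snd z))) * ?h z"
          unfolding sum_product sum_distrib_right
          by (intro sum.cong refl) (auto simp: indicator_def mem_Times_iff)
        also have "\<dots> \<le> (indicat_real (cell F K w) (fst z) * indicat_real (cell F K v) (snd z)) * ?h z"
          using elim wv by (intro mult_right_mono mult_mono) (auto intro!: sum_nonneg)
        also have "\<dots> = indicat_real (cell F K w \<times> cell F K v) z *\<^sub>R ?h z"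
          by (auto simp: indicator_def mem_Times_iff)
        finally show ?case .
      qed
    qed
    finally show ?thesis .
  qed
  have "(\<Sum>w\<in>words k m. ((\<Sum>j\<in>words k l. fine_error w j) / card (words k l)) / real k ^ m) =
      (\<Sum>w\<in>words k m. \<Sum>j\<in>words k l. \<Sum>v\<in>words k m. \<Sum>i\<in>words k l. \<bar>?c (w @ j) (v @ i) - ?c w v\<bar> / N / N)"
    by (simp add: fine_error_def N_def sum_divide_distrib card_words power_add mult_ac)
  also have "\<dots> \<le> (\<Sum>w\<in>words k m. \<Sum>j\<in>words k l. \<Sum>v\<in>words k m. \<Sum>i\<in>words k l. ?I (w @ j) (v @ i) w v)"
    by (intro sum_mono one words_append)
  also have "\<dots> = (\<Sum>w\<in>words k m. \<Sum>v\<in>words k m. \<Sum>j\<in>words k l. \<Sum>i\<in>words k l. ?I (w @ j) (v @ i) w v)"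
    by (intro sum.cong refl sum.swap)
  also have "\<dots> \<le> (\<Sum>w\<in>words k m. \<Sum>v\<in>words k m. ?I w v w v)" by (intro sum_mono children)
  finally show ?thesis by (simp add: deviation_as_double_sum)
qed

end

context mean_field_level
begin

lemma pair_integrals:
  fixes G :: "'a \<times> 'a \<Rightarrow> real"
  assumes "integrable (\<nu> \<Otimes>\<^sub>M \<nu>) G"
  shows "integrable \<nu> (\<lambda>x. LINT y|\<nu>. G (x, y))"
    and "(LINT x|\<nu>. LINT y|\<nu>. G (x, y)) = (LINT z|(\<nu> \<Otimes>\<^sub>M \<nu>). G z)"
    and "(LINT y|\<nu>. LINT x|\<nu>. G (x, y)) = (LINT z|(\<nu> \<Otimes>\<^sub>M \<nu>). G z)"
    and "integrable \<nu> (\<lambda>y. LINT x|\<nu>. G (x, y))"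
proof -
  interpret pp: pair_sigma_finite \<nu> \<nu> ..
  show "integrable \<nu> (\<lambda>x. LINT y|\<nu>. G (x, y))" by (rule pp.integrable_fst'[OF assms])
  show "(LINT x|\<nu>. LINT y|\<nu>. G (x, y)) = (LINT z|(\<nu> \<Otimes>\<^sub>M \<nu>). G z)" by (rule pp.integral_fst'[OF assms])
  show "(LINT y|\<nu>. LINT x|\<nu>. G (x, y)) = (LINT z|(\<nu> \<Otimes>\<^sub>M \<nu>). G z)"
    using pp.integral_snd[of "\<lambda>x y. G (x, y)"] assms by simp
  show "integrable \<nu> (\<lambda>y. LINT x|\<nu>. G (x, y))"
    using pp.integrable_snd[of "\<lambda>x y. G (x, y)"] assms by simp
qed

lemma coarse_error_integral:
  shows "integrable \<nu> (\<lambda>x. \<Sum>w\<in>words k m. indicator (cell F K w) x * coarse_error w x)"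
    and "(LINT x|\<nu>. (\<Sum>w\<in>words k m. indicator (cell F K w) x * coarse_error w x)) = pair.deviation m W"
proof -
  let ?c = "cell_average F K \<nu> W"
  let ?G = "\<lambda>w v z. indicat_real (cell F K w \<times> cell F K v) z *\<^sub>R \<bar>W z - ?c w v\<bar>"
  have int: "integrable (\<nu> \<Otimes>\<^sub>M \<nu>) (?G w v)" if "w \<in> words k m" "v \<in> words k m" for w v
    by (rule integrable_mult_indicator[OF _ integrable_W_shift]) (use cell_sets[OF that(1)] cell_sets[OF that(2)] in simp)
  have eq: "(\<Sum>w\<in>words k m. indicator (cell F K w) x * coarse_error w x)
      = (\<Sum>w\<in>words k m. \<Sum>v\<in>words k m. LINT y|\<nu>. ?G w v (x, y))" for x
  proof (rule sum.cong[OF refl])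
    fix w
    have "(LINT y|\<nu>. ?G w v (x, y)) = indicator (cell F K w) x * (LINT y:cell F K v|\<nu>. \<bar>?c w v - W (x, y)\<bar>)" for v
      by (cases "x \<in> cell F K w") (auto simp: set_lebesgue_integral_def indicator_def abs_minus_commute)
    then show "indicator (cell F K w) x * coarse_error w x = (\<Sum>v\<in>words k m. LINT y|\<nu>. ?G w v (x, y))"
      by (simp add: coarse_error_def sum_distrib_left)
  qed
  show "integrable \<nu> (\<lambda>x. \<Sum>w\<in>words k m. indicator (cell F K w) x * coarse_error w x)"
    unfolding eq by (intro Bochner_Integration.integrable_sum pair_integrals(1) int)
  have "(LINT x|\<nu>. (\<Sum>w\<in>words k m. \<Sum>v\<in>words k m. LINT y|\<nu>. ?G w v (x, y)))
      = (\<Sum>w\<in>words k m. LINT x|\<nu>. (\<Sum>v\<in>words k m. LINT y|\<nu>. ?G w v (x, y)))"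
    by (rule Bochner_Integration.integral_sum) (intro Bochner_Integration.integrable_sum pair_integrals(1) int)
  also have "\<dots> = (\<Sum>w\<in>words k m. \<Sum>v\<in>words k m. LINT x|\<nu>. LINT y|\<nu>. ?G w v (x, y))"
    by (rule sum.cong[OF refl], rule Bochner_Integration.integral_sum) (intro pair_integrals(1) int)
  also have "\<dots> = (\<Sum>w\<in>words k m. \<Sum>v\<in>words k m. LINT z|(\<nu> \<Otimes>\<^sub>M \<nu>). ?G w v z)"
    by (intro sum.cong refl pair_integrals(2) int)
  finally show "(LINT x|\<nu>. (\<Sum>w\<in>words k m. indicator (cell F K w) x * coarse_error w x)) = pair.deviation m W"
    unfolding eq by (simp add: deviation_as_double_sum set_lebesgue_integral_def)
qed

text \<open>This is where the bound on the columns of \<open>W\<close> enters.\<close>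
lemma weighted_error_integral:
  assumes s: "s \<in> {0..T}"
  shows "integrable \<nu> (\<lambda>x. LINT y|\<nu>. \<bar>W (x, y)\<bar> * err s y)"
    and "(LINT x|\<nu>. LINT y|\<nu>. \<bar>W (x, y)\<bar> * err s y) \<le> C\<^sub>W * (LINT y|\<nu>. err s y)"
proof -
  let ?G = "\<lambda>z. \<bar>W z\<bar> * err s (snd z)"
  have int: "integrable (\<nu> \<Otimes>\<^sub>M \<nu>) ?G"
  proof (rule Bochner_Integration.integrable_bound)
    show "integrable (\<nu> \<Otimes>\<^sub>M \<nu>) (\<lambda>z. \<bar>W z\<bar> * err_cap)"
      by (intro integrable_mult_left integrable_abs integrable_W)
    show "?G \<in> borel_measurable (\<nu> \<Otimes>\<^sub>M \<nu>)"
      by (intro borel_measurable_times borel_measurable_abs W_meas measurable_compose[OF measurable_snd err_measurable])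
    show "AE z in \<nu> \<Otimes>\<^sub>M \<nu>. norm (?G z) \<le> norm (\<bar>W z\<bar> * err_cap)"
    proof (rule AE_I2)
      fix z assume "z \<in> space (\<nu> \<Otimes>\<^sub>M \<nu>)"
      then have "snd z \<in> K" by (auto simp: space_pair_measure space_\<nu>)
      then show "norm (?G z) \<le> norm (\<bar>W z\<bar> * err_cap)"
        using err_range[OF s, of "snd z"] err_cap_nonneg by (simp add: abs_mult mult_left_mono)
    qed
  qed
  show "integrable \<nu> (\<lambda>x. LINT y|\<nu>. \<bar>W (x, y)\<bar> * err s y)" using pair_integrals(1)[OF int] by simp
  have "(LINT x|\<nu>. LINT y|\<nu>. \<bar>W (x, y)\<bar> * err s y) = (LINT y|\<nu>. LINT x|\<nu>. \<bar>W (x, y)\<bar> * err s y)"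
    using pair_integrals(2,3)[OF int] by simp
  also have "\<dots> \<le> (LINT y|\<nu>. C\<^sub>W * err s y)"
  proof (rule integral_mono_AE)
    show "integrable \<nu> (\<lambda>y. LINT x|\<nu>. \<bar>W (x, y)\<bar> * err s y)" using pair_integrals(4)[OF int] by simp
    show "integrable \<nu> (\<lambda>y. C\<^sub>W * err s y)" using err_integrable[OF s] by simp
    show "AE y in \<nu>. (LINT x|\<nu>. \<bar>W (x, y)\<bar> * err s y) \<le> C\<^sub>W * err s y"
      using kernel_column_bound AE_space
    proof eventually_elim
      case (elim y)
      then have y: "y \<in> K" by (simp add: space_\<nu>)
      show ?case using mult_right_mono[OF column_le[OF y elim(1)] err_range(1)[OF s y]] by simp
    qed
  qed
  also have "\<dots> = C\<^sub>W * (LINT y|\<nu>. err s y)" by simp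
  finally show "(LINT x|\<nu>. LINT y|\<nu>. \<bar>W (x, y)\<bar> * err s y) \<le> C\<^sub>W * (LINT y|\<nu>. err s y)" .
qed

text \<open>Both kinds of averaging error contribute one deviation each.\<close>
lemma mean_gap_le:
  assumes s: "s \<in> {0..T}"
  shows "mean_gap s \<le> 2 * pair.deviation m W + (1 + L\<^sub>D) * (C\<^sub>W * (LINT y|\<nu>. err s y))"
proof -
  let ?f = "\<lambda>w. (\<Sum>j\<in>words k l. fine_error w j) / card (words k l)"
  let ?X = "\<lambda>x. \<Sum>w\<in>words k m. indicat_real (cell F K w) x * ?f w"
  let ?Y = "\<lambda>x. \<Sum>w\<in>words k m. indicat_real (cell F K w) x * coarse_error w x"
  let ?Z = "\<lambda>x. LINT y|\<nu>. \<bar>W (x, y)\<bar> * err s y"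
  have X: "integrable \<nu> ?X"
    by (intro Bochner_Integration.integrable_sum integrable_mult_left integrable_indicator_\<nu> cell_sets)
  note Y = coarse_error_integral and Z = weighted_error_integral[OF s]
  have LD: "0 \<le> 1 + L\<^sub>D" using lipschitz_constants_nonneg by simp
  have "mean_gap s \<le> (LINT x|\<nu>. ?X x + ?Y x + (1 + L\<^sub>D) * ?Z x)"
    unfolding mean_gap_def
  proof (rule integral_mono_AE[OF total_gap_integrable])
    show "integrable \<nu> (\<lambda>x. ?X x + ?Y x + (1 + L\<^sub>D) * ?Z x)"
      by (intro Bochner_Integration.integrable_add integrable_mult_right X Y(1) Z(1))
    show "AE x in \<nu>. total_gap s x \<le> ?X x + ?Y x + (1 + L\<^sub>D) * ?Z x"
      using AE_total_gap AE_word_of kernel_row_bound AE_space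
    proof eventually_elim
      case (elim x)
      then have x: "x \<in> K" by (simp add: space_\<nu>)
      let ?w = "word_of k F K m x" and ?N = "real (card (words k l))"
      have "?X x = ?f ?w" by (rule sum_cells_eq_word_of[where G = ?f]) (use elim x in auto)
      moreover have "?Y x = coarse_error ?w x"
        by (rule sum_cells_eq_word_of[where G = "\<lambda>w. coarse_error w x"]) (use elim x in auto)
      moreover have "total_gap s x \<le> (\<Sum>j\<in>words k l. fine_error ?w j + (coarse_error ?w x + (1 + L\<^sub>D) * ?Z x)) / ?N"
        unfolding elim(1)[rule_format]
        by (intro divide_right_mono sum_mono)
          (use gap_le[OF s x elim(3) word_of_cell(1)[OF x]] in \<open>auto simp: add.assoc\<close>)
      moreover have "\<dots> = ?f ?w + (coarse_error ?w x + (1 + L\<^sub>D) * ?Z x)"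
        using card_words_pos by (auto simp: sum.distrib add_divide_distrib)
      ultimately show ?case by simp
    qed
  qed
  also have "\<dots> = (LINT x|\<nu>. ?X x) + (LINT x|\<nu>. ?Y x) + (1 + L\<^sub>D) * (LINT x|\<nu>. ?Z x)"
    using X Y(1) Z(1) by simp
  also have "(LINT x|\<nu>. ?X x) = (\<Sum>w\<in>words k m. ?f w / real k ^ m)"
  proof -
    have "(LINT x|\<nu>. ?X x) = (\<Sum>w\<in>words k m. LINT x|\<nu>. indicat_real (cell F K w) x * ?f w)"
      by (rule Bochner_Integration.integral_sum) (intro integrable_mult_left integrable_indicator_\<nu> cell_sets)
    also have "\<dots> = (\<Sum>w\<in>words k m. ?f w / real k ^ m)"
      by (rule sum.cong) (auto simp: cells cell_sets)
    finally show ?thesis .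
  qed
  also have "(\<Sum>w\<in>words k m. ?f w / real k ^ m) + (LINT x|\<nu>. ?Y x) + (1 + L\<^sub>D) * (LINT x|\<nu>. ?Z x)
      \<le> pair.deviation m W + pair.deviation m W + (1 + L\<^sub>D) * (C\<^sub>W * (LINT y|\<nu>. err s y))"
    by (intro add_mono fine_error_le mult_left_mono Z(2) LD eq_refl[OF Y(2)])
  finally show ?thesis by simp
qed

definition coupling :: real where "coupling = (1 + L\<^sub>D) * C\<^sub>W * growth"

lemma coupling_nonneg: "0 \<le> coupling"
  using lipschitz_constants_nonneg C\<^sub>W_nonneg growth_pos by (simp add: coupling_def)

theorem level_estimate:
  assumes t: "t \<in> {0..T}"
  shows "(\<integral>\<^sup>+x. d_BL (local_empirical k F K u m l t x) (vlasov_measure \<rho> t x) \<partial>\<nu>) \<le>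
    ennreal (growth * ((LINT x|\<nu>. d x) + T * (2 * (2 * pair.deviation m W + coupling * (LINT x|\<nu>. d x))
      * exp ((2 * coupling + 1) * T))))"
proof -
  let ?a = "2 * pair.deviation m W + coupling * (LINT x|\<nu>. d x)"
  have d0: "0 \<le> (LINT x|\<nu>. d x)" by (rule Bochner_Integration.integral_nonneg) (use d_range in \<open>simp add: space_\<nu>\<close>)
  have a0: "0 \<le> ?a" using pair.deviation_nonneg[of m W] coupling_nonneg d0 by simp
  have gronwall: "mean_gap s \<le> 2 * ?a * exp ((2 * coupling + 1) * T)" if "s \<in> {0..T}" for s
  proof (rule gronwall_integral[OF mean_gap_measurable mean_gap_range a0 coupling_nonneg _ that])
    show "mean_gap s \<le> ?a + coupling * (LINT r:{0..s}|lborel. mean_gap r)" if "s \<in> {0..T}" for s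
      using mean_gap_le[OF that] unfolding mean_err[OF that] by (simp add: coupling_def algebra_simps)
  qed
  have "(\<integral>\<^sup>+x. d_BL (local_empirical k F K u m l t x) (vlasov_measure \<rho> t x) \<partial>\<nu>) \<le> (\<integral>\<^sup>+x. ennreal (err t x) \<partial>\<nu>)"
    by (rule nn_integral_mono_AE) (use d_BL_le_err t in \<open>auto elim: eventually_mono\<close>)
  also have "\<dots> = ennreal (LINT x|\<nu>. err t x)"
    by (rule nn_integral_eq_integral[OF err_integrable[OF t]]) (use err_range(1)[OF t] in \<open>auto simp: space_\<nu> intro!: AE_I2\<close>)
  also have "\<dots> \<le> ennreal (growth * ((LINT x|\<nu>. d x) + T * (2 * ?a * exp ((2 * coupling + 1) * T))))"
  proof (rule ennreal_leI)
    have "norm (LINT s:{0..t}|lborel. mean_gap s) \<le> (t - 0) * (2 * ?a * exp ((2 * coupling + 1) * T))"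
      by (rule set_integral_interval_bound) (use t gronwall mean_gap_range in auto)
    also have "\<dots> \<le> T * (2 * ?a * exp ((2 * coupling + 1) * T))"
      using t a0 by (intro mult_right_mono) auto
    finally show "(LINT x|\<nu>. err t x) \<le> growth * ((LINT x|\<nu>. d x) + T * (2 * ?a * exp ((2 * coupling + 1) * T)))"
      unfolding mean_err[OF t] using growth_pos by (intro mult_left_mono add_left_mono) auto
  qed
  finally show ?thesis .
qed

end

context mean_field
begin

theorem mean_field_limit:
  assumes init: "AE x in \<nu>. weakly_converges
                 (\<lambda>(m, l). local_empirical k F K u m l 0 x) (vlasov_measure \<rho> 0 x)
                 (sequentially \<times>\<^sub>F sequentially)"
    and \<epsilon>: "0 < \<epsilon>" and T: "0 < T"
  shows "\<exists>N. \<forall>m\<ge>N. \<forall>l\<ge>N.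
           (SUP t\<in>{0..T}. \<integral>\<^sup>+x. d_BL (local_empirical k F K u m l t x) (vlasov_measure \<rho> t x) \<partial>\<nu>)
             < ennreal \<epsilon>"
proof -
  define growth where "growth = exp (L\<^sub>V * T)"
  define coupling where "coupling = (1 + L\<^sub>D) * C\<^sub>W * growth"
  \<comment> \<open>If \<open>\<eta>\<close> bounds the initial error and the deviation, then \<open>A * \<eta>\<close> bounds the right-hand side of the
    level estimate.\<close>
  define A where "A = growth * (1 + T * (2 * (2 + coupling) * exp ((2 * coupling + 1) * T)))"
  have g: "0 < growth" "0 \<le> coupling"
    using lipschitz_constants_nonneg C\<^sub>W_nonneg by (auto simp: growth_def coupling_def)
  have A: "0 < A" unfolding A_def using g T by (intro mult_pos_pos add_pos_nonneg) auto
  define \<eta> where "\<eta> = \<epsilon> / (2 * A)"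
  have \<eta>: "0 < \<eta>" "A * \<eta> = \<epsilon> / 2" using A \<epsilon> by (auto simp: \<eta>_def)
  have meas0: "(\<lambda>x. LINT v|vlasov_measure \<rho> 0 x. h v) \<in> borel_measurable \<nu>" if "continuous_on UNIV h" for h :: "'b \<Rightarrow> real"
  proof -
    have h [measurable]: "h \<in> borel_measurable borel" by (rule borel_measurable_continuous_onI[OF that])
    have "(\<lambda>(x, v). dens 0 v x *\<^sub>R h v) \<in> borel_measurable (\<nu> \<Otimes>\<^sub>M lborel)"
      unfolding split_beta by (intro borel_measurable_scaleR dens_measurable measurable_fst) auto
    then have "(\<lambda>x. LINT v|lborel. dens 0 v x *\<^sub>R h v) \<in> borel_measurable \<nu>"
      by (rule lborel.borel_measurable_lebesgue_integral)
    moreover have "(\<lambda>x. LINT v|vlasov_measure \<rho> 0 x. h v) \<in> borel_measurable \<nu> \<longleftrightarrow>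
        (\<lambda>x. LINT v|lborel. dens 0 v x *\<^sub>R h v) \<in> borel_measurable \<nu>"
      by (rule measurable_cong) (simp add: space_\<nu> integral_vlasov[OF _ _ h])
    ultimately show ?thesis by simp
  qed
  obtain N1 where N1: "\<And>m l. N1 \<le> m \<Longrightarrow> N1 \<le> l \<Longrightarrow> \<exists>d. d \<in> borel_measurable \<nu> \<and> (\<forall>x\<in>K. 0 \<le> d x \<and> d x \<le> 2) \<and>
    (LINT x|\<nu>. d x) \<le> \<eta> \<and>
    (AE x in \<nu>. \<forall>h. (\<forall>z. \<bar>h z\<bar> \<le> 1) \<longrightarrow> (\<forall>v w. \<bar>h v - h w\<bar> \<le> norm (v - w)) \<longrightarrow>
      \<bar>(LINT v|local_empirical k F K u m l 0 x. h v) - (LINT v|vlasov_measure \<rho> 0 x. h v)\<bar> \<le> d x)"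
    using initial_majorant[OF init prob_vlasov sets_vlasov meas0 \<eta>(1)] by auto
  have "\<forall>\<^sub>F m in sequentially. pair.deviation m W < \<eta>"
    by (rule order_tendstoD(2)[OF pair.deviation_tendsto_0[OF integrable_W] \<eta>(1)])
  then obtain N2 where N2: "\<And>m. N2 \<le> m \<Longrightarrow> pair.deviation m W < \<eta>" by (auto simp: eventually_sequentially)
  \<comment> \<open>The particle systems are given from level \<open>1\<close> on, whence the first argument of the maximum.\<close>
  show ?thesis
  proof (intro exI[of _ "max 1 (max N1 N2)"] allI impI)
    fix m l assume m: "max 1 (max N1 N2) \<le> m" and l: "max 1 (max N1 N2) \<le> l"
    obtain d where d: "d \<in> borel_measurable \<nu>" "\<forall>x\<in>K. 0 \<le> d x \<and> d x \<le> 2" "(LINT x|\<nu>. d x) \<le> \<eta>"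
      "AE x in \<nu>. \<forall>h. (\<forall>z. \<bar>h z\<bar> \<le> 1) \<longrightarrow> (\<forall>v w. \<bar>h v - h w\<bar> \<le> norm (v - w)) \<longrightarrow>
        \<bar>(LINT v|local_empirical k F K u m l 0 x. h v) - (LINT v|vlasov_measure \<rho> 0 x. h v)\<bar> \<le> d x"
      using N1[of m l] m l by auto
    interpret level: mean_field_level k F K \<nu> W f D L\<^sub>f L\<^sub>D u \<rho> m l T d
      by unfold_locales (use d m T in auto)
    have level_constants: "level.growth = growth" "level.coupling = coupling"
      by (simp_all add: level.growth_def growth_def level.coupling_def coupling_def)
    have "growth * ((LINT x|\<nu>. d x) + T * (2 * (2 * pair.deviation m W + coupling * (LINT x|\<nu>. d x))
      * exp ((2 * coupling + 1) * T))) \<le> growth * (\<eta> + T * (2 * (2 * \<eta> + coupling * \<eta>) * exp ((2 * coupling + 1) * T)))"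
      using g T d(3) N2[of m] m by (intro mult_left_mono add_mono mult_right_mono) auto
    also have "\<dots> = A * \<eta>" by (simp add: A_def algebra_simps)
    finally have le: "growth * ((LINT x|\<nu>. d x) + T * (2 * (2 * pair.deviation m W + coupling * (LINT x|\<nu>. d x))
      * exp ((2 * coupling + 1) * T))) \<le> \<epsilon> / 2" using \<eta> by simp
    have "(SUP t\<in>{0..T}. \<integral>\<^sup>+x. d_BL (local_empirical k F K u m l t x) (vlasov_measure \<rho> t x) \<partial>\<nu>) \<le> ennreal (\<epsilon> / 2)"
    proof (rule SUP_least)
      fix t assume "t \<in> {0..T}"
      from level.level_estimate[OF this] show "(\<integral>\<^sup>+x. d_BL (local_empirical k F K u m l t x) (vlasov_measure \<rho> t x) \<partial>\<nu>) \<le> ennreal (\<epsilon> / 2)"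
        unfolding level_constants by (rule order_trans) (rule ennreal_leI[OF le])
    qed
    also have "\<dots> < ennreal \<epsilon>" using \<epsilon> by (simp add: ennreal_less_iff)
    finally show "(SUP t\<in>{0..T}. \<integral>\<^sup>+x. d_BL (local_empirical k F K u m l t x) (vlasov_measure \<rho> t x) \<partial>\<nu>) < ennreal \<epsilon>" .
  qed
qed

end

theorem theorem4p5:
  fixes k :: nat and F :: "nat \<Rightarrow> 'a::euclidean_space \<Rightarrow> 'a"
    and K :: "'a set" and \<nu> :: "'a measure"
    and W :: "'a \<times> 'a \<Rightarrow> real"
    and f :: "real \<Rightarrow> 'b::euclidean_space \<Rightarrow> 'b" and D :: "'b \<Rightarrow> 'b \<Rightarrow> 'b"
    and L\<^sub>f L\<^sub>D :: real
    and u :: "nat list \<Rightarrow> real \<Rightarrow> 'b"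
    and \<rho> :: "real \<Rightarrow> 'b \<Rightarrow> 'a \<Rightarrow> real"
    and \<epsilon> T :: real
  assumes ifs: "contracting_ifs k F"
    and attr: "attractor k F K"
    and stat: "stationary_measure k F K \<nu>"
    and cells: "\<And>n w. w \<in> words k n \<Longrightarrow> measure \<nu> (cell F K w) = 1 / real k ^ n"
    and W_meas: "W \<in> borel_measurable (\<nu> \<Otimes>\<^sub>M \<nu>)"
    and W_L2: "integrable (\<nu> \<Otimes>\<^sub>M \<nu>) (\<lambda>p. (W p)\<^sup>2)"
    and W_bound: "max (esssup \<nu> (\<lambda>x. \<integral>\<^sup>+y. ennreal \<bar>W (x, y)\<bar> \<partial>\<nu>))
                      (esssup \<nu> (\<lambda>y. \<integral>\<^sup>+x. ennreal \<bar>W (x, y)\<bar> \<partial>\<nu>)) < \<infinity>"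
    and f_cont: "continuous_on UNIV (\<lambda>(t, u). f t u)"
    and f_lip: "\<And>t u u'. norm (f t u - f t u') \<le> L\<^sub>f * norm (u - u')"
    and D_cont: "continuous_on UNIV (\<lambda>(u, v). D u v)"
    and D_lip: "\<And>u v u' v'. norm (D u v - D u' v') \<le> L\<^sub>D * (norm (u - u') + norm (v - v'))"
    and D_bound: "\<And>u v. norm (D u v) \<le> 1"
    and u_sol: "\<And>n. n \<ge> 1 \<Longrightarrow> particle_solution k F K \<nu> W f D n u"
    and \<rho>_sol: "vlasov_solution K \<nu> W f D \<rho>"
    and init: "AE x in \<nu>. weakly_converges
                 (\<lambda>(m, l). local_empirical k F K u m l 0 x) (vlasov_measure \<rho> 0 x)
                 (sequentially \<times>\<^sub>F sequentially)"
    and "\<epsilon> > 0" and "T > 0"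
  shows "\<exists>N. \<forall>m\<ge>N. \<forall>l\<ge>N.
           (SUP t\<in>{0..T}. \<integral>\<^sup>+x. d_BL (local_empirical k F K u m l t x) (vlasov_measure \<rho> t x) \<partial>\<nu>)
             < ennreal \<epsilon>"
proof -
  interpret mean_field k F K \<nu> W f D L\<^sub>f L\<^sub>D u \<rho>
    by (intro mean_field.intro self_similar_cells.intro mean_field_axioms.intro; fact)
  show ?thesis by (rule mean_field_limit[OF init \<open>\<epsilon> > 0\<close> \<open>T > 0\<close>])
qed

end
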